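(* Let $(\mathcal{E},D,h)$ be a harmonic bundle over a complex manifold $X$, with induced Higgs field $\theta$. Then the holomorphic distribution $\ker\theta=\{v\in TX:\theta(v)=0\}$ on $X$ defined by the Higgs field is integrable.
   Context: **Harmonic bundle.** Let $(\mathcal{E},D)$ be a flat complex vector bundle of finite rank over a complex manifold $X$ with a Hermitian metric $h$. Write uniquely $D=\nabla+\alpha$ with $\nabla$ a metric connection and $\alpha$ an $h$-Hermitian $1$-form with values in $\mathrm{End}(\mathcal{E})$, and decompose in types $\nabla=\partial+\bar\partial$, $\alpha=\theta+\theta^*$, with $\theta$ of type $(1,0)$. $(\mathcal{E},D,h)$ is a harmonic bundle if $(\bar\partial+\theta)^2=0$, i.e. $\bar\partial^2=0$, $\bar\partial\theta=0$, $\theta\wedge\theta=0$. Then $(\mathcal{E},\bar\partial)$ is a holomorphic bundle and $\theta$, called the Higgs field, is a holomorphic $1$-form with values in $\mathrm{End}(\mathcal{E})$. **Distributions.** A holomorphic distribution in $X$ is a subset of the holomorphic tangent bundle $TX$ which is locally the vanishing set of a finite number of holomorphic $1$-forms (it may be singular, i.e. of non-constant rank). A distribution is integrable if it can locally be defined by exact holomorphic $1$-forms: every point of $X$ has a neighbourhood $U$ and finitely many holomorphic functions $f_1,\dots,f_p$ on $U$ such that the distribution over $U$ is the common vanishing set of $df_1,\dots,df_p$ in $TU$. *)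

theory Defs
  imports "HOL-Analysis.Analysis"
begin

section \<open>Smooth and holomorphic functions on open subsets of complex coordinate space\<close>

primrec Ck_on :: "nat \<Rightarrow> ('a::euclidean_space \<Rightarrow> 'b::real_normed_vector) \<Rightarrow> 'a set \<Rightarrow> bool" where
  "Ck_on 0 f S \<longleftrightarrow> continuous_on S f"
| "Ck_on (Suc k) f S \<longleftrightarrow>
     (\<exists>f'. (\<forall>x\<in>S. (f has_derivative f' x) (at x)) \<and> (\<forall>v. Ck_on k (\<lambda>x. f' x v) S))"

text \<open>Only used for open sets. Smoothness on \<^typ>\<open>complex ^ 'n\<close> is real smoothness.\<close>
definition smooth_on :: "('a::euclidean_space \<Rightarrow> 'b::real_normed_vector) \<Rightarrow> 'a set \<Rightarrow> bool" where
  "smooth_on f S \<longleftrightarrow> (\<forall>k. Ck_on k f S)"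

definition holo_on :: "(complex ^ 'n \<Rightarrow> complex) \<Rightarrow> (complex ^ 'n) set \<Rightarrow> bool" where
  "holo_on f S \<longleftrightarrow>
     (\<forall>z\<in>S. \<exists>f'. (f has_derivative f') (at z) \<and> (\<forall>c v. f' (c *s v) = c * f' v))"


section \<open>Complex manifolds\<close>

type_synonym ('x, 'n) chart = "'x set \<times> ('x \<Rightarrow> complex ^ 'n)"

definition chart_inv :: "('x, 'n) chart \<Rightarrow> complex ^ 'n \<Rightarrow> 'x" where
  "chart_inv c = inv_into (fst c) (snd c)"

definition complex_manifold ::
  "('x::{t2_space, second_countable_topology}, 'n::finite) chart set \<Rightarrow> bool" where
  "complex_manifold A \<longleftrightarrow>
     (\<forall>c\<in>A. open (fst c) \<and> open (snd c ` fst c) \<and>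
            homeomorphism (fst c) (snd c ` fst c) (snd c) (chart_inv c)) \<and>
     (\<Union>c\<in>A. fst c) = UNIV \<and>
     (\<forall>c\<in>A. \<forall>c'\<in>A. \<forall>i. holo_on (\<lambda>z. snd c' (chart_inv c z) $ i) (snd c ` (fst c \<inter> fst c')))"

definition smooth_fun ::
  "('x, 'n::finite) chart set \<Rightarrow> 'x set \<Rightarrow> ('x \<Rightarrow> 'b::real_normed_vector) \<Rightarrow> bool" where
  "smooth_fun A U f \<longleftrightarrow> (\<forall>c\<in>A. smooth_on (f \<circ> chart_inv c) (snd c ` (fst c \<inter> U)))"

definition holo_fun :: "('x, 'n::finite) chart set \<Rightarrow> 'x set \<Rightarrow> ('x \<Rightarrow> complex) \<Rightarrow> bool" where
  "holo_fun A U f \<longleftrightarrow> (\<forall>c\<in>A. holo_on (f \<circ> chart_inv c) (snd c ` (fst c \<inter> U)))"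


section \<open>The tangent bundle\<close>

text \<open>A tangent vector at \<open>x\<close> is a pair of \<open>x\<close> and the family of its coordinate vectors in all
  charts around \<open>x\<close>, related by the differentials of the transition maps; the family is \<open>0\<close> at all
  other arguments. The complex vector space of these vectors is the holomorphic tangent space.
  Its underlying real vector space is the real tangent space, on which multiplication by
  \<open>\<i>\<close> is the complex structure; the identification of the real tangent space with the
  holomorphic one is \<open>v \<mapsto> (v - \<i> J v) / 2\<close>.\<close>
type_synonym ('x, 'n) tvec = "'x \<times> (('x, 'n) chart \<Rightarrow> complex ^ 'n)"

definition tangent_bundle :: "('x, 'n::finite) chart set \<Rightarrow> ('x, 'n) tvec set" where
  "tangent_bundle A = {(x, \<xi>).
     (\<forall>c\<in>A. \<forall>c'\<in>A. x \<in> fst c \<inter> fst c' \<longrightarrow>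
        \<xi> c' = frechet_derivative (snd c' \<circ> chart_inv c) (at (snd c x)) (\<xi> c)) \<and>
     (\<forall>c. \<not> (c \<in> A \<and> x \<in> fst c) \<longrightarrow> \<xi> c = 0)}"

text \<open>Addition is only meaningful for vectors at the same point.\<close>
definition tadd :: "('x, 'n::finite) tvec \<Rightarrow> ('x, 'n) tvec \<Rightarrow> ('x, 'n) tvec" where
  "tadd v w = (fst v, \<lambda>c. snd v c + snd w c)"

definition tscale :: "complex \<Rightarrow> ('x, 'n::finite) tvec \<Rightarrow> ('x, 'n) tvec" where
  "tscale k v = (fst v, \<lambda>c. k *s snd v c)"

text \<open>For a fixed chart \<open>c\<close> and fixed \<open>a\<close>, the map \<open>x \<mapsto> coord_vec A c a x\<close> is the vector
  field on the domain of \<open>c\<close> with constant coordinates \<open>a\<close>.\<close>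
definition coord_vec ::
  "('x, 'n::finite) chart set \<Rightarrow> ('x, 'n) chart \<Rightarrow> complex ^ 'n \<Rightarrow> 'x \<Rightarrow> ('x, 'n) tvec" where
  "coord_vec A c a x =
     (x, \<lambda>c'. if c' \<in> A \<and> x \<in> fst c'
              then frechet_derivative (snd c' \<circ> chart_inv c) (at (snd c x)) a else 0)"

text \<open>The differential of a function, as a function of tangent vectors; by the chain rule the
  choice of the chart is immaterial.\<close>
definition mdiff ::
  "('x, 'n::finite) chart set \<Rightarrow> ('x \<Rightarrow> 'b::real_normed_vector) \<Rightarrow> ('x, 'n) tvec \<Rightarrow> 'b" where
  "mdiff A f v =
     (let c = (SOME c. c \<in> A \<and> fst v \<in> fst c)
      in frechet_derivative (f \<circ> chart_inv c) (at (snd c (fst v))) (snd v c))"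


section \<open>Holomorphic distributions\<close>

definition holo_one_form ::
  "('x, 'n::finite) chart set \<Rightarrow> 'x set \<Rightarrow> (('x, 'n) tvec \<Rightarrow> complex) \<Rightarrow> bool" where
  "holo_one_form A U \<omega> \<longleftrightarrow>
     (\<forall>v\<in>tangent_bundle A. \<forall>w\<in>tangent_bundle A. fst v \<in> U \<and> fst w = fst v \<longrightarrow>
        \<omega> (tadd v w) = \<omega> v + \<omega> w \<and> (\<forall>k. \<omega> (tscale k v) = k * \<omega> v)) \<and>
     (\<forall>c\<in>A. \<forall>a. holo_fun A (U \<inter> fst c) (\<lambda>x. \<omega> (coord_vec A c a x)))"

definition holomorphic_distribution ::
  "('x::topological_space, 'n::finite) chart set \<Rightarrow> ('x, 'n) tvec set \<Rightarrow> bool" where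
  "holomorphic_distribution A \<Delta> \<longleftrightarrow> \<Delta> \<subseteq> tangent_bundle A \<and>
     (\<forall>p. \<exists>U W. open U \<and> p \<in> U \<and> finite W \<and> (\<forall>\<omega>\<in>W. holo_one_form A U \<omega>) \<and>
        (\<forall>v\<in>tangent_bundle A. fst v \<in> U \<longrightarrow> (v \<in> \<Delta> \<longleftrightarrow> (\<forall>\<omega>\<in>W. \<omega> v = 0))))"

definition integrable_distribution ::
  "('x::topological_space, 'n::finite) chart set \<Rightarrow> ('x, 'n) tvec set \<Rightarrow> bool" where
  "integrable_distribution A \<Delta> \<longleftrightarrow>
     (\<forall>p. \<exists>U F. open U \<and> p \<in> U \<and> finite F \<and> (\<forall>f\<in>F. holo_fun A U f) \<and>
        (\<forall>v\<in>tangent_bundle A. fst v \<in> U \<longrightarrow> (v \<in> \<Delta> \<longleftrightarrow> (\<forall>f\<in>F. mdiff A f v = 0))))"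


section \<open>Smooth complex vector bundles\<close>

text \<open>A bundle is given by its total space (the type \<open>'e\<close>), projection, fibrewise vector space
  operations, and a bundle atlas of local trivialisations \<open>(U, \<tau>)\<close>, where \<open>\<tau>\<close> maps the fibres
  over \<open>U\<close> to the standard fibre \<^typ>\<open>complex ^ 'r\<close>. The topology and the
  smooth structure of the total space are those induced by the trivialisations.\<close>
record ('x, 'e, 'r) vbundle =
  bproj :: "'e \<Rightarrow> 'x"
  vadd :: "'e \<Rightarrow> 'e \<Rightarrow> 'e"
  vscale :: "complex \<Rightarrow> 'e \<Rightarrow> 'e"
  vzero :: "'x \<Rightarrow> 'e"
  trivs :: "('x set \<times> ('e \<Rightarrow> complex ^ 'r)) set"

definition fibre :: "('x, 'e, 'r::finite) vbundle \<Rightarrow> 'x \<Rightarrow> 'e set" where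
  "fibre E x = {e. bproj E e = x}"

definition smooth_vector_bundle ::
  "('x::topological_space, 'n::finite) chart set \<Rightarrow> ('x, 'e, 'r::finite) vbundle \<Rightarrow> bool" where
  "smooth_vector_bundle A E \<longleftrightarrow>
     (\<Union>(U, \<tau>)\<in>trivs E. U) = UNIV \<and>
     (\<forall>(U, \<tau>)\<in>trivs E. open U \<and>
        (\<forall>x\<in>U. bij_betw \<tau> (fibre E x) UNIV \<and>
           vzero E x \<in> fibre E x \<and> \<tau> (vzero E x) = 0 \<and>
           (\<forall>e\<in>fibre E x. \<forall>e'\<in>fibre E x.
              vadd E e e' \<in> fibre E x \<and> \<tau> (vadd E e e') = \<tau> e + \<tau> e') \<and>
           (\<forall>e\<in>fibre E x. \<forall>k.
              vscale E k e \<in> fibre E x \<and> \<tau> (vscale E k e) = k *s \<tau> e))) \<and>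
     (\<forall>(U, \<tau>)\<in>trivs E. \<forall>(V, \<sigma>)\<in>trivs E. \<forall>b.
        smooth_fun A (U \<inter> V) (\<lambda>x. \<sigma> (inv_into (fibre E x) \<tau> b)))"

text \<open>Local sections over \<open>U\<close> are total functions whose values outside \<open>U\<close> are irrelevant.\<close>
definition smooth_section ::
  "('x::topological_space, 'n::finite) chart set \<Rightarrow> ('x, 'e, 'r::finite) vbundle \<Rightarrow> 'x set \<Rightarrow>
     ('x \<Rightarrow> 'e) \<Rightarrow> bool" where
  "smooth_section A E U s \<longleftrightarrow> open U \<and> (\<forall>x\<in>U. s x \<in> fibre E x) \<and>
     (\<forall>(V, \<tau>)\<in>trivs E. smooth_fun A (U \<inter> V) (\<tau> \<circ> s))"

text \<open>Complex-valued one-forms with values in \<open>E\<close>, as real-linear functions on the real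
  tangent spaces.\<close>
definition bundle_one_form ::
  "('x::topological_space, 'n::finite) chart set \<Rightarrow> ('x, 'e, 'r::finite) vbundle \<Rightarrow> 'x set \<Rightarrow>
     (('x, 'n) tvec \<Rightarrow> 'e) \<Rightarrow> bool" where
  "bundle_one_form A E U \<eta> \<longleftrightarrow>
     (\<forall>v\<in>tangent_bundle A. \<forall>w\<in>tangent_bundle A. fst v \<in> U \<and> fst w = fst v \<longrightarrow>
        \<eta> v \<in> fibre E (fst v) \<and> \<eta> (tadd v w) = vadd E (\<eta> v) (\<eta> w) \<and>
        (\<forall>k::real. \<eta> (tscale (complex_of_real k) v) = vscale E (complex_of_real k) (\<eta> v))) \<and>
     (\<forall>c\<in>A. \<forall>a. smooth_section A E (U \<inter> fst c) (\<lambda>x. \<eta> (coord_vec A c a x)))"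

definition part10 ::
  "('x, 'e, 'r::finite) vbundle \<Rightarrow> (('x, 'n::finite) tvec \<Rightarrow> 'e) \<Rightarrow> ('x, 'n) tvec \<Rightarrow> 'e" where
  "part10 E \<eta> v = vscale E (1/2) (vadd E (\<eta> v) (vscale E (- \<i>) (\<eta> (tscale \<i> v))))"

definition part01 ::
  "('x, 'e, 'r::finite) vbundle \<Rightarrow> (('x, 'n::finite) tvec \<Rightarrow> 'e) \<Rightarrow> ('x, 'n) tvec \<Rightarrow> 'e" where
  "part01 E \<eta> v = vscale E (1/2) (vadd E (\<eta> v) (vscale E \<i> (\<eta> (tscale \<i> v))))"


section \<open>Connections and metrics\<close>

text \<open>\<open>D s v\<close> is the covariant derivative of the local section \<open>s\<close> in direction \<open>v\<close>. The
  second clause says that it depends only on the germ of \<open>s\<close>, so that \<open>D\<close> is a morphism from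
  the sheaf of smooth sections to the sheaf of smooth \<open>E\<close>-valued one-forms.\<close>
definition connection ::
  "('x::topological_space, 'n::finite) chart set \<Rightarrow> ('x, 'e, 'r::finite) vbundle \<Rightarrow>
     (('x \<Rightarrow> 'e) \<Rightarrow> ('x, 'n) tvec \<Rightarrow> 'e) \<Rightarrow> bool" where
  "connection A E D \<longleftrightarrow>
     (\<forall>U s. smooth_section A E U s \<longrightarrow> bundle_one_form A E U (D s)) \<and>
     (\<forall>U s t. smooth_section A E U s \<and> (\<forall>x\<in>U. t x = s x) \<longrightarrow>
        (\<forall>v\<in>tangent_bundle A. fst v \<in> U \<longrightarrow> D t v = D s v)) \<and>
     (\<forall>U s t. smooth_section A E U s \<and> smooth_section A E U t \<longrightarrow>
        (\<forall>v\<in>tangent_bundle A. fst v \<in> U \<longrightarrow>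
           D (\<lambda>x. vadd E (s x) (t x)) v = vadd E (D s v) (D t v))) \<and>
     (\<forall>U s (f :: 'x \<Rightarrow> complex). smooth_section A E U s \<and> smooth_fun A U f \<longrightarrow>
        (\<forall>v\<in>tangent_bundle A. fst v \<in> U \<longrightarrow>
           D (\<lambda>x. vscale E (f x) (s x)) v =
             vadd E (vscale E (mdiff A f v) (s (fst v))) (vscale E (f (fst v)) (D s v))))"

text \<open>\<open>P \<circ> P = 0\<close> for a first order operator \<open>P\<close> such as \<open>D\<close> or \<open>\<partial>bar + \<theta>\<close>, where \<open>P\<close> is
  extended to \<open>E\<close>-valued one-forms by the Leibniz rule. The extension is
  \<open>(P \<eta>)(V, W) = P\<^sub>V (\<eta> W) - P\<^sub>W (\<eta> V)\<close> for vector fields \<open>V\<close> and \<open>W\<close> with constant coordinates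
  in a holomorphic chart: these commute, so there is no bracket term, and the
  one-forms dual to a coordinate frame are killed by \<open>d\<close> and by \<open>\<partial>bar\<close>.\<close>
definition squares_to_zero ::
  "('x::topological_space, 'n::finite) chart set \<Rightarrow> ('x, 'e, 'r::finite) vbundle \<Rightarrow>
     (('x \<Rightarrow> 'e) \<Rightarrow> ('x, 'n) tvec \<Rightarrow> 'e) \<Rightarrow> bool" where
  "squares_to_zero A E P \<longleftrightarrow>
     (\<forall>U s. smooth_section A E U s \<longrightarrow>
        (\<forall>c\<in>A. \<forall>a b. \<forall>x\<in>U \<inter> fst c.
           P (\<lambda>y. P s (coord_vec A c b y)) (coord_vec A c a x) =
           P (\<lambda>y. P s (coord_vec A c a y)) (coord_vec A c b x)))"

definition flat_connection ::
  "('x::topological_space, 'n::finite) chart set \<Rightarrow> ('x, 'e, 'r::finite) vbundle \<Rightarrow>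
     (('x \<Rightarrow> 'e) \<Rightarrow> ('x, 'n) tvec \<Rightarrow> 'e) \<Rightarrow> bool" where
  "flat_connection A E D \<longleftrightarrow> connection A E D \<and> squares_to_zero A E D"

text \<open>Linear in the first argument, conjugate-linear in the second.\<close>
definition hermitian_metric ::
  "('x::topological_space, 'n::finite) chart set \<Rightarrow> ('x, 'e, 'r::finite) vbundle \<Rightarrow>
     ('e \<Rightarrow> 'e \<Rightarrow> complex) \<Rightarrow> bool" where
  "hermitian_metric A E h \<longleftrightarrow>
     (\<forall>x. \<forall>e\<in>fibre E x. \<forall>e'\<in>fibre E x.
        (\<forall>e''\<in>fibre E x. h (vadd E e e') e'' = h e e'' + h e' e'') \<and>
        (\<forall>k. h (vscale E k e) e' = k * h e e') \<and>
        h e' e = cnj (h e e') \<and>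
        (e \<noteq> vzero E x \<longrightarrow> 0 < Re (h e e))) \<and>
     (\<forall>U s t. smooth_section A E U s \<and> smooth_section A E U t \<longrightarrow>
        smooth_fun A U (\<lambda>x. h (s x) (t x)))"

definition metric_connection ::
  "('x::topological_space, 'n::finite) chart set \<Rightarrow> ('x, 'e, 'r::finite) vbundle \<Rightarrow>
     ('e \<Rightarrow> 'e \<Rightarrow> complex) \<Rightarrow> (('x \<Rightarrow> 'e) \<Rightarrow> ('x, 'n) tvec \<Rightarrow> 'e) \<Rightarrow> bool" where
  "metric_connection A E h N \<longleftrightarrow> connection A E N \<and>
     (\<forall>U s t. smooth_section A E U s \<and> smooth_section A E U t \<longrightarrow>
        (\<forall>v\<in>tangent_bundle A. fst v \<in> U \<longrightarrow>
           mdiff A (\<lambda>x. h (s x) (t x)) v = h (N s v) (t (fst v)) + h (s (fst v)) (N t v)))"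

text \<open>Smooth one-forms with values in the endomorphisms of \<open>E\<close>.\<close>
definition endo_one_form ::
  "('x::topological_space, 'n::finite) chart set \<Rightarrow> ('x, 'e, 'r::finite) vbundle \<Rightarrow>
     (('x, 'n) tvec \<Rightarrow> 'e \<Rightarrow> 'e) \<Rightarrow> bool" where
  "endo_one_form A E \<alpha> \<longleftrightarrow>
     (\<forall>v\<in>tangent_bundle A. \<forall>e\<in>fibre E (fst v). \<forall>e'\<in>fibre E (fst v).
        \<alpha> v e \<in> fibre E (fst v) \<and> \<alpha> v (vadd E e e') = vadd E (\<alpha> v e) (\<alpha> v e') \<and>
        (\<forall>k. \<alpha> v (vscale E k e) = vscale E k (\<alpha> v e))) \<and>
     (\<forall>U s. smooth_section A E U s \<longrightarrow> bundle_one_form A E U (\<lambda>v. \<alpha> v (s (fst v))))"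

definition hermitian_one_form ::
  "('x::topological_space, 'n::finite) chart set \<Rightarrow> ('x, 'e, 'r::finite) vbundle \<Rightarrow>
     ('e \<Rightarrow> 'e \<Rightarrow> complex) \<Rightarrow> (('x, 'n) tvec \<Rightarrow> 'e \<Rightarrow> 'e) \<Rightarrow> bool" where
  "hermitian_one_form A E h \<alpha> \<longleftrightarrow> endo_one_form A E \<alpha> \<and>
     (\<forall>v\<in>tangent_bundle A. \<forall>e\<in>fibre E (fst v). \<forall>e'\<in>fibre E (fst v).
        h (\<alpha> v e) e' = h e (\<alpha> v e'))"


section \<open>Harmonic bundles\<close>

text \<open>\<open>D = N + \<alpha>\<close> with a metric connection \<open>N\<close> and a Hermitian one-form \<open>\<alpha>\<close>.\<close>
definition metric_decomposition ::
  "('x::topological_space, 'n::finite) chart set \<Rightarrow> ('x, 'e, 'r::finite) vbundle \<Rightarrow>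
     (('x \<Rightarrow> 'e) \<Rightarrow> ('x, 'n) tvec \<Rightarrow> 'e) \<Rightarrow> ('e \<Rightarrow> 'e \<Rightarrow> complex) \<Rightarrow>
     (('x \<Rightarrow> 'e) \<Rightarrow> ('x, 'n) tvec \<Rightarrow> 'e) \<Rightarrow> (('x, 'n) tvec \<Rightarrow> 'e \<Rightarrow> 'e) \<Rightarrow> bool" where
  "metric_decomposition A E D h N \<alpha> \<longleftrightarrow>
     metric_connection A E h N \<and> hermitian_one_form A E h \<alpha> \<and>
     (\<forall>U s. smooth_section A E U s \<longrightarrow>
        (\<forall>v\<in>tangent_bundle A. fst v \<in> U \<longrightarrow> D s v = vadd E (N s v) (\<alpha> v (s (fst v)))))"

definition form10 ::
  "('x, 'e, 'r::finite) vbundle \<Rightarrow> (('x, 'n::finite) tvec \<Rightarrow> 'e \<Rightarrow> 'e) \<Rightarrow> ('x, 'n) tvec \<Rightarrow> 'e \<Rightarrow> 'e" where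
  "form10 E \<alpha> v e = part10 E (\<lambda>w. \<alpha> w e) v"

text \<open>\<open>\<partial>bar + \<theta>\<close>, where \<open>\<partial>bar\<close> is the (0,1)-part of \<open>N\<close> and \<open>\<theta>\<close> the (1,0)-part of \<open>\<alpha>\<close>.\<close>
definition dbar_plus_theta ::
  "('x, 'e, 'r::finite) vbundle \<Rightarrow> (('x \<Rightarrow> 'e) \<Rightarrow> ('x, 'n::finite) tvec \<Rightarrow> 'e) \<Rightarrow>
     (('x, 'n) tvec \<Rightarrow> 'e \<Rightarrow> 'e) \<Rightarrow> ('x \<Rightarrow> 'e) \<Rightarrow> ('x, 'n) tvec \<Rightarrow> 'e" where
  "dbar_plus_theta E N \<alpha> s v = vadd E (part01 E (N s) v) (form10 E \<alpha> v (s (fst v)))"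

text \<open>Since the decomposition is unique (on tangent vectors, fibres and germs of smooth sections),
  the existential quantifiers here and in \<open>higgs_field\<close> refer to the same decomposition.\<close>
definition harmonic_bundle ::
  "('x::topological_space, 'n::finite) chart set \<Rightarrow> ('x, 'e, 'r::finite) vbundle \<Rightarrow>
     (('x \<Rightarrow> 'e) \<Rightarrow> ('x, 'n) tvec \<Rightarrow> 'e) \<Rightarrow> ('e \<Rightarrow> 'e \<Rightarrow> complex) \<Rightarrow> bool" where
  "harmonic_bundle A E D h \<longleftrightarrow>
     smooth_vector_bundle A E \<and> flat_connection A E D \<and> hermitian_metric A E h \<and>
     (\<exists>N \<alpha>. metric_decomposition A E D h N \<alpha> \<and> squares_to_zero A E (dbar_plus_theta E N \<alpha>))"

definition higgs_field ::
  "('x::topological_space, 'n::finite) chart set \<Rightarrow> ('x, 'e, 'r::finite) vbundle \<Rightarrow>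
     (('x \<Rightarrow> 'e) \<Rightarrow> ('x, 'n) tvec \<Rightarrow> 'e) \<Rightarrow> ('e \<Rightarrow> 'e \<Rightarrow> complex) \<Rightarrow>
     (('x, 'n) tvec \<Rightarrow> 'e \<Rightarrow> 'e) \<Rightarrow> bool" where
  "higgs_field A E D h \<theta> \<longleftrightarrow>
     (\<exists>N \<alpha>. metric_decomposition A E D h N \<alpha> \<and>
        (\<forall>v\<in>tangent_bundle A. \<forall>e\<in>fibre E (fst v). \<theta> v e = form10 E \<alpha> v e))"

definition higgs_kernel ::
  "('x, 'n::finite) chart set \<Rightarrow> ('x, 'e, 'r::finite) vbundle \<Rightarrow> (('x, 'n) tvec \<Rightarrow> 'e \<Rightarrow> 'e) \<Rightarrow>
     ('x, 'n) tvec set" where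
  "higgs_kernel A E \<theta> =
     {v \<in> tangent_bundle A. \<forall>e\<in>fibre E (fst v). \<theta> v e = vzero E (fst v)}"

end

theory Submission
  imports Defs "HOL-Complex_Analysis.Complex_Analysis"
begin

text \<open>Write \<open>D = \<nabla> + \<theta> + \<theta>*\<close> for the flat connection. Flatness of \<open>D\<close>, the equation
  \<open>(\<partial>bar + \<theta>)\<^sup>2 = 0\<close> and the adjoints of these equations say together that the connection
  \<open>\<nabla> + \<lambda>\<^sup>-\<^sup>1 \<theta> + \<lambda> \<theta>*\<close> is flat for every nonzero complex number \<open>\<lambda>\<close>. Near a point \<open>p\<close> there are
  therefore matrices \<open>\<Phi>(x, \<lambda>)\<close> that carry flat sections to constants and satisfy \<open>\<Phi>(p, \<lambda>) = 1\<close>: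
  \<open>d\<Phi> = \<Phi> (\<Gamma> + \<lambda>\<^sup>-\<^sup>1 \<theta> + \<lambda> \<theta>*)\<close>, where \<open>\<Gamma>\<close> is the connection form of \<open>\<nabla>\<close> in a local frame.

  For \<open>x\<close> near \<open>p\<close> the loop \<open>\<lambda> \<mapsto> \<Phi>(x, \<lambda>)\<close> is close to \<open>1\<close> and has a Birkhoff factorisation: there is
  a power series \<open>u = u\<^sub>0 + u\<^sub>1 \<lambda> + \<dots>\<close> with \<open>w = \<Phi> u = 1 + w\<^sub>1 \<lambda>\<^sup>-\<^sup>1 + w\<^sub>2 \<lambda>\<^sup>-\<^sup>2 + \<dots>\<close>. Comparing the
  powers of \<open>\<lambda>\<close> in \<open>dw = \<Phi> ((\<Gamma> + \<lambda>\<^sup>-\<^sup>1 \<theta> + \<lambda> \<theta>*) u + du)\<close> gives \<open>dw = \<lambda>\<^sup>-\<^sup>1 w c\<close> with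
  \<open>c = u\<^sub>0\<^sup>-\<^sup>1 \<theta> u\<^sub>0\<close>, so \<open>dw\<^sub>1 = u\<^sub>0\<^sup>-\<^sup>1 \<theta> u\<^sub>0\<close>. As \<open>\<theta>\<close> is of type \<open>(1,0)\<close>, the entries of the matrix
  \<open>w\<^sub>1\<close> are holomorphic, and their differentials vanish together exactly on \<open>ker \<theta>\<close>. These entries are
  the required functions; their differentials are the holomorphic one-forms that define the
  distribution.

  The matrix \<open>\<Phi>\<close> is obtained in \<open>flat_total_differential_equation\<close> by Picard iteration, the
  factorisation and the formula for \<open>dw\<^sub>1\<close> in \<open>birkhoff_potential\<close>, where a loop is the two-sided
  sequence of its Fourier coefficients and acts by convolution, and the flatness of the family from
  \<open>harmonic_curvature_identities\<close> in \<open>higgs_potential\<close>. The differential of a holomorphic function has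
  holomorphic coefficients by the Cauchy integral formula (\<open>holo_on_directional_derivative\<close>). The
  bundle enters through its coordinates in a local frame (\<open>harmonic_frame_of_bundle\<close>).\<close>

section \<open>Flat linear total differential equations\<close>

lemmas compose_simps =
  bounded_bilinear.add_left[OF bounded_bilinear_blinfun_compose]
  bounded_bilinear.add_right[OF bounded_bilinear_blinfun_compose]
  bounded_bilinear.diff_left[OF bounded_bilinear_blinfun_compose]
  bounded_bilinear.diff_right[OF bounded_bilinear_blinfun_compose]
  bounded_bilinear.scaleR_left[OF bounded_bilinear_blinfun_compose]
  bounded_bilinear.scaleR_right[OF bounded_bilinear_blinfun_compose]

lemmas bounded_linear_compose_left = bounded_bilinear.bounded_linear_left[OF bounded_bilinear_blinfun_compose]
lemmas bounded_linear_compose_right = bounded_bilinear.bounded_linear_right[OF bounded_bilinear_blinfun_compose]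

text \<open>A solution of \<open>d\<Phi> = \<Phi> a\<close> restricted to the ray through \<open>x\<close> solves an ordinary differential
  equation; \<open>ray_integral a\<close> is its Picard operator, evaluated at the end point \<open>x\<close> of the ray.\<close>
definition ray_integral ::
  "('a::euclidean_space \<Rightarrow> 'a \<Rightarrow>\<^sub>L ('v::banach \<Rightarrow>\<^sub>L 'v)) \<Rightarrow> ('a \<Rightarrow> 'v \<Rightarrow>\<^sub>L 'v) \<Rightarrow> 'a \<Rightarrow> 'v \<Rightarrow>\<^sub>L 'v" where
  "ray_integral a \<Psi> x = integral {0..1::real} (\<lambda>t. \<Psi> (t *\<^sub>R x) o\<^sub>L a (t *\<^sub>R x) x)"

text \<open>The integrand in the derivative of \<open>ray_integral a \<Psi>\<close> at \<open>x\<close> in direction \<open>w\<close>.\<close>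
abbreviation ray_deriv where
  "ray_deriv a a' \<Psi> \<Psi>' x w t \<equiv> t *\<^sub>R (blinfun_apply (\<Psi>' (t *\<^sub>R x)) w o\<^sub>L blinfun_apply (a (t *\<^sub>R x)) x)
     + (\<Psi> (t *\<^sub>R x) o\<^sub>L (t *\<^sub>R blinfun_apply (blinfun_apply (a' (t *\<^sub>R x)) w) x + blinfun_apply (a (t *\<^sub>R x)) w))"

abbreviation defect_integrand where
  "defect_integrand a E \<Psi> \<Theta> x w t \<equiv>
     t *\<^sub>R ((E (t *\<^sub>R x) w o\<^sub>L blinfun_apply (a (t *\<^sub>R x)) x) - (E (t *\<^sub>R x) x o\<^sub>L blinfun_apply (a (t *\<^sub>R x)) w)
       + ((\<Psi> (t *\<^sub>R x) - \<Theta> (t *\<^sub>R x)) o\<^sub>L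
          ((blinfun_apply (a (t *\<^sub>R x)) x o\<^sub>L blinfun_apply (a (t *\<^sub>R x)) w) - (blinfun_apply (a (t *\<^sub>R x)) w o\<^sub>L blinfun_apply (a (t *\<^sub>R x)) x))))"

lemma scaleR_in_ball0: "t *\<^sub>R x \<in> ball 0 r" if "x \<in> ball 0 r" "t \<in> {0..1::real}"
  for x :: "'a::real_normed_vector"
  using that mult_left_le_one_le[of "norm x" t] by simp

lemma continuous_on_ray [continuous_intros]:
  fixes f :: "'a::real_normed_vector \<Rightarrow> 'b::topological_space"
  assumes "continuous_on (ball 0 r) f"
  shows "continuous_on (ball 0 r \<times> {0..1::real}) (\<lambda>p. f (snd p *\<^sub>R fst p))"
  by (intro continuous_on_compose2[OF assms] continuous_intros) (use scaleR_in_ball0 in fastforce)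

lemma continuous_on_ray1:
  fixes f :: "'a::real_normed_vector \<Rightarrow> 'b::topological_space"
  assumes "continuous_on (ball 0 r) f" "x \<in> ball 0 r"
  shows "continuous_on {0..1::real} (\<lambda>t. f (t *\<^sub>R x))"
  by (intro continuous_on_compose2[OF assms(1)] continuous_intros) (use scaleR_in_ball0 assms(2) in blast)

lemma ray_integral_has_derivative:
  fixes a :: "'a::euclidean_space \<Rightarrow> 'a \<Rightarrow>\<^sub>L ('v::banach \<Rightarrow>\<^sub>L 'v)"
  assumes a: "\<And>x. x \<in> ball 0 r \<Longrightarrow> (a has_derivative blinfun_apply (a' x)) (at x)"
    and ca': "continuous_on (ball 0 r) a'"
    and P: "\<And>x. x \<in> ball 0 r \<Longrightarrow> (\<Psi> has_derivative blinfun_apply (\<Psi>' x)) (at x)"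
    and cP': "continuous_on (ball 0 r) \<Psi>'"
  obtains K' where "continuous_on (ball 0 r) K'"
    "\<And>x. x \<in> ball 0 r \<Longrightarrow> (ray_integral a \<Psi> has_derivative blinfun_apply (K' x)) (at x)"
    "\<And>x w. x \<in> ball 0 r \<Longrightarrow> (ray_deriv a a' \<Psi> \<Psi>' x w has_integral K' x w) {0..1::real}"
proof -
  let ?U = "ball (0::'a) r"
  have ca: "continuous_on ?U a"
    by (meson a has_derivative_continuous continuous_at_imp_continuous_on)
  have cP: "continuous_on ?U \<Psi>"
    by (meson P has_derivative_continuous continuous_at_imp_continuous_on)
  define g where "g x t w = t *\<^sub>R (\<Psi>' (t *\<^sub>R x) w o\<^sub>L a (t *\<^sub>R x) x)
            + (\<Psi> (t *\<^sub>R x) o\<^sub>L (t *\<^sub>R a' (t *\<^sub>R x) w x + a (t *\<^sub>R x) w))" for x w :: 'a and t :: real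
  have bl: "bounded_linear (g x t)" for x t
    unfolding g_def
    by (intro bounded_linear_add bounded_linear_const_scaleR bounded_linear_compose[OF bounded_linear_compose_left] 
          bounded_linear_compose[OF bounded_linear_compose_right] blinfun.bounded_linear_right 
          bounded_linear_compose[OF blinfun.bounded_linear_left])
  define fx where "fx x t = Blinfun (g x t)" for x t
  have fx: "blinfun_apply (fx x t) w = g x t w" for x t w
    unfolding fx_def by (simp add: bounded_linear_Blinfun_apply[OF bl])
  have cfx: "continuous_on (?U \<times> cbox 0 1) (\<lambda>(x,t). fx x t)"
    unfolding case_prod_unfold
  proof (rule continuous_on_blinfun_componentwise)
    fix i :: 'a
    show "continuous_on (?U \<times> cbox 0 1) (\<lambda>p. blinfun_apply (fx (fst p) (snd p)) i)"
      unfolding fx g_def cbox_interval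
      by (intro continuous_intros ca ca' cP cP')
  qed
  have der: "((\<lambda>x. \<Psi> (t *\<^sub>R x) o\<^sub>L a (t *\<^sub>R x) x) has_derivative blinfun_apply (fx x t)) (at x within ?U)"
    if x: "x \<in> ?U" and t: "t \<in> cbox 0 1" for x t
  proof -
    have tx: "t *\<^sub>R x \<in> ?U" using scaleR_in_ball0[OF x, of t] t by (simp add: cbox_interval)
    have 1: "((\<lambda>x. \<Psi> (t *\<^sub>R x)) has_derivative (\<lambda>w. \<Psi>' (t *\<^sub>R x) (t *\<^sub>R w))) (at x within ?U)"
      by (rule has_derivative_compose[where f="\<lambda>x. t *\<^sub>R x", OF _ P[OF tx]]) (auto intro!: derivative_eq_intros)
    have 2: "((\<lambda>x. a (t *\<^sub>R x)) has_derivative (\<lambda>w. a' (t *\<^sub>R x) (t *\<^sub>R w))) (at x within ?U)"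
      by (rule has_derivative_compose[where f="\<lambda>x. t *\<^sub>R x", OF _ a[OF tx]]) (auto intro!: derivative_eq_intros)
    have "((\<lambda>x. a (t *\<^sub>R x) x) has_derivative (\<lambda>w. a (t *\<^sub>R x) w + a' (t *\<^sub>R x) (t *\<^sub>R w) x)) (at x within ?U)"
      by (rule blinfun.FDERIV[OF 2 has_derivative_ident])
    from bounded_bilinear.FDERIV[OF bounded_bilinear_blinfun_compose 1 this] show ?thesis
      by (rule has_derivative_eq_rhs)
         (auto simp: fx g_def blinfun.bilinear_simps compose_simps algebra_simps)
  qed
  have ci: "continuous_on {0..1} (\<lambda>t. \<Psi> (t *\<^sub>R x) o\<^sub>L a (t *\<^sub>R x) x)" if "x \<in> ?U" for x
    by (intro continuous_intros continuous_on_ray1[OF cP that] continuous_on_ray1[OF ca that])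
  have int2: "(\<lambda>t. \<Psi> (t *\<^sub>R x) o\<^sub>L a (t *\<^sub>R x) x) integrable_on cbox 0 1" if "x \<in> ?U" for x
    unfolding cbox_interval by (rule integrable_continuous_real[OF ci[OF that]])
  have ifx: "fx x integrable_on {0..1}" if "x \<in> ?U" for x
  proof (rule integrable_continuous_real)
    show "continuous_on {0..1} (fx x)"
      by (rule continuous_on_compose2[OF cfx, of _ "\<lambda>t. (x,t)", simplified])
         (use that in \<open>auto intro!: continuous_intros\<close>)
  qed
  show thesis
  proof
    show "continuous_on ?U (\<lambda>x. integral {0..1} (fx x))"
      using integral_continuous_on_param[OF cfx] by (simp add: cbox_interval)
    fix x assume x: "x \<in> ?U"
    have "(ray_integral a \<Psi> has_derivative blinfun_apply (integral {0..1} (fx x))) (at x within ?U)"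
      using leibniz_rule[OF der int2 cfx x convex_ball]
      unfolding ray_integral_def by (simp add: cbox_interval)
    thus "(ray_integral a \<Psi> has_derivative blinfun_apply (integral {0..1} (fx x))) (at x)"
      using at_within_open[OF x open_ball] by simp
    fix w
    have "((\<lambda>t. blinfun_apply (fx x t) w) has_integral blinfun_apply (integral {0..1} (fx x)) w) {0..1}"
      using integrable_integral[OF ifx[OF x]]
      by (rule has_integral_linear[OF _ blinfun.bounded_linear_left, unfolded o_def])
    thus "(ray_deriv a a' \<Psi> \<Psi>' x w has_integral
             blinfun_apply (integral {0..1} (fx x)) w) {0..1::real}"
      by (simp add: fx g_def)
  qed
qed

text \<open>Suppose that \<open>\<Psi>\<close> was obtained by one Picard step from \<open>\<Theta>\<close>. The defect \<open>E = d\<Psi> - \<Theta> a\<close> measures the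
  failure of the equation for the derivative, and the next defect is an integral of the present one
  plus a multiple of \<open>\<Psi> - \<Theta>\<close>. Flatness of \<open>a\<close> is what makes the derivatives of \<open>a\<close> cancel: the
  fundamental theorem of calculus along the ray writes \<open>\<Psi> x a\<^sub>x(w)\<close> as the integral of the
  derivative of \<open>t \<Psi>(t x) a(t x) w\<close>.\<close>
lemma picard_defect_step:
  fixes a :: "'a::euclidean_space \<Rightarrow> 'a \<Rightarrow>\<^sub>L ('v::banach \<Rightarrow>\<^sub>L 'v)"
    and \<Theta> :: "'a \<Rightarrow> 'v \<Rightarrow>\<^sub>L 'v"
  assumes a: "\<And>x. x \<in> ball 0 r \<Longrightarrow> (a has_derivative blinfun_apply (a' x)) (at x)"
    and flat: "\<And>x v w. x \<in> ball 0 r \<Longrightarrow>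
       a' x v w + (a x v o\<^sub>L a x w) = a' x w v + (a x w o\<^sub>L a x v)"
    and P: "\<And>x. x \<in> ball 0 r \<Longrightarrow> (\<Psi> has_derivative blinfun_apply (\<Psi>' x)) (at x)"
    and x: "x \<in> ball 0 r"
    and K: "(ray_deriv a a' \<Psi> \<Psi>' x w has_integral K) {0..1::real}"
  defines "E \<equiv> \<lambda>y v. \<Psi>' y v - (\<Theta> y o\<^sub>L a y v)"
  shows "((defect_integrand a E \<Psi> \<Theta> x w)
          has_integral (K - (\<Psi> x o\<^sub>L a x w))) {0..1::real}"
proof -
  have "((\<lambda>t. (\<Psi> (t *\<^sub>R x) o\<^sub>L a (t *\<^sub>R x) w) + t *\<^sub>R ((\<Psi>' (t *\<^sub>R x) x o\<^sub>L a (t *\<^sub>R x) w)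
            + (\<Psi> (t *\<^sub>R x) o\<^sub>L a' (t *\<^sub>R x) x w))) has_integral
          (1 *\<^sub>R (\<Psi> (1 *\<^sub>R x) o\<^sub>L a (1 *\<^sub>R x) w) - 0 *\<^sub>R (\<Psi> (0 *\<^sub>R x) o\<^sub>L a (0 *\<^sub>R x) w))) {0..1::real}"
  proof (rule fundamental_theorem_of_calculus)
    fix t :: real assume t: "t \<in> {0..1}"
    have tx: "t *\<^sub>R x \<in> ball 0 r" using scaleR_in_ball0[OF x t] .
    have 1: "((\<lambda>t. \<Psi> (t *\<^sub>R x)) has_derivative (\<lambda>s. \<Psi>' (t *\<^sub>R x) (s *\<^sub>R x))) (at t within {0..1})"
      by (rule has_derivative_compose[where f="\<lambda>t. t *\<^sub>R x", OF _ P[OF tx]]) (auto intro!: derivative_eq_intros)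
    have 2: "((\<lambda>t. a (t *\<^sub>R x)) has_derivative (\<lambda>s. a' (t *\<^sub>R x) (s *\<^sub>R x))) (at t within {0..1})"
      by (rule has_derivative_compose[where f="\<lambda>t. t *\<^sub>R x", OF _ a[OF tx]]) (auto intro!: derivative_eq_intros)
    have 3: "((\<lambda>t. a (t *\<^sub>R x) w) has_derivative (\<lambda>s. a' (t *\<^sub>R x) (s *\<^sub>R x) w)) (at t within {0..1})"
      using bounded_linear.has_derivative[OF blinfun.bounded_linear_left 2] .
    have 4: "((\<lambda>t. t *\<^sub>R (\<Psi> (t *\<^sub>R x) o\<^sub>L a (t *\<^sub>R x) w)) has_derivative
       (\<lambda>s. t *\<^sub>R ((\<Psi> (t *\<^sub>R x) o\<^sub>L a' (t *\<^sub>R x) (s *\<^sub>R x) w) + (\<Psi>' (t *\<^sub>R x) (s *\<^sub>R x) o\<^sub>L a (t *\<^sub>R x) w))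
          + s *\<^sub>R (\<Psi> (t *\<^sub>R x) o\<^sub>L a (t *\<^sub>R x) w))) (at t within {0..1})"
      by (rule has_derivative_scaleR[OF has_derivative_ident bounded_bilinear.FDERIV[OF bounded_bilinear_blinfun_compose 1 3]])
    show "((\<lambda>t. t *\<^sub>R (\<Psi> (t *\<^sub>R x) o\<^sub>L a (t *\<^sub>R x) w)) has_vector_derivative
        (\<Psi> (t *\<^sub>R x) o\<^sub>L a (t *\<^sub>R x) w) + t *\<^sub>R ((\<Psi>' (t *\<^sub>R x) x o\<^sub>L a (t *\<^sub>R x) w)
            + (\<Psi> (t *\<^sub>R x) o\<^sub>L a' (t *\<^sub>R x) x w))) (at t within {0..1})"
      unfolding has_vector_derivative_def
      by (rule has_derivative_eq_rhs[OF 4])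
         (auto simp: blinfun.bilinear_simps compose_simps algebra_simps fun_eq_iff)
  qed auto
  from has_integral_diff[OF K this]
  have *: "((\<lambda>t. ray_deriv a a' \<Psi> \<Psi>' x w t - 
             ((\<Psi> (t *\<^sub>R x) o\<^sub>L a (t *\<^sub>R x) w) + t *\<^sub>R ((\<Psi>' (t *\<^sub>R x) x o\<^sub>L a (t *\<^sub>R x) w)
            + (\<Psi> (t *\<^sub>R x) o\<^sub>L a' (t *\<^sub>R x) x w)))) has_integral (K - (\<Psi> x o\<^sub>L a x w))) {0..1}"
    by simp
  show ?thesis
  proof (rule has_integral_eq[OF _ *])
    fix t :: real assume t: "t \<in> {0..1}"
    define y where "y = t *\<^sub>R x"
    have tx: "y \<in> ball 0 r" using scaleR_in_ball0[OF x t] by (simp add: y_def)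
    have f: "a' y w x = a' y x w + (a y x o\<^sub>L a y w) - (a y w o\<^sub>L a y x)"
      using flat[OF tx, of w x] by (simp add: algebra_simps)
    show "ray_deriv a a' \<Psi> \<Psi>' x w t - 
             ((\<Psi> (t *\<^sub>R x) o\<^sub>L a (t *\<^sub>R x) w) + t *\<^sub>R ((\<Psi>' (t *\<^sub>R x) x o\<^sub>L a (t *\<^sub>R x) w)
            + (\<Psi> (t *\<^sub>R x) o\<^sub>L a' (t *\<^sub>R x) x w))) = 
       defect_integrand a E \<Psi> \<Theta> x w t"
      unfolding y_def[symmetric] E_def f
      by (rule blinfun_eqI) (simp add: blinfun.bilinear_simps compose_simps algebra_simps)
  qed
qed

text \<open>The Picard iterates along rays converge uniformly on a small ball, and by \<open>picard_defect_step\<close> so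
  do their derivatives, with the limit required by the equation. An operator \<open>Q\<close> that commutes with
  the coefficients commutes with all iterates and hence with \<open>\<Phi>\<close>; applied to multiplication by
  scalars and by \<open>\<lambda>\<close> this makes \<open>\<Phi>\<close> complex linear and a convolution operator.\<close>
theorem flat_total_differential_equation:
  fixes a :: "'a::euclidean_space \<Rightarrow> 'a \<Rightarrow>\<^sub>L ('v::banach \<Rightarrow>\<^sub>L 'v)"
  assumes S: "open S" "0 \<in> S"
    and a: "\<And>x. x \<in> S \<Longrightarrow> (a has_derivative blinfun_apply (a' x)) (at x)"
    and ca': "continuous_on S a'"
    and flat: "\<And>x v w. x \<in> S \<Longrightarrow> a' x v w + (a x v o\<^sub>L a x w) = a' x w v + (a x w o\<^sub>L a x v)"
  obtains r \<Phi> where "r > 0" "ball 0 r \<subseteq> S" "\<Phi> 0 = id_blinfun"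
    "\<And>x. x \<in> ball 0 r \<Longrightarrow> (\<Phi> has_derivative (\<lambda>w. \<Phi> x o\<^sub>L a x w)) (at x)"
    "\<And>Q x. (\<And>x w. x \<in> S \<Longrightarrow> (Q o\<^sub>L a x w) = (a x w o\<^sub>L Q)) \<Longrightarrow> x \<in> ball 0 r \<Longrightarrow> (Q o\<^sub>L \<Phi> x) = (\<Phi> x o\<^sub>L Q)"
proof -
  obtain r0 where r0: "r0 > 0" "cball 0 r0 \<subseteq> S"
    using S open_contains_cball by blast
  have caS: "continuous_on S a"
    by (meson a has_derivative_continuous continuous_at_imp_continuous_on)
  have "compact (a ` cball 0 r0)"
    by (intro compact_continuous_image continuous_on_subset[OF caS] r0 compact_cball)
  then obtain M where M: "M > 0" "\<And>x. x \<in> cball 0 r0 \<Longrightarrow> norm (a x) \<le> M"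
    using bounded_pos[of "a ` cball 0 r0"] compact_imp_bounded by blast
  \<comment> \<open>On this ball one Picard step contracts by the factor \<open>1/8\<close>; the bound for the defect is then halved in each step.\<close>
  define r where "r = min r0 (1 / (8 * M))"
  have r: "r > 0" "r \<le> r0" "M * r \<le> 1/8"
    using r0 M(1) by (auto simp: r_def min_def field_simps)
  let ?U = "ball (0::'a) r"
  have US: "?U \<subseteq> S" using r r0 by (auto simp: subset_iff)
  note aU = a[OF subsetD[OF US]] and flatU = flat[OF subsetD[OF US]]
  note ca'U = continuous_on_subset[OF ca' US]
  have caU: "continuous_on ?U a" using caS US continuous_on_subset by blast
  have na: "norm (a x) \<le> M" if "x \<in> ?U" for x using M(2) that r by auto
  have naw: "norm (a x w) \<le> M * norm w" if "x \<in> ?U" for x w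
    by (rule order_trans[OF norm_blinfun mult_right_mono[OF na[OF that]]]) simp
  have nax: "norm (a y x) \<le> 1/8" if "x \<in> ?U" "y \<in> ?U" for x y
  proof -
    have "norm (a y x) \<le> M * r"
      by (rule order_trans[OF naw[OF that(2)]]) (use that M in auto)
    thus ?thesis using r by simp
  qed

  \<comment> \<open>The iteration starts at \<open>0\<close>, so that the first iterate is constant and has defect \<open>0\<close>.\<close>
  define P where "P = rec_nat (\<lambda>_. 0) (\<lambda>_ \<Psi> x. id_blinfun + ray_integral a \<Psi> x)"
  have P0: "P 0 = (\<lambda>_. 0)" and PS: "P (Suc n) = (\<lambda>x. id_blinfun + ray_integral a (P n) x)" for n
    by (simp_all add: P_def)
  have C1: "\<exists>D. (\<forall>x\<in>?U. (P n has_derivative blinfun_apply (D x)) (at x)) \<and> continuous_on ?U D" for n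
  proof (induction n)
    case 0
    show ?case by (rule exI[of _ "\<lambda>_. 0"]) (simp add: P0)
  next
    case (Suc n)
    then obtain D where D: "\<And>x. x \<in> ?U \<Longrightarrow> (P n has_derivative blinfun_apply (D x)) (at x)" "continuous_on ?U D"
      by blast
    obtain K' where K': "continuous_on ?U K'" 
      "\<And>x. x \<in> ?U \<Longrightarrow> (ray_integral a (P n) has_derivative blinfun_apply (K' x)) (at x)"
      by (rule ray_integral_has_derivative[OF aU ca'U D]) (assumption, assumption, rule that)
    show ?case
      unfolding PS using K' by (intro exI[of _ K']) (auto intro!: derivative_eq_intros)
  qed
  then obtain D where D: "\<And>n x. x \<in> ?U \<Longrightarrow> (P n has_derivative blinfun_apply (D n x)) (at x)" 
      and cD: "\<And>n. continuous_on ?U (D n)"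
    by metis
  have cP: "continuous_on ?U (P n)" for n
    by (meson D has_derivative_continuous continuous_at_imp_continuous_on)
  have cint: "continuous_on {0..1} (\<lambda>t. P n (t *\<^sub>R x) o\<^sub>L a (t *\<^sub>R x) x)" if "x \<in> ?U" for x n
    by (intro continuous_intros continuous_on_ray1[OF cP that] continuous_on_ray1[OF caU that])
  have DK: "(ray_deriv a a' (P n) (D n) x w has_integral D (Suc n) x w) {0..1}"
    if x: "x \<in> ?U" for n x w
  proof -
    obtain K' where K': "continuous_on ?U K'" "\<And>x. x \<in> ?U \<Longrightarrow> (ray_integral a (P n) has_derivative blinfun_apply (K' x)) (at x)"
      "\<And>x w. x \<in> ?U \<Longrightarrow> (ray_deriv a a' (P n) (D n) x w has_integral K' x w) {0..1::real}"
      by (rule ray_integral_has_derivative[OF aU ca'U D cD]) (assumption, assumption, rule that)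
    have "(P (Suc n) has_derivative blinfun_apply (K' x)) (at x)"
      unfolding PS using K'(2)[OF x] by (auto intro!: derivative_eq_intros)
    hence "blinfun_apply (K' x) = blinfun_apply (D (Suc n) x)"
      using D[OF x] has_derivative_unique by blast
    thus ?thesis using K'(3)[OF x, of w] by simp
  qed

  have diff: "norm (P (Suc n) x - P n x) \<le> (1/4)^n" if "x \<in> ?U" for n x
    using that
  proof (induction n arbitrary: x)
    case 0
    thus ?case by (simp add: P0 PS ray_integral_def norm_blinfun_id_le)
  next
    case (Suc n)
    have "P (Suc (Suc n)) x - P (Suc n) x = 
        integral {0..1} (\<lambda>t. (P (Suc n) (t *\<^sub>R x) o\<^sub>L a (t *\<^sub>R x) x) - (P n (t *\<^sub>R x) o\<^sub>L a (t *\<^sub>R x) x))"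
      using fun_cong[OF PS[of "Suc n"], of x] fun_cong[OF PS[of n], of x]
        integral_diff[OF integrable_continuous_real[OF cint[OF Suc.prems, of "Suc n"]]
            integrable_continuous_real[OF cint[OF Suc.prems, of n]]]
      by (simp add: ray_integral_def)
    also have "norm \<dots> \<le> (1/4)^Suc n * (1 - 0)"
    proof (rule integral_bound)
      fix t :: real assume t: "t \<in> {0..1}"
      have "norm ((P (Suc n) (t *\<^sub>R x) - P n (t *\<^sub>R x)) o\<^sub>L a (t *\<^sub>R x) x)
          \<le> norm (P (Suc n) (t *\<^sub>R x) - P n (t *\<^sub>R x)) * norm (a (t *\<^sub>R x) x)"
        by (rule norm_blinfun_compose)
      also have "\<dots> \<le> (1/4)^n * (1/4)"
        using Suc.IH[OF scaleR_in_ball0[OF Suc.prems t]] nax[OF Suc.prems scaleR_in_ball0[OF Suc.prems t]]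
        by (intro mult_mono) auto
      finally show "norm ((P (Suc n) (t *\<^sub>R x) o\<^sub>L a (t *\<^sub>R x) x) - (P n (t *\<^sub>R x) o\<^sub>L a (t *\<^sub>R x) x)) \<le> (1/4)^Suc n"
        by (simp add: compose_simps)
    qed (auto intro!: continuous_intros cint[OF Suc.prems])
    finally show ?case by simp
  qed

  define E where "E n x w = D (Suc n) x w - (P n x o\<^sub>L a x w)" for n x w
  have Ebound: "norm (E n x w) \<le> M * (1/2)^n * norm w" if "x \<in> ?U" for n x w
    using that
  proof (induction n arbitrary: x w)
    case 0
    have "P (Suc 0) = (\<lambda>_. id_blinfun)" by (simp add: PS P0 ray_integral_def)
    hence "blinfun_apply (D (Suc 0) x) = (\<lambda>_. 0)"
      using has_derivative_unique[OF D[OF 0, of "Suc 0"]] by (metis has_derivative_const)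
    thus ?case using M(1) by (simp add: E_def P0)
  next
    case (Suc n)
    note x = Suc.prems
    have "((defect_integrand a (E n) (P (Suc n)) (P n) x w)
          has_integral E (Suc n) x w) {0..1::real}"
      unfolding E_def by (rule picard_defect_step[OF aU flatU D x DK[OF x]])
    moreover have "norm (defect_integrand a (E n) (P (Suc n)) (P n) x w t)
           \<le> M * (1/2)^Suc n * norm w" if "t \<in> {0..1}" for t
    proof -
      define y where "y = t *\<^sub>R x"
      have y: "y \<in> ?U" unfolding y_def using scaleR_in_ball0[OF x that] .
      have xr: "norm x \<le> r" using x by simp
      have 1: "norm (E n y w o\<^sub>L a y x) \<le> (M * (1/2)^n * norm w) * (1/8)"
        by (rule order_trans[OF norm_blinfun_compose mult_mono[OF Suc.IH[OF y] nax[OF x y]]]) (use M in auto)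
      have "norm (E n y x o\<^sub>L a y w) \<le> (M * (1/2)^n * norm x) * (M * norm w)"
        by (rule order_trans[OF norm_blinfun_compose mult_mono[OF Suc.IH[OF y] naw[OF y]]]) (use M in auto)
      also have "\<dots> = (M * norm x) * (M * (1/2)^n * norm w)" by simp
      also have "\<dots> \<le> (1/8) * (M * (1/2)^n * norm w)"
      proof (rule mult_right_mono)
        show "M * norm x \<le> 1/8" using mult_left_mono[OF xr, of M] M(1) r(3) by linarith
      qed (use M(1) in auto)
      finally have 2: "norm (E n y x o\<^sub>L a y w) \<le> (1/8) * (M * (1/2)^n * norm w)" .
      have "norm (a y x o\<^sub>L a y w) \<le> (1/8) * (M * norm w)"
        by (rule order_trans[OF norm_blinfun_compose mult_mono[OF nax[OF x y] naw[OF y]]]) auto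
      moreover have "norm (a y w o\<^sub>L a y x) \<le> (M * norm w) * (1/8)"
        by (rule order_trans[OF norm_blinfun_compose mult_mono[OF naw[OF y] nax[OF x y]]]) (use M in auto)
      ultimately have 3: "norm ((a y x o\<^sub>L a y w) - (a y w o\<^sub>L a y x)) \<le> (1/4) * (M * norm w)"
        using norm_triangle_ineq4[of "a y x o\<^sub>L a y w" "a y w o\<^sub>L a y x"] by linarith
      have "(1/4::real)^n \<le> (1/2)^n" by (rule power_mono) auto
      hence d: "norm (P (Suc n) y - P n y) \<le> (1/2)^n" using diff[OF y, of n] by linarith
      have 4: "norm ((P (Suc n) y - P n y) o\<^sub>L ((a y x o\<^sub>L a y w) - (a y w o\<^sub>L a y x))) \<le> (1/2)^n * ((1/4) * (M * norm w))"
        by (rule order_trans[OF norm_blinfun_compose mult_mono[OF d 3]]) auto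
      have "norm ((E n y w o\<^sub>L a y x) - (E n y x o\<^sub>L a y w)
             + ((P (Suc n) y - P n y) o\<^sub>L ((a y x o\<^sub>L a y w) - (a y w o\<^sub>L a y x)))) \<le> M * (1/2)^Suc n * norm w"
        (is "norm (?A - ?B + ?C) \<le> _")
      proof -
        have "norm (?A - ?B + ?C) \<le> norm ?A + norm ?B + norm ?C"
          using norm_triangle_ineq[of "?A - ?B" ?C] norm_triangle_ineq4[of ?A ?B] by linarith
        also have "\<dots> \<le> (M * (1/2)^n * norm w) * (1/8) + (1/8) * (M * (1/2)^n * norm w) + (1/2)^n * ((1/4) * (M * norm w))"
          using 1 2 4 by linarith
        also have "\<dots> = M * (1/2)^Suc n * norm w" by (simp add: algebra_simps)
        finally show ?thesis .
      qed
      moreover have "norm (t *\<^sub>R z) \<le> norm z" for z :: "'v \<Rightarrow>\<^sub>L 'v"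
        using that by (simp add: mult_left_le_one_le)
      ultimately show ?thesis unfolding y_def using order_trans by blast
    qed
    ultimately show ?case
      using has_integral_bound[of "M * (1/2)^Suc n * norm w" _ "E (Suc n) x w" "0::real" 1] M(1)
      by (simp add: cbox_interval)
  qed

  define \<Phi> where "\<Phi> x = lim (\<lambda>n. P n x)" for x
  have lim: "(\<lambda>n. P n x) \<longlonglongrightarrow> \<Phi> x" if x: "x \<in> ?U" for x
  proof -
    have "summable (\<lambda>n. P (Suc n) x - P n x)"
      by (rule summable_comparison_test'[OF summable_geometric[of "1/4::real"], of 0]) (use diff[OF x] in auto)
    hence "convergent (\<lambda>n. \<Sum>k<n. P (Suc k) x - P k x)" by (simp add: summable_iff_convergent)
    hence "convergent (\<lambda>n. P n x)" by (simp add: sum_lessThan_telescope[of "\<lambda>k. P k x"] P0)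
    thus ?thesis unfolding \<Phi>_def by (simp add: convergent_LIMSEQ_iff)
  qed
  have rate: "norm (P n x - \<Phi> x) \<le> 2 * (1/2)^n" if x: "x \<in> ?U" for x n
  proof -
    have step: "norm (P (n + k) x - P n x) \<le> 2 * (1/2)^n - 2 * (1/2)^(n+k)" for k
    proof (induction k)
      case (Suc k)
      have "(1/4::real)^(n+k) \<le> (1/2)^(n+k)" by (rule power_mono) auto
      hence "norm (P (Suc (n+k)) x - P (n+k) x) \<le> (1/2)^(n+k)" using diff[OF x, of "n+k"] by linarith
      with Suc norm_triangle_ineq[of "P (Suc (n+k)) x - P (n+k) x" "P (n+k) x - P n x"] show ?case by simp
    qed simp
    have "(\<lambda>k. norm (P (k + n) x - P n x)) \<longlonglongrightarrow> norm (\<Phi> x - P n x)"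
      by (intro tendsto_intros LIMSEQ_ignore_initial_segment lim[OF x])
    moreover have "norm (P (k + n) x - P n x) \<le> 2 * (1/2)^n" for k
      using step[of k] zero_le_power[of "1/2::real" "n + k"]
      unfolding add.commute[of k n] by linarith
    ultimately have "norm (\<Phi> x - P n x) \<le> 2 * (1/2)^n"
      by (meson LIMSEQ_le_const2)
    thus ?thesis by (simp add: norm_minus_commute)
  qed
  show thesis
  proof
    show "0 < r" "?U \<subseteq> S" by fact+
    have "P (Suc n) 0 = id_blinfun" for n by (simp add: PS ray_integral_def blinfun.bilinear_simps)
    hence "(\<lambda>n. P (Suc n) 0) \<longlonglongrightarrow> id_blinfun" by simp
    with LIMSEQ_Suc[OF lim[of 0]] r show "\<Phi> 0 = id_blinfun"
      using LIMSEQ_unique by (metis centre_in_ball)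
  next
    fix x assume x: "x \<in> ?U"
    have lim0: "(\<lambda>n. 3 * M * (1/2)^n) \<longlonglongrightarrow> 0"
      using tendsto_mult_right_zero[OF LIMSEQ_power_zero[of "1/2::real"], of "3*M"] by simp
    have "\<exists>g. \<forall>x\<in>?U. (\<lambda>n. P (Suc n) x) \<longlonglongrightarrow> g x \<and> (g has_derivative (\<lambda>w. \<Phi> x o\<^sub>L a x w)) (at x within ?U)"
    proof (rule has_derivative_sequence[where f' = "\<lambda>n x. blinfun_apply (D (Suc n) x)"])
      show "(\<lambda>n. P (Suc n) 0) \<longlonglongrightarrow> \<Phi> 0" using LIMSEQ_Suc[OF lim[of 0]] r by simp
      fix e :: real assume e: "e > 0"
      have "\<forall>\<^sub>F n in sequentially. 3 * M * (1/2)^n < e"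
        using order_tendstoD(2)[OF lim0 e] .
      thus "\<forall>\<^sub>F n in sequentially. \<forall>x\<in>?U. \<forall>h. norm (D (Suc n) x h - (\<Phi> x o\<^sub>L a x h)) \<le> e * norm h"
      proof eventually_elim
        case (elim n)
        show ?case
        proof (intro ballI allI)
          fix x h assume x: "x \<in> ?U"
          have "D (Suc n) x h - (\<Phi> x o\<^sub>L a x h) = E n x h + ((P n x - \<Phi> x) o\<^sub>L a x h)"
            by (simp add: E_def compose_simps)
          also have "norm \<dots> \<le> norm (E n x h) + norm ((P n x - \<Phi> x) o\<^sub>L a x h)"
            by (rule norm_triangle_ineq)
          also have "\<dots> \<le> M * (1/2)^n * norm h + (2 * (1/2)^n) * (M * norm h)"
            by (intro add_mono Ebound[OF x] order_trans[OF norm_blinfun_compose mult_mono[OF rate[OF x] naw[OF x]]]) auto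
          also have "\<dots> = (3 * M * (1/2)^n) * norm h" by (simp add: algebra_simps)
          also have "\<dots> \<le> e * norm h" using elim by (intro mult_right_mono) auto
          finally show "norm (D (Suc n) x h - (\<Phi> x o\<^sub>L a x h)) \<le> e * norm h" .
        qed
      qed
    qed (use r D in \<open>auto intro: has_derivative_at_withinI\<close>)
    then obtain g where g: "\<And>x. x \<in> ?U \<Longrightarrow> (\<lambda>n. P (Suc n) x) \<longlonglongrightarrow> g x"
       "\<And>x. x \<in> ?U \<Longrightarrow> (g has_derivative (\<lambda>w. \<Phi> x o\<^sub>L a x w)) (at x within ?U)" by blast
    have gP: "g x = \<Phi> x" if "x \<in> ?U" for x
      using g(1)[OF that] LIMSEQ_Suc[OF lim[OF that]] LIMSEQ_unique by blast
    have "(\<Phi> has_derivative (\<lambda>w. \<Phi> x o\<^sub>L a x w)) (at x within ?U)"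
      by (rule has_derivative_transform[OF x _ g(2)[OF x]]) (use gP in auto)
    thus "(\<Phi> has_derivative (\<lambda>w. \<Phi> x o\<^sub>L a x w)) (at x)"
      using at_within_open[OF x open_ball] by simp
  next
    fix Q :: "'v \<Rightarrow>\<^sub>L 'v" and x :: 'a
    assume Q: "\<And>x w. x \<in> S \<Longrightarrow> (Q o\<^sub>L a x w) = (a x w o\<^sub>L Q)" and x: "x \<in> ?U"
    have "(Q o\<^sub>L P n x) = (P n x o\<^sub>L Q)" if "x \<in> ?U" for n x
      using that
    proof (induction n arbitrary: x)
      case (Suc n)
      have "(Q o\<^sub>L ray_integral a (P n) x) = integral {0..1} (\<lambda>t. Q o\<^sub>L (P n (t *\<^sub>R x) o\<^sub>L a (t *\<^sub>R x) x))"
        unfolding ray_integral_def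
        by (rule integral_linear[OF integrable_continuous_real[OF cint[OF Suc.prems]] 
             bounded_linear_compose_right, unfolded o_def, symmetric])
      also have "\<dots> = integral {0..1} (\<lambda>t. (P n (t *\<^sub>R x) o\<^sub>L a (t *\<^sub>R x) x) o\<^sub>L Q)"
      proof (rule integral_cong)
        fix t :: real assume "t \<in> {0..1}"
        hence t: "t *\<^sub>R x \<in> ?U" using scaleR_in_ball0[OF Suc.prems] by blast
        show "(Q o\<^sub>L (P n (t *\<^sub>R x) o\<^sub>L a (t *\<^sub>R x) x)) = ((P n (t *\<^sub>R x) o\<^sub>L a (t *\<^sub>R x) x) o\<^sub>L Q)"
        proof (rule blinfun_eqI)
          fix v
          have "Q (P n (t *\<^sub>R x) u) = P n (t *\<^sub>R x) (Q u)" for u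
            using arg_cong[OF Suc.IH[OF t], of "\<lambda>f. blinfun_apply f u"] by simp
          moreover have "Q (a (t *\<^sub>R x) x v) = a (t *\<^sub>R x) x (Q v)"
            using arg_cong[OF Q[OF subsetD[OF US t], of x], of "\<lambda>f. blinfun_apply f v"] by simp
          ultimately show "(Q o\<^sub>L (P n (t *\<^sub>R x) o\<^sub>L a (t *\<^sub>R x) x)) v = ((P n (t *\<^sub>R x) o\<^sub>L a (t *\<^sub>R x) x) o\<^sub>L Q) v"
            by simp
        qed
      qed
      also have "\<dots> = (ray_integral a (P n) x o\<^sub>L Q)"
        unfolding ray_integral_def
        by (rule integral_linear[OF integrable_continuous_real[OF cint[OF Suc.prems]] 
             bounded_linear_compose_left, unfolded o_def])
      finally show ?case
        unfolding PS compose_simps by (simp add: blinfun_eqI)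
    qed (simp add: P0)
    moreover have "(\<lambda>n. Q o\<^sub>L P n x) \<longlonglongrightarrow> (Q o\<^sub>L \<Phi> x)" "(\<lambda>n. P n x o\<^sub>L Q) \<longlonglongrightarrow> (\<Phi> x o\<^sub>L Q)"
      using lim[OF x] by (auto intro!: tendsto_intros)
    ultimately show "(Q o\<^sub>L \<Phi> x) = (\<Phi> x o\<^sub>L Q)" using x LIMSEQ_unique by fastforce
  qed
qed

corollary flat_total_differential_equation_at:
  fixes a :: "'a::euclidean_space \<Rightarrow> 'a \<Rightarrow>\<^sub>L ('v::banach \<Rightarrow>\<^sub>L 'v)"
  assumes S: "open S" "p \<in> S"
    and a: "\<And>x. x \<in> S \<Longrightarrow> (a has_derivative blinfun_apply (a' x)) (at x)"
    and ca': "continuous_on S a'"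
    and flat: "\<And>x v w. x \<in> S \<Longrightarrow> a' x v w + (a x v o\<^sub>L a x w) = a' x w v + (a x w o\<^sub>L a x v)"
  obtains r \<Phi> where "r > 0" "ball p r \<subseteq> S" "\<Phi> p = id_blinfun"
    "\<And>x. x \<in> ball p r \<Longrightarrow> (\<Phi> has_derivative (\<lambda>w. \<Phi> x o\<^sub>L a x w)) (at x)"
    "\<And>Q x. (\<And>x w. x \<in> S \<Longrightarrow> (Q o\<^sub>L a x w) = (a x w o\<^sub>L Q)) \<Longrightarrow> x \<in> ball p r \<Longrightarrow> (Q o\<^sub>L \<Phi> x) = (\<Phi> x o\<^sub>L Q)"
proof -
  let ?S = "(\<lambda>x. x - p) ` S"
  have mem: "x \<in> ?S \<longleftrightarrow> p + x \<in> S" for x by (force simp: image_iff)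
  have 1: "open ?S" "0 \<in> ?S" using S by (auto simp: open_translation_subtract)
  have 2: "((\<lambda>x. a (p + x)) has_derivative blinfun_apply (a' (p + x))) (at x)" if "x \<in> ?S" for x
    by (rule has_derivative_compose[where f = "\<lambda>x. p + x", OF _ a])
       (use that mem in \<open>auto intro!: derivative_eq_intros\<close>)
  have 3: "continuous_on ?S (\<lambda>x. a' (p + x))"
    by (rule continuous_on_compose2[OF ca']) (auto intro!: continuous_intros)
  obtain r \<Phi> where r: "r > 0" "ball 0 r \<subseteq> ?S" "\<Phi> 0 = id_blinfun"
    "\<And>x. x \<in> ball 0 r \<Longrightarrow> (\<Phi> has_derivative (\<lambda>w. \<Phi> x o\<^sub>L a (p + x) w)) (at x)"
    "\<And>Q x. (\<And>x w. x \<in> ?S \<Longrightarrow> (Q o\<^sub>L a (p + x) w) = (a (p + x) w o\<^sub>L Q)) \<Longrightarrow> x \<in> ball 0 r \<Longrightarrow> (Q o\<^sub>L \<Phi> x) = (\<Phi> x o\<^sub>L Q)"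
    by (rule flat_total_differential_equation[OF 1 2 3 flat]) (use mem in blast)+
  have b: "x - p \<in> ball 0 r \<longleftrightarrow> x \<in> ball p r" for x by (simp add: dist_norm norm_minus_commute)
  show thesis
  proof (rule that[of r "\<lambda>x. \<Phi> (x - p)"])
    show "ball p r \<subseteq> S" 
    proof
      fix x assume "x \<in> ball p r"
      hence "x - p \<in> ?S" using b r(2) by blast
      thus "x \<in> S" by (simp add: mem)
    qed
    show "((\<lambda>x. \<Phi> (x - p)) has_derivative (\<lambda>w. \<Phi> (x - p) o\<^sub>L a x w)) (at x)" if x: "x \<in> ball p r" for x
    proof -
      have "(\<Phi> has_derivative (\<lambda>w. \<Phi> (x - p) o\<^sub>L a x w)) (at (x - p))"
        using r(4)[of "x - p"] x b by simp
      moreover have "((\<lambda>x. x - p) has_derivative (\<lambda>w. w)) (at x)"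
        by (auto intro!: derivative_eq_intros)
      ultimately show ?thesis using has_derivative_compose by blast
    qed
    show "(Q o\<^sub>L \<Phi> (x - p)) = (\<Phi> (x - p) o\<^sub>L Q)"
      if Q: "\<And>x w. x \<in> S \<Longrightarrow> (Q o\<^sub>L a x w) = (a x w o\<^sub>L Q)" and x: "x \<in> ball p r" for Q x
      by (rule r(5)) (use Q x mem b in auto)
  qed (use r in auto)
qed

section \<open>Inverting operators near the identity\<close>

text \<open>The equation \<open>T x = y\<close> is the fixed point equation of the contraction \<open>x \<mapsto> y + (x - T x)\<close>.\<close>
lemma neumann_inverse:
  fixes T :: "'v::banach \<Rightarrow>\<^sub>L 'v"
  assumes q: "norm (id_blinfun - T) \<le> q" "q < 1"
  obtains R where "(R o\<^sub>L T) = id_blinfun" "(T o\<^sub>L R) = id_blinfun" "norm R \<le> 1 / (1 - q)"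
proof -
  have q0: "q \<ge> 0" using q(1) norm_ge_zero order_trans by blast
  have contr: "norm (x - T x) \<le> q * norm x" for x
    using norm_blinfun[of "id_blinfun - T" x] mult_right_mono[OF q(1), of "norm x"]
    by (simp add: blinfun.bilinear_simps)
  have lower: "norm x \<le> norm (T x) / (1 - q)" for x
    using contr[of x] norm_triangle_ineq2[of x "T x"] q by (simp add: field_simps)
  have inj: "inj T"
  proof (rule injI)
    fix x y assume "T x = T y"
    with lower[of "x - y"] show "x = y" by (simp add: blinfun.bilinear_simps)
  qed
  have "\<exists>x. T x = y" for y
  proof -
    have "\<exists>!x. y + (x - T x) = x"
    proof (rule banach_fix_type[of q])
      show "\<forall>x. \<forall>z. dist (y + (x - T x)) (y + (z - T z)) \<le> q * dist x z"
      proof (intro allI)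
        fix x z
        have "dist (y + (x - T x)) (y + (z - T z)) = norm ((x - z) - T (x - z))"
          by (simp add: dist_norm blinfun.bilinear_simps algebra_simps)
        thus "dist (y + (x - T x)) (y + (z - T z)) \<le> q * dist x z"
          using contr[of "x - z"] by (simp add: dist_norm)
      qed
    qed (use q q0 in auto)
    thus ?thesis by (auto simp: algebra_simps)
  qed
  then obtain f where f: "\<And>y. T (f y) = y" by metis
  have fT: "f (T x) = x" for x using inj f by (meson injD)
  have bl: "bounded_linear f"
  proof (rule bounded_linear_intro)
    show "f (x + y) = f x + f y" for x y
      by (rule injD[OF inj]) (simp add: f blinfun.bilinear_simps)
    show "f (c *\<^sub>R x) = c *\<^sub>R f x" for c x
      by (rule injD[OF inj]) (simp add: f blinfun.bilinear_simps)
    show "norm (f x) \<le> norm x * (1 / (1 - q))" for x using lower[of "f x"] by (simp add: f)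
  qed
  show thesis
  proof
    show "(Blinfun f o\<^sub>L T) = id_blinfun" "(T o\<^sub>L Blinfun f) = id_blinfun"
      by (rule blinfun_eqI, simp add: bounded_linear_Blinfun_apply[OF bl] f fT)+
    show "norm (Blinfun f) \<le> 1 / (1 - q)"
      by (rule norm_blinfun_bound) (use q lower[of "f _"] in \<open>auto simp: bounded_linear_Blinfun_apply[OF bl] f\<close>)
  qed
qed

text \<open>The derivative is read off from \<open>R y - R x = - R y (T y - T x) R x\<close>; the uniform bound on the
  inverses makes the right hand side small.\<close>
lemma has_derivative_operator_inverse:
  fixes T R :: "'a::real_normed_vector \<Rightarrow> 'v::real_normed_vector \<Rightarrow>\<^sub>L 'v"
  assumes T: "(T has_derivative T') (at x)" and U: "open U" "x \<in> U"
    and RT: "\<And>y. y \<in> U \<Longrightarrow> (R y o\<^sub>L T y) = id_blinfun" and TR: "\<And>y. y \<in> U \<Longrightarrow> (T y o\<^sub>L R y) = id_blinfun"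
    and B: "\<And>y. y \<in> U \<Longrightarrow> norm (R y) \<le> B"
  shows "(R has_derivative (\<lambda>h. - (R x o\<^sub>L T' h o\<^sub>L R x))) (at x)"
proof -
  have B0: "B \<ge> 0" using B[OF U(2)] norm_ge_zero order_trans by blast
  obtain K where K: "K \<ge> 0" "\<And>h. norm (T' h) \<le> norm h * K"
    using bounded_linear.nonneg_bounded[OF has_derivative_bounded_linear[OF T]] by auto
  have RTv: "R y (T y v) = v" and TRv: "T y (R y v) = v" if "y \<in> U" for y v
    using arg_cong[OF RT[OF that], of "\<lambda>f. blinfun_apply f v"] arg_cong[OF TR[OF that], of "\<lambda>f. blinfun_apply f v"]
    by simp_all
  have diff: "R y - R x = - (R y o\<^sub>L (T y - T x) o\<^sub>L R x)" if "y \<in> U" for y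
    by (rule blinfun_eqI) (simp add: blinfun.bilinear_simps RTv[OF that] TRv[OF U(2)])
  have comp3: "norm (A o\<^sub>L C o\<^sub>L D) \<le> \<alpha> * norm C * \<beta>" if "norm A \<le> \<alpha>" "norm D \<le> \<beta>" for A C D :: "'v \<Rightarrow>\<^sub>L 'v" and \<alpha> \<beta>
  proof -
    have "\<alpha> \<ge> 0" using that(1) norm_ge_zero order_trans by blast
    thus ?thesis
      by (intro order_trans[OF norm_blinfun_compose] mult_mono order_trans[OF norm_blinfun_compose[of A C] mult_right_mono] that) auto
  qed
  obtain e where e: "e > 0" "ball x e \<subseteq> U" using U open_contains_ball by blast
  have Tx: "((\<lambda>y. norm (T y - T x)) \<longlongrightarrow> 0) (at x)"
    using has_derivative_continuous[OF T] by (simp add: isCont_def tendsto_norm_zero LIM_zero)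
  let ?D = "\<lambda>y. T y - T x - T' (y - x)"
  show ?thesis
  proof (rule has_derivativeI_sandwich[OF e(1)])
    show "bounded_linear (\<lambda>h. - (R x o\<^sub>L T' h o\<^sub>L R x))"
      by (intro bounded_linear_minus bounded_linear_compose[OF bounded_linear_compose_left]
           bounded_linear_compose[OF bounded_linear_compose_right]
           has_derivative_bounded_linear[OF T])
    have "((\<lambda>y. norm (?D y) / norm (y - x)) \<longlongrightarrow> 0) (at x)"
      using T unfolding has_derivative_iff_norm by blast
    hence "((\<lambda>y. (B * norm (T y - T x) * B) * K * B + B * (norm (?D y) / norm (y - x)) * B) \<longlongrightarrow> (B * 0 * B) * K * B + B * 0 * B) (at x)"
      by (intro tendsto_intros Tx)
    thus "((\<lambda>y. (B * norm (T y - T x) * B) * K * B + B * (norm (?D y) / norm (y - x)) * B) \<longlongrightarrow> 0) (at x)" by simp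
    fix y assume y: "y \<noteq> x" "dist y x < e"
    hence yU: "y \<in> U" using e by (auto simp: dist_commute)
    have "(R y - R x) - - (R x o\<^sub>L T' (y - x) o\<^sub>L R x) = - ((R y - R x) o\<^sub>L T' (y - x) o\<^sub>L R x) - (R y o\<^sub>L ?D y o\<^sub>L R x)"
      by (subst diff[OF yU], rule blinfun_eqI) (simp add: blinfun.bilinear_simps)
    also have "norm \<dots> \<le> norm ((R y - R x) o\<^sub>L T' (y - x) o\<^sub>L R x) + norm (R y o\<^sub>L ?D y o\<^sub>L R x)"
      using norm_triangle_ineq4[of "- ((R y - R x) o\<^sub>L T' (y - x) o\<^sub>L R x)" "R y o\<^sub>L ?D y o\<^sub>L R x"] by simp
    also have "\<dots> \<le> (B * norm (T y - T x) * B) * norm (T' (y - x)) * B + B * norm (?D y) * B"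
      by (intro add_mono comp3 B yU U) (use comp3[OF B[OF yU] B[OF U(2)]] diff[OF yU] in simp)
    also have "\<dots> \<le> (B * norm (T y - T x) * B) * (norm (y - x) * K) * B + B * norm (?D y) * B"
      using B0 K by (intro add_mono mult_mono) auto
    finally show "norm ((R y - R x) - - (R x o\<^sub>L T' (y - x) o\<^sub>L R x)) / norm (y - x)
        \<le> (B * norm (T y - T x) * B) * K * B + B * (norm (?D y) / norm (y - x)) * B"
      using y by (simp add: field_simps)
  qed
qed

section \<open>Loops and their Birkhoff factorisation\<close>

text \<open>The usual distance on the integers, for which bounded two-sided sequences form a Banach space.\<close>
instantiation int :: metric_space
begin

definition dist_int :: "int \<Rightarrow> int \<Rightarrow> real" where
  "dist_int x y = \<bar>real_of_int (x - y)\<bar>"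

definition uniformity_int :: "(int \<times> int) filter" where
  "uniformity_int = (INF e\<in>{0<..}. principal {(x, y). dist x y < e})"

instance
proof
  show "uniformity = (INF e\<in>{0<..}. principal {(x, y :: int). dist x y < e})"
    by (rule uniformity_int_def)
  fix U :: "int set"
  have "(uniformity :: (int \<times> int) filter) \<le> principal {(x, y). dist x y < 1}"
    unfolding uniformity_int_def by (rule INF_lower) simp
  moreover have "\<forall>\<^sub>F (x', y) in principal {(x, y). dist x y < 1}. x' = x \<longrightarrow> y \<in> U" if "x \<in> U" for x :: int
    using that by (auto simp: eventually_principal dist_int_def simp flip: of_int_diff of_int_abs)
  ultimately show "open U \<longleftrightarrow> (\<forall>x\<in>U. \<forall>\<^sub>F (x', y) in uniformity. x' = x \<longrightarrow> y \<in> U)"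
    by (auto simp: open_discrete intro: filter_leD)
qed (auto simp: dist_int_def)

end

instance bcontfun :: (metric_space, banach) banach ..

text \<open>A loop \<open>\<lambda> \<mapsto> \<Sum>\<^sub>k f\<^sub>k \<lambda>\<^sup>k\<close> with values in \<open>'c\<close> is represented by its sequence of Fourier coefficients.\<close>
type_synonym 'c loop = "int \<Rightarrow>\<^sub>C 'c"

definition loop_map :: "(int \<Rightarrow> 'd \<Rightarrow> 'c) \<Rightarrow> 'd::real_normed_vector \<Rightarrow>\<^sub>L ('c::real_normed_vector) loop" where
  "loop_map g = Blinfun (\<lambda>f. Bcontfun (\<lambda>k. g k f))"

lemma loop_map_apply:
  fixes g :: "int \<Rightarrow> 'd::real_normed_vector \<Rightarrow> 'c::real_normed_vector"
  assumes lin: "\<And>k. linear (g k)" and B: "\<And>k f. norm (g k f) \<le> B * norm f"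
  shows "apply_bcontfun (loop_map g f) k = g k f"
    and "norm (loop_map g f) \<le> B * norm f"
proof -
  have mem: "(\<lambda>k. g k f) \<in> bcontfun" for f
    by (rule bcontfun_normI[OF _ B]) simp
  have app: "apply_bcontfun (Bcontfun (\<lambda>k. g k f)) k = g k f" for f k
    using Bcontfun_inverse[OF mem] by simp
  have nb: "norm (Bcontfun (\<lambda>k. g k f)) \<le> B * norm f" for f
    by (rule norm_bound) (simp add: app B)
  have "bounded_linear (\<lambda>f. Bcontfun (\<lambda>k. g k f))"
  proof (rule bounded_linear_intro)
    show "norm (Bcontfun (\<lambda>k. g k f)) \<le> norm f * B" for f using nb by (simp add: mult.commute)
    show "Bcontfun (\<lambda>k. g k (f + f')) = Bcontfun (\<lambda>k. g k f) + Bcontfun (\<lambda>k. g k f')" for f f'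
      by (rule bcontfun_eqI) (unfold plus_bcontfun.rep_eq app, rule linear_add[OF lin])
    show "Bcontfun (\<lambda>k. g k (c *\<^sub>R f)) = c *\<^sub>R Bcontfun (\<lambda>k. g k f)" for c f
      by (rule bcontfun_eqI) (unfold scaleR_bcontfun.rep_eq app, rule linear_scale[OF lin])
  qed
  note bl = bounded_linear_Blinfun_apply[OF this]
  show "apply_bcontfun (loop_map g f) k = g k f" "norm (loop_map g f) \<le> B * norm f"
    by (simp_all add: loop_map_def bl app nb)
qed

text \<open>Multiplication by \<open>\<lambda>\<^sup>-\<^sup>m M\<close>.\<close>
definition shift_op :: "int \<Rightarrow> ('c \<Rightarrow>\<^sub>L 'c) \<Rightarrow> 'c loop \<Rightarrow>\<^sub>L ('c::real_normed_vector) loop" where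
  "shift_op m M = loop_map (\<lambda>k f. M (apply_bcontfun f (k + m)))"

text \<open>The projection to power series in \<open>\<lambda>\<close>. It is bounded on bounded sequences, which is the reason for
  working with coefficients and not with continuous functions on the circle.\<close>
definition pos_part :: "'c loop \<Rightarrow>\<^sub>L ('c::real_normed_vector) loop" where
  "pos_part = loop_map (\<lambda>k f. if k \<ge> 0 then apply_bcontfun f k else 0)"

definition const_loop :: "'c \<Rightarrow>\<^sub>L ('c::real_normed_vector) loop" where
  "const_loop = loop_map (\<lambda>k y. if k = 0 then y else 0)"

definition loop_coeff :: "int \<Rightarrow> 'c loop \<Rightarrow>\<^sub>L ('c::real_normed_vector)" where
  "loop_coeff k = Blinfun (\<lambda>f. apply_bcontfun f k)"

lemmas loop_simps = plus_bcontfun.rep_eq minus_bcontfun.rep_eq scaleR_bcontfun.rep_eq uminus_bcontfun.rep_eq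

lemma loop_coeff_apply [simp]: "loop_coeff k f = apply_bcontfun f k"
  unfolding loop_coeff_def
  by (subst bounded_linear_Blinfun_apply)
     (auto intro!: bounded_linear_intro[of _ 1] norm_bounded simp: loop_simps)

lemma norm_shift_op_le: "norm (shift_op m M f) \<le> norm M * norm f"
  and shift_op_apply [simp]: "apply_bcontfun (shift_op m M f) k = M (f (k + m))"
proof -
  have 1: "linear (\<lambda>f. M (apply_bcontfun f (k + m)))" for k
    by (auto intro!: linearI simp: loop_simps blinfun.bilinear_simps)
  have 2: "norm (M (apply_bcontfun f (k + m))) \<le> norm M * norm f" for k f
    by (rule order_trans[OF norm_blinfun]) (auto intro!: mult_left_mono norm_bounded)
  show "norm (shift_op m M f) \<le> norm M * norm f" "apply_bcontfun (shift_op m M f) k = M (f (k + m))"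
    unfolding shift_op_def by (rule loop_map_apply[of "\<lambda>k f. M (apply_bcontfun f (k + m))", OF 1 2])+
qed

lemma pos_part_apply [simp]: "apply_bcontfun (pos_part f) k = (if k \<ge> 0 then f k else 0)"
  and norm_pos_part_le: "norm (pos_part f) \<le> norm f"
proof -
  have 1: "linear (\<lambda>f. if k \<ge> 0 then apply_bcontfun f k else 0)" for k :: int
    by (auto intro!: linearI simp: loop_simps)
  have 2: "norm (if k \<ge> 0 then apply_bcontfun f k else 0) \<le> 1 * norm f" for k :: int and f :: "'a loop"
    by (auto intro!: norm_bounded)
  show "norm (pos_part f) \<le> norm f" "apply_bcontfun (pos_part f) k = (if k \<ge> 0 then f k else 0)"
    using loop_map_apply[of "\<lambda>k f. if k \<ge> 0 then apply_bcontfun f k else 0", OF 1 2]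
    unfolding pos_part_def by simp_all
qed

lemma const_loop_apply [simp]: "apply_bcontfun (const_loop y) k = (if k = 0 then y else 0)"
  and norm_const_loop_le: "norm (const_loop y) \<le> norm y"
proof -
  have 1: "linear (\<lambda>y::'a. if k = 0 then y else 0)" for k :: int
    by (auto intro!: linearI)
  have 2: "norm (if k = 0 then y else 0) \<le> 1 * norm y" for k :: int and y :: 'a
    by auto
  show "norm (const_loop y) \<le> norm y" "apply_bcontfun (const_loop y) k = (if k = 0 then y else 0)"
    using loop_map_apply[of "\<lambda>k y::'a. if k = 0 then y else 0", OF 1 2]
    unfolding const_loop_def by simp_all
qed

lemma bounded_linear_shift_op: "bounded_linear (shift_op m)"
proof (rule bounded_linear_intro)
  show "norm (shift_op m M) \<le> norm M * 1" for M :: "'a \<Rightarrow>\<^sub>L 'a"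
    by (rule norm_blinfun_bound) (simp_all add: norm_shift_op_le)
qed (auto intro!: blinfun_eqI bcontfun_eqI simp: loop_simps blinfun.bilinear_simps)

definition shift_blin :: "int \<Rightarrow> ('c \<Rightarrow>\<^sub>L 'c) \<Rightarrow>\<^sub>L ('c loop \<Rightarrow>\<^sub>L ('c::real_normed_vector) loop)" where
  "shift_blin m = Blinfun (shift_op m)"

lemma shift_blin_apply [simp]: "shift_blin m M = shift_op m M"
  by (simp add: shift_blin_def bounded_linear_Blinfun_apply bounded_linear_shift_op)

text \<open>The hypotheses \<open>f2\<close> to \<open>f2'\<close> are the coefficients of \<open>\<lambda>\<^sup>2, \<dots>, \<lambda>\<^sup>-\<^sup>2\<close> in the flatness of
  \<open>a = N + \<lambda>\<^sup>-\<^sup>1 Th + \<lambda> Ts\<close>. With a solution \<open>\<Phi>\<close> of \<open>d\<Phi> = \<Phi> a\<close> and the projection \<open>P\<close> to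
  power series, the Toeplitz operator \<open>T = P \<Phi> P + (1 - P)\<close> is invertible near the base point, and
  \<open>u = T\<^sup>-\<^sup>1 1\<close> is the power series factor of \<open>\<Phi>\<close>: it satisfies \<open>P (\<Phi> u) = 1\<close>. The functions \<open>g\<close> and
  \<open>F\<close> are the leading coefficient of \<open>u\<close> and the first negative coefficient of \<open>w = \<Phi> u\<close>.\<close>
theorem birkhoff_potential:
  fixes N Th Ts :: "'a::euclidean_space \<Rightarrow> 'a \<Rightarrow>\<^sub>L ('c::euclidean_space \<Rightarrow>\<^sub>L 'c)"
  assumes S: "open S" "p \<in> S"
    and N: "\<And>x. x \<in> S \<Longrightarrow> (N has_derivative blinfun_apply (N' x)) (at x)" "continuous_on S N'"
    and Th: "\<And>x. x \<in> S \<Longrightarrow> (Th has_derivative blinfun_apply (Th' x)) (at x)" "continuous_on S Th'"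
    and Ts: "\<And>x. x \<in> S \<Longrightarrow> (Ts has_derivative blinfun_apply (Ts' x)) (at x)" "continuous_on S Ts'"
    and f2: "\<And>x v w. x \<in> S \<Longrightarrow> (Ts x v o\<^sub>L Ts x w) = (Ts x w o\<^sub>L Ts x v)"
    and f1: "\<And>x v w. x \<in> S \<Longrightarrow> Ts' x v w + (N x v o\<^sub>L Ts x w) + (Ts x v o\<^sub>L N x w)
                              = Ts' x w v + (N x w o\<^sub>L Ts x v) + (Ts x w o\<^sub>L N x v)"
    and f0: "\<And>x v w. x \<in> S \<Longrightarrow> N' x v w + (N x v o\<^sub>L N x w) + (Th x v o\<^sub>L Ts x w) + (Ts x v o\<^sub>L Th x w)
                              = N' x w v + (N x w o\<^sub>L N x v) + (Th x w o\<^sub>L Ts x v) + (Ts x w o\<^sub>L Th x v)"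
    and f1': "\<And>x v w. x \<in> S \<Longrightarrow> Th' x v w + (N x v o\<^sub>L Th x w) + (Th x v o\<^sub>L N x w)
                              = Th' x w v + (N x w o\<^sub>L Th x v) + (Th x w o\<^sub>L N x v)"
    and f2': "\<And>x v w. x \<in> S \<Longrightarrow> (Th x v o\<^sub>L Th x w) = (Th x w o\<^sub>L Th x v)"
  obtains r F g where "r > 0" "ball p r \<subseteq> S"
    "\<And>x. x \<in> ball p r \<Longrightarrow> linear (g x) \<and> bij (g x)"
    "\<And>x J y. x \<in> ball p r \<Longrightarrow> (\<And>x w. x \<in> S \<Longrightarrow> (J o\<^sub>L N x w) = (N x w o\<^sub>L J) \<and> (J o\<^sub>L Th x w) = (Th x w o\<^sub>L J)
         \<and> (J o\<^sub>L Ts x w) = (Ts x w o\<^sub>L J)) \<Longrightarrow> g x (J y) = J (g x y)"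
    "\<And>x y. x \<in> ball p r \<Longrightarrow> ((\<lambda>x. F x y) has_derivative (\<lambda>h. inv (g x) (Th x h (g x y)))) (at x)"
proof -
  define a where "a x = (shift_blin 0 o\<^sub>L N x) + (shift_blin 1 o\<^sub>L Th x) + (shift_blin (-1) o\<^sub>L Ts x)" for x
  define a' where "a' x = Blinfun (\<lambda>v. (shift_blin 0 o\<^sub>L N' x v) + (shift_blin 1 o\<^sub>L Th' x v) + (shift_blin (-1) o\<^sub>L Ts' x v))" for x
  have a'_eq: "a' x v = (shift_blin 0 o\<^sub>L N' x v) + (shift_blin 1 o\<^sub>L Th' x v) + (shift_blin (-1) o\<^sub>L Ts' x v)" for x v
    unfolding a'_def
    by (subst bounded_linear_Blinfun_apply)
       (auto intro!: bounded_linear_add bounded_linear_compose[OF bounded_linear_compose_right]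
         blinfun.bounded_linear_right)
  have aw: "apply_bcontfun (a x w f) k = N x w (f k) + Th x w (f (k+1)) + Ts x w (f (k-1))" for x w f k
    by (simp add: a_def blinfun.bilinear_simps loop_simps)
  have a'w: "apply_bcontfun (a' x v w f) k = N' x v w (f k) + Th' x v w (f (k+1)) + Ts' x v w (f (k-1))" for x v w f k
    by (simp add: a'_eq blinfun.bilinear_simps loop_simps)
  have da: "(a has_derivative blinfun_apply (a' x)) (at x)" if "x \<in> S" for x
  proof -
    have "blinfun_apply (a' x) = (\<lambda>v. (shift_blin 0 o\<^sub>L N' x v) + (shift_blin 1 o\<^sub>L Th' x v) + (shift_blin (-1) o\<^sub>L Ts' x v))"
      by (rule ext) (rule a'_eq)
    thus ?thesis unfolding a_def
      by (auto intro!: has_derivative_add bounded_linear.has_derivative[OF bounded_linear_compose_right]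
        N Th Ts that)
  qed
  have ca': "continuous_on S a'"
    by (rule continuous_on_blinfun_componentwise) (auto simp: a'_eq intro!: continuous_intros N Th Ts)
  have flat: "a' x v w + (a x v o\<^sub>L a x w) = a' x w v + (a x w o\<^sub>L a x v)" if x: "x \<in> S" for x v w
  proof (rule blinfun_eqI, rule bcontfun_eqI)
    fix f k
    note app = arg_cong[where f = "\<lambda>A. blinfun_apply A _"]
    have e2: "Ts x v (Ts x w u) = Ts x w (Ts x v u)" for u using app[OF f2[OF x, of v w]] by simp
    have e2': "Th x v (Th x w u) = Th x w (Th x v u)" for u using app[OF f2'[OF x, of v w]] by simp
    have e1: "Ts' x v w u + N x v (Ts x w u) + Ts x v (N x w u) = Ts' x w v u + N x w (Ts x v u) + Ts x w (N x v u)" for u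
      using app[OF f1[OF x, of v w]] by (simp add: blinfun.bilinear_simps)
    have e1': "Th' x v w u + N x v (Th x w u) + Th x v (N x w u) = Th' x w v u + N x w (Th x v u) + Th x w (N x v u)" for u
      using app[OF f1'[OF x, of v w]] by (simp add: blinfun.bilinear_simps)
    have e0: "N' x v w u + N x v (N x w u) + Th x v (Ts x w u) + Ts x v (Th x w u)
         = N' x w v u + N x w (N x v u) + Th x w (Ts x v u) + Ts x w (Th x v u)" for u
      using app[OF f0[OF x, of v w]] by (simp add: blinfun.bilinear_simps)
    have "apply_bcontfun ((a' x v w + (a x v o\<^sub>L a x w)) f) k =
       Ts x v (Ts x w (f (k-2))) + (Ts' x v w (f (k-1)) + N x v (Ts x w (f (k-1))) + Ts x v (N x w (f (k-1))))
      + (N' x v w (f k) + N x v (N x w (f k)) + Th x v (Ts x w (f k)) + Ts x v (Th x w (f k)))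
      + (Th' x v w (f (k+1)) + N x v (Th x w (f (k+1))) + Th x v (N x w (f (k+1)))) + Th x v (Th x w (f (k+2)))" for v w
      by (simp add: blinfun.bilinear_simps loop_simps aw a'w algebra_simps)
    thus "apply_bcontfun ((a' x v w + (a x v o\<^sub>L a x w)) f) k = apply_bcontfun ((a' x w v + (a x w o\<^sub>L a x v)) f) k"
      by (simp only: e2 e2' e1 e1' e0)
  qed
  obtain r0 \<Phi> where r0: "r0 > 0" "ball p r0 \<subseteq> S" "\<Phi> p = id_blinfun"
    and d\<Phi>: "\<And>x. x \<in> ball p r0 \<Longrightarrow> (\<Phi> has_derivative (\<lambda>w. \<Phi> x o\<^sub>L a x w)) (at x)"
    and comm: "\<And>Q x. (\<And>x w. x \<in> S \<Longrightarrow> (Q o\<^sub>L a x w) = (a x w o\<^sub>L Q)) \<Longrightarrow> x \<in> ball p r0 \<Longrightarrow> (Q o\<^sub>L \<Phi> x) = (\<Phi> x o\<^sub>L Q)"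
    by (rule flat_total_differential_equation_at[OF S da ca' flat]) (assumption, assumption, rule that, (assumption | blast)+)
  have comm': "Q (\<Phi> x f) = \<Phi> x (Q f)" if "\<And>x w f. x \<in> S \<Longrightarrow> Q (a x w f) = a x w (Q f)" "x \<in> ball p r0"
    for Q :: "'c loop \<Rightarrow>\<^sub>L 'c loop" and x f
  proof -
    have "(Q o\<^sub>L \<Phi> x) = (\<Phi> x o\<^sub>L Q)" by (rule comm) (use that in \<open>auto intro: blinfun_eqI\<close>)
    thus ?thesis by (metis blinfun_apply_blinfun_compose)
  qed
  have "isCont \<Phi> p" using d\<Phi>[of p] r0 has_derivative_continuous by fastforce
  then obtain d where d: "d > 0" "\<And>x. dist x p < d \<Longrightarrow> dist (\<Phi> x) (\<Phi> p) < 1/4"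
    unfolding continuous_at_eps_delta by (meson zero_less_divide_1_iff zero_less_numeral)
  define r where "r = min r0 d"
  have r: "r > 0" "ball p r \<subseteq> S" "ball p r \<subseteq> ball p r0" using r0 d by (auto simp: r_def subset_iff)
  \<comment> \<open>The bound \<open>1/4\<close> gives \<open>\<bar>T\<^sup>-\<^sup>1 - 1\<bar> \<le> 1/3\<close>, so that the coefficient \<open>u\<^sub>0\<close> is invertible as well.\<close>
  have near: "norm (id_blinfun - \<Phi> x) \<le> 1/4" if "x \<in> ball p r" for x
    using d(2)[of x] that r0(3) by (simp add: r_def dist_norm norm_minus_commute)
  note d\<Phi>r = d\<Phi>[OF subsetD[OF r(3)]]

  let ?P = "pos_part :: 'c loop \<Rightarrow>\<^sub>L 'c loop"
  have nP: "norm ?P \<le> 1" by (rule norm_blinfun_bound) (auto simp: norm_pos_part_le)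
  have PP: "?P (?P f) = ?P f" for f by (rule bcontfun_eqI) simp
  define T where "T x = id_blinfun - (?P o\<^sub>L (id_blinfun - \<Phi> x) o\<^sub>L ?P)" for x
  define T' where "T' x h = (?P o\<^sub>L (\<Phi> x o\<^sub>L a x h) o\<^sub>L ?P)" for x h
  have Tapp: "T x f = f - ?P f + ?P (\<Phi> x (?P f))" for x f
    by (simp add: T_def blinfun.bilinear_simps PP)
  have dT: "(T has_derivative T' x) (at x)" if x: "x \<in> ball p r" for x
  proof -
    have "((\<lambda>x. ?P o\<^sub>L (id_blinfun - \<Phi> x) o\<^sub>L ?P) has_derivative (\<lambda>h. ?P o\<^sub>L (0 - (\<Phi> x o\<^sub>L a x h)) o\<^sub>L ?P)) (at x)"
      by (intro bounded_linear.has_derivative[OF bounded_linear_compose_left]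
            bounded_linear.has_derivative[OF bounded_linear_compose_right]
            has_derivative_diff has_derivative_const d\<Phi>r x)
    from has_derivative_diff[OF has_derivative_const this, of id_blinfun]
    show ?thesis unfolding T_def
      by (rule has_derivative_eq_rhs) (auto simp: T'_def compose_simps fun_eq_iff blinfun.bilinear_simps intro!: blinfun_eqI)
  qed
  have nT: "norm (id_blinfun - T x) \<le> 1/4" if x: "x \<in> ball p r" for x
  proof -
    have "norm (?P o\<^sub>L (id_blinfun - \<Phi> x) o\<^sub>L ?P) \<le> (1 * (1/4)) * 1"
      by (intro order_trans[OF norm_blinfun_compose] mult_mono nP near x) auto
    thus ?thesis by (simp add: T_def)
  qed
  have "\<exists>R. (R o\<^sub>L T x) = id_blinfun \<and> (T x o\<^sub>L R) = id_blinfun \<and> norm R \<le> 4/3" if x: "x \<in> ball p r" for x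
    using neumann_inverse[OF nT[OF x]] by (auto simp: that)
  then obtain R where RT: "\<And>x. x \<in> ball p r \<Longrightarrow> (R x o\<^sub>L T x) = id_blinfun"
    and TR: "\<And>x. x \<in> ball p r \<Longrightarrow> (T x o\<^sub>L R x) = id_blinfun"
    and nR: "\<And>x. x \<in> ball p r \<Longrightarrow> norm (R x) \<le> 4/3" by metis
  have RTv: "R x (T x f) = f" and TRv: "T x (R x f) = f" if "x \<in> ball p r" for x f
    using arg_cong[OF RT[OF that], of "\<lambda>A. blinfun_apply A f"] arg_cong[OF TR[OF that], of "\<lambda>A. blinfun_apply A f"]
    by simp_all
  have dR: "(R has_derivative (\<lambda>h. - (R x o\<^sub>L T' x h o\<^sub>L R x))) (at x)" if x: "x \<in> ball p r" for x
    by (rule has_derivative_operator_inverse[OF dT[OF x] open_ball x RT TR nR])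

  define u where "u x y = R x (const_loop y)" for x y
  define w where "w x y = \<Phi> x (u x y)" for x y
  define g where "g x y = apply_bcontfun (u x y) 0" for x y
  define F where "F x y = apply_bcontfun (w x y) (-1)" for x y
  have Tu: "T x (u x y) = const_loop y" if "x \<in> ball p r" for x y
    by (simp add: u_def TRv[OF that])
  have Pu: "?P (u x y) = u x y" if "x \<in> ball p r" for x y
  proof -
    have "?P (T x (u x y)) = ?P (\<Phi> x (?P (u x y)))"
      unfolding Tapp by (simp add: blinfun.bilinear_simps PP)
    hence "u x y - ?P (u x y) = const_loop y - ?P (const_loop y)"
      using Tu[OF that, of y] unfolding Tapp by (simp add: algebra_simps)
    also have "\<dots> = 0" by (rule bcontfun_eqI) (simp add: loop_simps)
    finally show ?thesis by simp
  qed
  have Pw: "?P (w x y) = const_loop y" if "x \<in> ball p r" for x y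
    using Tu[OF that, of y] unfolding Tapp w_def by (simp add: Pu[OF that])
  have u0: "apply_bcontfun (u x y) k = 0" if "x \<in> ball p r" "k < 0" for x y k
    using arg_cong[OF Pu[OF that(1), of y], of "\<lambda>f. apply_bcontfun f k"] that(2) by simp
  have wpos: "apply_bcontfun (w x y) k = (if k = 0 then y else 0)" if "x \<in> ball p r" "k \<ge> 0" for x y k
    using arg_cong[OF Pw[OF that(1), of y], of "\<lambda>f. apply_bcontfun f k"] that(2) by simp
  have ling: "linear (g x)" for x
    by (auto intro!: linearI simp: g_def u_def blinfun.bilinear_simps loop_simps)
  have injg: "inj (g x)" if x: "x \<in> ball p r" for x
  proof (rule linear_injective_0[OF ling, THEN iffD2], intro allI impI)
    fix y assume y: "g x y = 0"
    have "R x o\<^sub>L (id_blinfun - T x) = R x - id_blinfun"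
      by (rule blinfun_eqI) (simp add: blinfun.bilinear_simps RTv[OF x])
    hence "norm (R x - id_blinfun) \<le> (4/3) * (1/4)"
      using order_trans[OF norm_blinfun_compose mult_mono[OF nR[OF x] nT[OF x]]] by (metis norm_ge_zero zero_le_divide_iff zero_le_numeral)
    hence 1: "norm ((R x - id_blinfun) (const_loop y)) \<le> (1/3) * norm y"
      by (intro order_trans[OF norm_blinfun] mult_mono norm_const_loop_le) auto
    have "norm y = norm (apply_bcontfun ((R x - id_blinfun) (const_loop y)) 0)"
      using y by (simp add: g_def u_def blinfun.bilinear_simps loop_simps)
    also have "\<dots> \<le> norm ((R x - id_blinfun) (const_loop y))" by (rule norm_bounded)
    finally have "norm y \<le> (1/3) * norm y" using 1 by linarith
    hence "norm y \<le> 0" by linarith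
    thus "y = 0" by simp
  qed
  have bijg: "bij (g x)" if "x \<in> ball p r" for x
    using linear_injective_imp_surjective[OF ling injg[OF that]] injg[OF that] by (simp add: bij_def)
  show thesis
  proof
    show "r > 0" "ball p r \<subseteq> S" by fact+
    fix x assume x: "x \<in> ball p r"
    hence xS: "x \<in> S" using r by blast
    show "linear (g x) \<and> bij (g x)" using ling bijg[OF x] by blast
    show "g x (J y) = J (g x y)" if J: "\<And>x w. x \<in> S \<Longrightarrow> (J o\<^sub>L N x w) = (N x w o\<^sub>L J) \<and> (J o\<^sub>L Th x w) = (Th x w o\<^sub>L J)
         \<and> (J o\<^sub>L Ts x w) = (Ts x w o\<^sub>L J)" for J y
    proof -
      let ?J = "shift_op 0 J"
      have Jv: "J (N x w v) = N x w (J v)" "J (Th x w v) = Th x w (J v)" "J (Ts x w v) = Ts x w (J v)" if "x \<in> S" for x w v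
        using J[OF that, of w] by (metis blinfun_apply_blinfun_compose)+
      have J\<Phi>: "?J (\<Phi> x f) = \<Phi> x (?J f)" for f
        by (rule comm') (use x r Jv in \<open>auto intro!: bcontfun_eqI simp: aw blinfun.bilinear_simps\<close>)
      have JP: "?J (?P f) = ?P (?J f)" for f by (rule bcontfun_eqI) (simp add: blinfun.bilinear_simps)
      have JT: "?J (T x f) = T x (?J f)" for f
        by (simp add: Tapp blinfun.bilinear_simps J\<Phi> JP)
      have JR: "?J (R x f) = R x (?J f)" for f
        using arg_cong[OF JT[of "R x f"], of "R x"] by (simp add: RTv[OF x] TRv[OF x])
      have "?J (const_loop y) = const_loop (J y)" by (rule bcontfun_eqI) (simp add: blinfun.bilinear_simps)
      hence "u x (J y) = ?J (u x y)" by (simp add: u_def JR)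
      thus ?thesis by (simp add: g_def)
    qed
    fix y
    define du where "du h = - R x (T' x h (u x y))" for h
    define dw where "dw h = \<Phi> x (a x h (u x y) + du h)" for h
    have Du: "((\<lambda>x. u x y) has_derivative du) (at x)"
      unfolding u_def
      by (rule has_derivative_eq_rhs[OF bounded_linear.has_derivative[OF blinfun.bounded_linear_left dR[OF x]]])
         (simp add: du_def[abs_def] u_def blinfun.bilinear_simps)
    have Dw: "((\<lambda>x. w x y) has_derivative dw) (at x)"
      unfolding w_def
      by (rule has_derivative_eq_rhs[OF blinfun.FDERIV[OF d\<Phi>r[OF x] Du]])
         (simp add: dw_def[abs_def] blinfun.bilinear_simps add.commute)
    have inB: "open (ball p r)" "x \<in> ball p r" using x by auto
    have Pdu: "?P (du h) = du h" for h
    proof -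
      have "((\<lambda>x. ?P (u x y)) has_derivative (\<lambda>h. ?P (du h))) (at x)"
        by (rule bounded_linear.has_derivative[OF blinfun.bounded_linear_right Du])
      hence "((\<lambda>x. u x y) has_derivative (\<lambda>h. ?P (du h))) (at x)"
        by (rule has_derivative_transform_within_open[OF _ inB]) (simp add: Pu)
      thus ?thesis using has_derivative_unique[OF Du] by metis
    qed
    have Pdw: "?P (dw h) = 0" for h
    proof -
      have "((\<lambda>x. ?P (w x y)) has_derivative (\<lambda>h. ?P (dw h))) (at x)"
        by (rule bounded_linear.has_derivative[OF blinfun.bounded_linear_right Dw])
      hence "((\<lambda>x. const_loop y) has_derivative (\<lambda>h. ?P (dw h))) (at x)"
        by (rule has_derivative_transform_within_open[OF _ inB]) (simp add: Pw)
      thus ?thesis using has_derivative_unique[OF has_derivative_const] by metis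
    qed
    have dF: "apply_bcontfun (dw h) (-1) = inv (g x) (Th x h (g x y))" for h
    proof -
      define c where "c = inv (g x) (Th x h (g x y))"
      have c: "g x c = Th x h (g x y)" unfolding c_def by (rule surj_f_inv_f[OF bij_is_surj[OF bijg[OF x]]])
      let ?S = "shift_op 1 id_blinfun :: 'c loop \<Rightarrow>\<^sub>L 'c loop"
      \<comment> \<open>By the choice of \<open>c\<close> the coefficient of \<open>\<lambda>\<^sup>-\<^sup>1\<close> in \<open>v\<close> vanishes, so \<open>v\<close> is a power series; as
        \<open>\<Phi> v\<close> has only negative powers, \<open>T v = 0\<close>.\<close>
      define v where "v = a x h (u x y) + du h - ?S (u x c)"
      have S\<Phi>: "?S (\<Phi> x f) = \<Phi> x (?S f)" for f
        by (rule comm') (use x r in \<open>auto intro!: bcontfun_eqI simp: aw blinfun.bilinear_simps algebra_simps\<close>)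
      have du0: "apply_bcontfun (du h) k = 0" if "k < 0" for k
        using arg_cong[OF Pdu[of h], of "\<lambda>f. apply_bcontfun f k"] that by simp
      have Pv: "?P v = v"
      proof (rule bcontfun_eqI)
        fix k :: int
        consider "k \<ge> 0" | "k = -1" | "k < -1" by linarith
        thus "apply_bcontfun (?P v) k = apply_bcontfun v k"
        proof cases
          case 2
          thus ?thesis using c u0[OF x, of "-1" y] u0[OF x, of "-2" y]
            by (simp add: v_def aw loop_simps blinfun.bilinear_simps du0 g_def)
        next
          case 3
          thus ?thesis
            by (simp add: v_def aw loop_simps blinfun.bilinear_simps du0 u0[OF x])
        qed simp
      qed
      have \<Phi>v: "\<Phi> x v = dw h - ?S (w x c)"
        by (simp add: v_def dw_def blinfun.bilinear_simps S\<Phi> w_def)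
      have "?P (?S (w x c)) = 0"
        by (rule bcontfun_eqI) (simp add: wpos[OF x])
      hence "T x v = 0" by (simp add: Tapp Pv \<Phi>v blinfun.bilinear_simps Pdw)
      hence "v = 0" using RTv[OF x, of v] by (simp add: blinfun.bilinear_simps)
      hence "dw h = ?S (w x c)" using \<Phi>v by (simp add: blinfun.bilinear_simps)
      thus ?thesis by (simp add: wpos[OF x] c_def)
    qed
    show "((\<lambda>x. F x y) has_derivative (\<lambda>h. inv (g x) (Th x h (g x y)))) (at x)"
      using bounded_linear.has_derivative[OF blinfun.bounded_linear_right[of "loop_coeff (-1)"] Dw]
      by (simp add: F_def dF)
  qed
qed

section \<open>Directional derivatives of holomorphic functions\<close>

lemma norm_vector_scale_complex: "norm (c *s v) = norm c * norm v" for v :: "complex ^ 'n"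
  by (simp add: norm_vec_def norm_mult L2_set_right_distrib)

lemma bounded_linear_vector_scale: "bounded_linear (\<lambda>c. c *s (v :: complex ^ 'n))"
  by (rule bounded_linear_intro[of _ "norm v"])
     (auto simp: norm_vector_scale_complex vec_eq_iff algebra_simps)

lemma bounded_linear_vector_scale_right: "bounded_linear (\<lambda>v :: complex ^ 'n. c *s v)"
  by (rule bounded_linear_intro[of _ "norm c"])
     (auto simp: norm_vector_scale_complex vec_eq_iff algebra_simps)

lemma vector_scale_of_real: "complex_of_real k *s u = k *\<^sub>R u" for u :: "complex ^ 'm"
  by (simp add: vec_eq_iff scaleR_conv_of_real[where 'a = complex])

lemma holo_onD:
  assumes "holo_on f S" "z \<in> S"
  shows "(f has_derivative frechet_derivative f (at z)) (at z)"
    and "frechet_derivative f (at z) (c *s v) = c * frechet_derivative f (at z) v"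
  using assms frechet_derivative_at unfolding holo_on_def by metis+

abbreviation circle_point :: "real \<Rightarrow> real \<Rightarrow> complex" where
  "circle_point r t \<equiv> of_real r * exp (2 * of_real pi * \<i> * of_real t)"

lemma small_discs_in_open_set:
  fixes S :: "(complex ^ 'n) set" and a :: "complex ^ 'n"
  assumes "open S" "z0 \<in> S"
  obtains d r where "d > 0" "r > 0"
    "\<And>z \<zeta>. z \<in> ball z0 d \<Longrightarrow> norm \<zeta> \<le> r \<Longrightarrow> z + \<zeta> *s a \<in> S"
proof -
  obtain e where e: "e > 0" "ball z0 e \<subseteq> S" using assms open_contains_ball by blast
  define r where "r = e / (2 * (norm a + 1))"
  have b: "norm a + 1 > 0" by (simp add: add_nonneg_pos)
  have r: "r > 0" "r * norm a \<le> e / 2" using e(1) b by (simp_all add: r_def field_simps)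
  show thesis
  proof (rule that[of "e / 2" r])
    fix z and \<zeta> :: complex assume z: "z \<in> ball z0 (e / 2)" and \<zeta>: "norm \<zeta> \<le> r"
    have "norm (\<zeta> *s a) \<le> e / 2"
      unfolding norm_vector_scale_complex using mult_right_mono[OF \<zeta> norm_ge_zero[of a]] r(2) by linarith
    hence "dist z0 (z + \<zeta> *s a) < e"
      using z norm_triangle_ineq[of "z - z0" "\<zeta> *s a"] by (simp add: dist_norm norm_minus_commute algebra_simps)
    thus "z + \<zeta> *s a \<in> S" using e(2) by auto
  qed (use e(1) r(1) in auto)
qed

text \<open>The Cauchy formula for the derivative at \<open>0\<close> of \<open>\<zeta> \<mapsto> f (z + \<zeta> a)\<close>. It expresses the derivative of
  \<open>f\<close> by values of \<open>f\<close>, so that regularity in \<open>z\<close> can be obtained under the integral sign.\<close>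
lemma directional_derivative_circle_average:
  fixes f :: "complex ^ 'n \<Rightarrow> complex"
  assumes f: "holo_on f S" and r: "r > 0" and mem: "\<And>\<zeta>. norm \<zeta> \<le> r \<Longrightarrow> z + \<zeta> *s a \<in> S"
  shows "frechet_derivative f (at z) a = integral {0..1} (\<lambda>t. f (z + circle_point r t *s a) / circle_point r t)"
proof -
  define \<phi> where "\<phi> \<zeta> = f (z + \<zeta> *s a)" for \<zeta>
  have D: "(\<phi> has_field_derivative frechet_derivative f (at (z + \<zeta> *s a)) a) (at \<zeta>)" if "norm \<zeta> \<le> r" for \<zeta>
  proof -
    have "((\<lambda>\<zeta>. z + \<zeta> *s a) has_derivative (\<lambda>h. h *s a)) (at \<zeta>)"
      using bounded_linear.has_derivative[OF bounded_linear_vector_scale has_derivative_ident, of a]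
      by (auto intro!: derivative_eq_intros)
    from has_derivative_compose[OF this holo_onD(1)[OF f mem[OF that]]]
    show ?thesis unfolding has_field_derivative_def \<phi>_def
      by (rule has_derivative_eq_rhs) (simp add: holo_onD(2)[OF f mem[OF that]] mult.commute fun_eq_iff)
  qed
  have c: "continuous_on (cball 0 r) \<phi>"
    using D by (intro continuous_at_imp_continuous_on ballI DERIV_isCont) auto
  have h: "\<phi> holomorphic_on ball 0 r"
    unfolding holomorphic_on_def
  proof
    fix \<zeta> :: complex assume "\<zeta> \<in> ball 0 r"
    with D[of \<zeta>] have "\<phi> field_differentiable at \<zeta>" by (auto simp: field_differentiable_def)
    thus "\<phi> field_differentiable at \<zeta> within ball 0 r" by (rule field_differentiable_at_within)
  qed
  have "(\<phi> has_field_derivative (1 / (2 * of_real pi * \<i>) * contour_integral (circlepath 0 r) (\<lambda>u. \<phi> u / (u - 0)\<^sup>2))) (at 0)"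
    using Cauchy_derivative_integral_circlepath(2)[OF c h, of 0] r by simp
  hence "frechet_derivative f (at (z + 0 *s a)) a = 1 / (2 * of_real pi * \<i>) * contour_integral (circlepath 0 r) (\<lambda>u. \<phi> u / (u - 0)\<^sup>2)"
    using D[of 0] r DERIV_unique by fastforce
  also have "contour_integral (circlepath 0 r) (\<lambda>u. \<phi> u / (u - 0)\<^sup>2) = 
     integral {0..1} (\<lambda>t. (2 * of_real pi * \<i>) * (\<phi> (circle_point r t) / circle_point r t))"
    unfolding contour_integral_integral vector_derivative_circlepath
    by (rule integral_cong) (use r in \<open>simp add: circlepath power2_eq_square field_simps\<close>)
  finally show ?thesis unfolding integral_mult_right by (simp add: \<phi>_def)
qed

lemma continuous_on_directional_derivative:
  fixes f :: "complex ^ 'n \<Rightarrow> complex"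
  assumes f: "holo_on f S" and S: "open S"
  shows "continuous_on S (\<lambda>z. frechet_derivative f (at z) a)"
proof (rule continuous_at_imp_continuous_on, rule ballI)
  fix z0 assume z0: "z0 \<in> S"
  obtain d r where d: "d > 0" and r: "r > 0"
    and disc: "\<And>z \<zeta>. z \<in> ball z0 d \<Longrightarrow> norm \<zeta> \<le> r \<Longrightarrow> z + \<zeta> *s a \<in> S"
    using small_discs_in_open_set[OF S z0] by metis
  have mem: "z + circle_point r t *s a \<in> S" if "z \<in> ball z0 d" for z t
    by (rule disc[OF that]) (use r in \<open>simp add: norm_mult\<close>)
  have cf: "continuous_on S f"
    using holo_onD(1)[OF f] by (intro continuous_at_imp_continuous_on ballI) (blast intro: has_derivative_continuous)
  have "continuous_on (ball z0 d \<times> cbox 0 (1::real)) (\<lambda>(z, t). f (z + circle_point r t *s a) / circle_point r t)"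
    unfolding case_prod_unfold using r mem
    by (intro continuous_intros continuous_on_compose2[OF cf] bounded_linear.continuous_on[OF bounded_linear_vector_scale]) auto
  from integral_continuous_on_param[OF this]
  have "continuous_on (ball z0 d) (\<lambda>z. frechet_derivative f (at z) a)"
    by (rule continuous_on_eq) (simp add: directional_derivative_circle_average[OF f r disc] cbox_interval)
  thus "isCont (\<lambda>z. frechet_derivative f (at z) a) z0"
    using d by (simp add: continuous_on_eq_continuous_at)
qed

text \<open>The circle average may be differentiated under the integral sign, because the derivative of \<open>f\<close>
  is continuous, again by the circle average; the derivative of the average is complex linear because
  that of the integrand is.\<close>
theorem holo_on_directional_derivative:
  fixes f :: "complex ^ 'n \<Rightarrow> complex"
  assumes f: "holo_on f S" and S: "open S"
  shows "holo_on (\<lambda>z. frechet_derivative f (at z) a) S"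
  unfolding holo_on_def
proof
  fix z0 assume z0: "z0 \<in> S"
  obtain d r where d: "d > 0" and r: "r > 0"
    and disc: "\<And>z \<zeta>. z \<in> ball z0 d \<Longrightarrow> norm \<zeta> \<le> r \<Longrightarrow> z + \<zeta> *s a \<in> S"
    using small_discs_in_open_set[OF S z0] by metis
  have mem: "z + circle_point r t *s a \<in> S" if "z \<in> ball z0 d" for z t
    by (rule disc[OF that]) (use r in \<open>simp add: norm_mult\<close>)
  define f' where "f' z = Blinfun (frechet_derivative f (at z))" for z
  have f'_apply: "blinfun_apply (f' z) = frechet_derivative f (at z)" if "z \<in> S" for z
    unfolding f'_def using holo_onD(1)[OF f that] by (intro bounded_linear_Blinfun_apply has_derivative_bounded_linear)
  have cf': "continuous_on S f'"
    by (rule continuous_on_blinfun_componentwise, rule continuous_on_eq[OF continuous_on_directional_derivative[OF f S]])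
       (simp add: f'_apply)
  have cf: "continuous_on S f"
    using holo_onD(1)[OF f] by (intro continuous_at_imp_continuous_on ballI) (blast intro: has_derivative_continuous)
  define fx where "fx z t = blinfun_mult_right (1 / circle_point r t) o\<^sub>L f' (z + circle_point r t *s a)" for z t
  have cfx: "continuous_on (ball z0 d \<times> cbox 0 (1::real)) (\<lambda>(z, t). fx z t)"
    unfolding case_prod_unfold fx_def using r mem
    by (intro continuous_intros continuous_on_compose2[OF cf'] bounded_linear.continuous_on[OF bounded_linear_vector_scale]) auto
  have ct: "continuous_on (cbox 0 (1::real)) (\<lambda>t. f (z + circle_point r t *s a) / circle_point r t)" if "z \<in> ball z0 d" for z
    using r mem[OF that]
    by (intro continuous_intros continuous_on_compose2[OF cf] bounded_linear.continuous_on[OF bounded_linear_vector_scale]) auto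
  have der: "((\<lambda>z. f (z + circle_point r t *s a) / circle_point r t) has_derivative blinfun_apply (fx z t)) (at z within ball z0 d)" if "z \<in> ball z0 d" for z t
  proof -
    have "((\<lambda>z. z + circle_point r t *s a) has_derivative (\<lambda>v. v)) (at z within ball z0 d)"
      by (auto intro!: derivative_eq_intros)
    from has_derivative_compose[OF this holo_onD(1)[OF f mem[OF that]]]
    have "((\<lambda>z. (1 / circle_point r t) * f (z + circle_point r t *s a)) has_derivative (\<lambda>v. (1 / circle_point r t) * frechet_derivative f (at (z + circle_point r t *s a)) v)) (at z within ball z0 d)"
      by (rule has_derivative_mult_right)
    thus ?thesis by (simp add: fx_def f'_apply[OF mem[OF that]] o_def blinfun_compose.rep_eq blinfun_mult_right.rep_eq)
  qed
  have z0d: "z0 \<in> ball z0 d" using d by simp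
  have ifx: "fx z0 integrable_on cbox 0 1"
    by (rule integrable_continuous, rule continuous_on_compose2[OF cfx, of _ "\<lambda>t. (z0,t)", simplified])
       (use d in \<open>auto intro!: continuous_intros\<close>)
  have "((\<lambda>z. integral (cbox 0 1) (\<lambda>t. f (z + circle_point r t *s a) / circle_point r t)) has_derivative integral (cbox 0 1) (fx z0)) (at z0 within ball z0 d)"
    by (rule leibniz_rule[OF der integrable_continuous[OF ct] cfx z0d convex_ball])
  hence "((\<lambda>z. integral (cbox 0 1) (\<lambda>t. f (z + circle_point r t *s a) / circle_point r t)) has_derivative integral (cbox 0 1) (fx z0)) (at z0)"
    using at_within_open[OF z0d open_ball] by simp
  hence D: "((\<lambda>z. frechet_derivative f (at z) a) has_derivative integral (cbox 0 1) (fx z0)) (at z0)"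
    by (rule has_derivative_transform_within_open[OF _ open_ball z0d])
       (simp add: directional_derivative_circle_average[OF f r disc] cbox_interval)
  have "integral (cbox 0 1) (fx z0) (c *s v) = c * integral (cbox 0 1) (fx z0) v" for c v
  proof -
    have "fx z0 t (c *s v) = c * fx z0 t v" for t
      by (simp add: fx_def f'_apply[OF mem[OF z0d]] holo_onD(2)[OF f mem[OF z0d]] blinfun_mult_right.rep_eq)
    thus ?thesis unfolding blinfun_apply_integral[OF ifx] by (simp only: integral_mult_right)
  qed
  with D show "\<exists>f'. ((\<lambda>z. frechet_derivative f (at z) a) has_derivative f') (at z0) \<and> (\<forall>c v. f' (c *s v) = c * f' v)"
    by blast
qed

section \<open>Families of endomorphisms over a coordinate domain\<close>

definition C1_on :: "('a::euclidean_space \<Rightarrow> 'b::real_normed_vector) \<Rightarrow> 'a set \<Rightarrow> bool" where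
  "C1_on f S \<longleftrightarrow>
     (\<exists>f'. (\<forall>x\<in>S. (f has_derivative blinfun_apply (f' x)) (at x)) \<and> continuous_on S f')"

lemma C1_on_bounded_linear:
  assumes L: "bounded_linear L" and f: "C1_on f S"
  shows "C1_on (\<lambda>z. L (f z)) S"
proof -
  obtain f' where f': "\<And>x. x \<in> S \<Longrightarrow> (f has_derivative blinfun_apply (f' x)) (at x)" "continuous_on S f'"
    using f unfolding C1_on_def by blast
  have "((\<lambda>z. L (f z)) has_derivative blinfun_apply (Blinfun L o\<^sub>L f' x)) (at x)" if "x \<in> S" for x
    using bounded_linear.has_derivative[OF L f'(1)[OF that]]
    by (simp add: blinfun_compose.rep_eq bounded_linear_Blinfun_apply[OF L] o_def)
  thus ?thesis unfolding C1_on_def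
    by (intro exI[of _ "\<lambda>x. Blinfun L o\<^sub>L f' x"]) (auto intro!: continuous_intros f')
qed

lemma C1_on_add:
  assumes "C1_on f S" "C1_on g S"
  shows "C1_on (\<lambda>z. f z + g z) S"
proof -
  obtain f' g' where "\<And>x. x \<in> S \<Longrightarrow> (f has_derivative blinfun_apply (f' x)) (at x)" "continuous_on S f'"
    "\<And>x. x \<in> S \<Longrightarrow> (g has_derivative blinfun_apply (g' x)) (at x)" "continuous_on S g'"
    using assms unfolding C1_on_def by metis
  thus ?thesis unfolding C1_on_def
    by (intro exI[of _ "\<lambda>x. f' x + g' x"]) (auto intro!: continuous_intros has_derivative_add simp: plus_blinfun.rep_eq)
qed

lemma C1_on_const: "C1_on (\<lambda>z. c) S"
  unfolding C1_on_def by (rule exI[of _ "\<lambda>x. 0"]) (simp add: zero_blinfun.rep_eq)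

lemma C1_on_sum: "(\<And>i. i \<in> I \<Longrightarrow> C1_on (f i) S) \<Longrightarrow> C1_on (\<lambda>z. \<Sum>i\<in>I. f i z) S"
  by (induction I rule: infinite_finite_induct) (auto intro!: C1_on_const C1_on_add)

lemma C1_on_derivative:
  assumes "C1_on f S" "z \<in> S"
  shows "(f has_derivative frechet_derivative f (at z)) (at z)"
  using assms unfolding C1_on_def by (metis frechet_derivative_at)

text \<open>Connection forms and endomorphism forms are given by their values on constant arguments; as a
  one-form with values in operators such a family is continuously differentiable in the operator
  norm, since all spaces involved have finite dimension.\<close>
lemma bilinear_family_as_blinfun:
  fixes G :: "'a::euclidean_space \<Rightarrow> 'b::euclidean_space \<Rightarrow> 'c::euclidean_space \<Rightarrow> 'd::real_normed_vector"
  assumes S: "open S" and C1: "\<And>a u. C1_on (\<lambda>z. G z a u) S"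
    and lin: "\<And>z a. z \<in> S \<Longrightarrow> linear (G z a)" "\<And>z u. z \<in> S \<Longrightarrow> linear (\<lambda>a. G z a u)"
  obtains N N' where "\<And>z. z \<in> S \<Longrightarrow> (N has_derivative blinfun_apply (N' z)) (at z)" "continuous_on S N'"
    "\<And>z a u. z \<in> S \<Longrightarrow> blinfun_apply (blinfun_apply (N z) a) u = G z a u"
    "\<And>z v a u. z \<in> S \<Longrightarrow> N' z v a u = frechet_derivative (\<lambda>z. G z a u) (at z) v"
proof -
  define E :: "'b \<Rightarrow> 'c \<Rightarrow> 'd \<Rightarrow> 'b \<Rightarrow>\<^sub>L 'c \<Rightarrow>\<^sub>L 'd" where
    "E i j y = blinfun_scaleR_left (blinfun_scaleR_left y o\<^sub>L blinfun_inner_left j) o\<^sub>L blinfun_inner_left i" for i j y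
  have blE: "bounded_linear (E i j)" for i j
    unfolding E_def
    by (intro bounded_linear_compose[OF bounded_linear_compose_left]
         bounded_linear_compose[OF bounded_linear_blinfun_scaleR_left] bounded_linear_blinfun_scaleR_left)
  have E: "E i j y a u = (a \<bullet> i) *\<^sub>R (u \<bullet> j) *\<^sub>R y" for i j y a u
    by (simp add: E_def scaleR_blinfun.rep_eq blinfun_inner_left.rep_eq)
  define N where "N z = (\<Sum>i\<in>Basis. \<Sum>j\<in>Basis. E i j (G z i j))" for z
  have "C1_on N S"
    unfolding N_def by (intro C1_on_sum C1_on_bounded_linear[OF blE] C1)
  then obtain N' where N': "\<And>z. z \<in> S \<Longrightarrow> (N has_derivative blinfun_apply (N' z)) (at z)" "continuous_on S N'"
    unfolding C1_on_def by blast
  have NG: "blinfun_apply (blinfun_apply (N z) a) u = G z a u" if z: "z \<in> S" for z a u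
  proof -
    have u: "G z i u = (\<Sum>j\<in>Basis. (u \<bullet> j) *\<^sub>R G z i j)" for i
      using linear_sum[OF lin(1)[OF z, of i], of "\<lambda>j. (u \<bullet> j) *\<^sub>R j" Basis]
      by (simp add: euclidean_representation linear_scale[OF lin(1)[OF z]])
    have "G z a u = (\<Sum>i\<in>Basis. (a \<bullet> i) *\<^sub>R G z i u)"
      using linear_sum[OF lin(2)[OF z, of u], of "\<lambda>i. (a \<bullet> i) *\<^sub>R i" Basis] linear_scale[OF lin(2)[OF z]]
      by (simp only: euclidean_representation)
    also have "\<dots> = (\<Sum>i\<in>Basis. (a \<bullet> i) *\<^sub>R (\<Sum>j\<in>Basis. (u \<bullet> j) *\<^sub>R G z i j))"
      by (simp only: u)
    also have "\<dots> = N z a u"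
      by (simp add: N_def blinfun.sum_left E scaleR_sum_right)
    finally show ?thesis by simp
  qed
  have "N' z v a u = frechet_derivative (\<lambda>z. G z a u) (at z) v" if z: "z \<in> S" for z v a u
  proof -
    have "((\<lambda>z. N z a u) has_derivative (\<lambda>v. N' z v a u)) (at z)"
      by (intro bounded_linear.has_derivative[OF blinfun.bounded_linear_left] N' z)
    hence "((\<lambda>z. G z a u) has_derivative (\<lambda>v. N' z v a u)) (at z)"
      by (rule has_derivative_transform_within_open[OF _ S z]) (simp add: NG)
    thus ?thesis using frechet_derivative_at by metis
  qed
  thus thesis using that N' NG by blast
qed

section \<open>The equations of a harmonic bundle at a point\<close>

text \<open>The conclusions are the parts of \<open>(\<partial>bar + \<theta>)\<^sup>2\<close> of type \<open>(0,2)\<close>, \<open>(1,1)\<close> and \<open>(2,0)\<close>, up to the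
  factor \<open>4\<close>: with \<open>R\<close> the curvature of \<open>\<nabla>\<close>, \<open>C\<close> the covariant derivative of \<open>\<alpha>\<close>, and \<open>K\<close> the
  commutator of the values of \<open>\<alpha>\<close>. Multiplying an argument by \<open>\<i>\<close> multiplies them by different
  units, so that their sum vanishes only if each of them does.\<close>
lemma separate_types:
  fixes R C K :: "complex ^ 'n \<Rightarrow> complex ^ 'n \<Rightarrow> complex" and i :: "complex ^ 'n \<Rightarrow> complex ^ 'n"
  defines "i \<equiv> \<lambda>a. \<i> *s a"
  assumes R: "\<And>a b. R (- a) b = - R a b" "\<And>a b. R a (- b) = - R a b"
    and C: "\<And>a b. C (- a) b = - C a b" "\<And>a b. C a (- b) = - C a b"
    and K: "\<And>a b. K (- a) b = - K a b" "\<And>a b. K a (- b) = - K a b"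
    and Q: "\<And>a b. (R a b + \<i> * R (i a) b + \<i> * R a (i b) - R (i a) (i b))
       + (C a b - \<i> * C a (i b) + \<i> * C (i a) b + C (i a) (i b))
       - (C b a - \<i> * C b (i a) + \<i> * C (i b) a + C (i b) (i a))
       + (K a b - \<i> * K a (i b) - \<i> * K (i a) b - K (i a) (i b)) = 0"
  shows "R a b + \<i> * R (i a) b + \<i> * R a (i b) - R (i a) (i b) = 0"
    and "C a b - \<i> * C a (i b) + \<i> * C (i a) b + C (i a) (i b) = 0"
    and "K a b - \<i> * K a (i b) - \<i> * K (i a) b - K (i a) (i b) = 0"
proof -
  have ii: "i (i a) = - a" for a unfolding i_def by (simp add: vec_eq_iff)
  define R2 where "R2 a b = R a b + \<i> * R (i a) b + \<i> * R a (i b) - R (i a) (i b)" for a b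
  define C2 where "C2 a b = C a b - \<i> * C a (i b) + \<i> * C (i a) b + C (i a) (i b)" for a b
  define K2 where "K2 a b = K a b - \<i> * K a (i b) - \<i> * K (i a) b - K (i a) (i b)" for a b
  have Q2: "R2 a b + C2 a b - C2 b a + K2 a b = 0" for a b using Q unfolding R2_def C2_def K2_def by blast
  have ix: "\<i> * (\<i> * x) = - x" for x :: complex by simp
  have Ri: "R2 (i a) b = - \<i> * R2 a b" "R2 a (i b) = - \<i> * R2 a b" for a b
    unfolding R2_def ii R by (simp_all add: algebra_simps ix)
  have Ci: "C2 (i a) b = - \<i> * C2 a b" "C2 a (i b) = \<i> * C2 a b" for a b
    unfolding C2_def ii C by (simp_all add: algebra_simps ix)
  have Ki: "K2 (i a) b = \<i> * K2 a b" "K2 a (i b) = \<i> * K2 a b" for a b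
    unfolding K2_def ii K by (simp_all add: algebra_simps ix)
  have 1: "R2 a b + C2 a b - C2 b a + K2 a b = 0" by (rule Q2)
  have 2: "- R2 a b + C2 a b - C2 b a - K2 a b = 0" using Q2[of "i a" "i b"] by (simp add: Ri Ci Ki)
  have "\<i> * (- R2 a b - C2 a b - C2 b a + K2 a b) = 0" using Q2[of "i a" b] by (simp add: Ri Ci Ki algebra_simps)
  hence 3: "- R2 a b - C2 a b - C2 b a + K2 a b = 0" by simp
  have "\<i> * (- R2 a b + C2 a b + C2 b a + K2 a b) = 0" using Q2[of a "i b"] by (simp add: Ri Ci Ki algebra_simps)
  hence 4: "- R2 a b + C2 a b + C2 b a + K2 a b = 0" by simp
  have "4 * R2 a b = 0" "4 * C2 a b = 0" "4 * K2 a b = 0" using 1 2 3 4 by algebra+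
  hence "R2 a b = 0" "C2 a b = 0" "K2 a b = 0" by simp_all
  thus "R a b + \<i> * R (i a) b + \<i> * R a (i b) - R (i a) (i b) = 0"
    "C a b - \<i> * C a (i b) + \<i> * C (i a) b + C (i a) (i b) = 0"
    "K a b - \<i> * K a (i b) - \<i> * K (i a) b - K (i a) (i b) = 0"
    by (simp_all add: R2_def C2_def K2_def)
qed

definition hermitian_form :: "(complex ^ 'r \<Rightarrow> complex ^ 'r \<Rightarrow> complex) \<Rightarrow> bool" where
  "hermitian_form h \<longleftrightarrow> (\<forall>u v w. h (u + v) w = h u w + h v w) \<and> (\<forall>c u v. h (c *s u) v = c * h u v) \<and>
     (\<forall>u v. h v u = cnj (h u v)) \<and> (\<forall>u. u \<noteq> 0 \<longrightarrow> Re (h u u) > 0)"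

lemma hermitian_formD:
  assumes "hermitian_form h"
  shows "h (u + v) w = h u w + h v w" "h (c *s u) v = c * h u v" "h w (u + v) = h w u + h w v"
    "h u (c *s v) = cnj c * h u v" "h (u - v) w = h u w - h v w" "h w (u - v) = h w u - h w v"
    "h (- u) v = - h u v" "h u (- v) = - h u v"
    "(\<And>v. h u v = 0) \<Longrightarrow> u = 0"
proof -
  show a: "h (u + v) w = h u w + h v w" and s: "h (c *s u) v = c * h u v" for u v w c
    using assms unfolding hermitian_form_def by blast+
  have c: "h v u = cnj (h u v)" for u v using assms unfolding hermitian_form_def by blast
  show a': "h w (u + v) = h w u + h w v" and s': "h u (c *s v) = cnj c * h u v" for u v w c
    using a[of u v w] s[of c v u] c by (metis complex_cnj_add, metis complex_cnj_mult)
  show "h (u - v) w = h u w - h v w" "h w (u - v) = h w u - h w v" for u v w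
    using a[of "u - v" v w] a'[of w "u - v" v] by simp_all
  show "h (- u) v = - h u v" "h u (- v) = - h u v"
    using s[of "-1" u v] s'[of u "-1" v] by simp_all
  show "(\<And>v. h u v = 0) \<Longrightarrow> u = 0"
    using assms unfolding hermitian_form_def by (metis less_irrefl zero_complex.sel(1))
qed

text \<open>An operator \<open>S + \<i> T\<close> with \<open>S\<close> and \<open>T\<close> both selfadjoint (or both skew) vanishes only if \<open>S\<close> and \<open>T\<close>
  do. This replaces the equations of a harmonic bundle by their real and imaginary parts and so
  contains the adjoint equations for \<open>\<partial>\<close> and \<open>\<theta>*\<close>.\<close>
lemma adjoint_pair_vanishes:
  fixes h :: "complex ^ 'r \<Rightarrow> complex ^ 'r \<Rightarrow> complex" and \<sigma> :: complex
  assumes h: "hermitian_form h"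
    and S: "\<And>u v. h (S u) v = \<sigma> * h u (S v)" and T: "\<And>u v. h (T u) v = \<sigma> * h u (T v)"
    and 0: "\<And>u. S u + \<i> *s T u = 0"
  shows "S u = 0" "T u = 0"
proof -
  have ST: "S u = (- \<i>) *s T u" for u using 0[of u] by (simp add: eq_neg_iff_add_eq_0)
  have "h (T u) v = 0" for u v
  proof -
    have "- \<i> * h (T u) v = \<sigma> * (cnj (- \<i>) * h u (T v))"
      using S[of u v] unfolding ST hermitian_formD[OF h] .
    also have "\<dots> = \<i> * h (T u) v" by (simp add: T)
    finally show ?thesis by simp
  qed
  thus "T u = 0" using hermitian_formD(9)[OF h] by blast
  thus "S u = 0" by (simp add: ST)
qed

text \<open>The selfadjoint antisymmetric form \<open>L a b = C a b - C b a\<close> is zero: the \<open>(0,2)\<close>-part of the flatness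
  of \<open>D\<close> gives \<open>L (i a) (i b) = L a b\<close>, the vanishing of \<open>\<partial>bar \<theta>\<close> gives
  \<open>L (i a) (i b) = - L a b\<close>. This route involves first derivatives of the metric only.\<close>
lemma harmonic_curvature_identities:
  fixes R C K :: "complex ^ 'n \<Rightarrow> complex ^ 'n \<Rightarrow> complex ^ 'r \<Rightarrow> complex ^ 'r"
    and i :: "complex ^ 'n \<Rightarrow> complex ^ 'n"
  defines "i \<equiv> \<lambda>a. \<i> *s a"
  assumes h: "hermitian_form h"
    and R: "\<And>a b u. R (- a) b u = - R a b u" "\<And>a b u. R a (- b) u = - R a b u"
    and C: "\<And>a b u. C (- a) b u = - C a b u" "\<And>a b u. C a (- b) u = - C a b u"
    and K: "\<And>a b u. K (- a) b u = - K a b u" "\<And>a b u. K a (- b) u = - K a b u"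
    and Cadj: "\<And>a b u v. h (C a b u) v = h u (C a b v)"
    and Kadj: "\<And>a b u v. h (K a b u) v = - h u (K a b v)"
    and F: "\<And>a b u. R a b u + C a b u - C b a u + K a b u = 0"
    and Q: "\<And>a b u. (R a b u + \<i> *s R (i a) b u + \<i> *s R a (i b) u - R (i a) (i b) u)
       + (C a b u - \<i> *s C a (i b) u + \<i> *s C (i a) b u + C (i a) (i b) u)
       - (C b a u - \<i> *s C b (i a) u + \<i> *s C (i b) a u + C (i b) (i a) u)
       + (K a b u - \<i> *s K a (i b) u - \<i> *s K (i a) b u - K (i a) (i b) u) = 0"
  shows "C a b u = C b a u" "C (i a) b u = C a (i b) u" "K (i a) (i b) u = K a b u"
    "K a (i b) u = - K (i a) b u" "R a b u + K a b u = 0"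
proof -
  have types: "R a b u + \<i> *s R (i a) b u + \<i> *s R a (i b) u - R (i a) (i b) u = 0"
     "C a b u - \<i> *s C a (i b) u + \<i> *s C (i a) b u + C (i a) (i b) u = 0"
     "K a b u - \<i> *s K a (i b) u - \<i> *s K (i a) b u - K (i a) (i b) u = 0" for a b u
  proof -
    have "(R a b u $ k + \<i> * R (i a) b u $ k + \<i> * R a (i b) u $ k - R (i a) (i b) u $ k = 0) \<and>
       (C a b u $ k - \<i> * C a (i b) u $ k + \<i> * C (i a) b u $ k + C (i a) (i b) u $ k = 0) \<and>
       (K a b u $ k - \<i> * K a (i b) u $ k - \<i> * K (i a) b u $ k - K (i a) (i b) u $ k = 0)" for k
      unfolding i_def
      by (intro conjI separate_types[where R = "\<lambda>a b. R a b u $ k" and C = "\<lambda>a b. C a b u $ k" and K = "\<lambda>a b. K a b u $ k"])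
         (use arg_cong[OF Q, where f = "\<lambda>v. v $ k"] in \<open>auto simp: R C K i_def\<close>)
    thus "R a b u + \<i> *s R (i a) b u + \<i> *s R a (i b) u - R (i a) (i b) u = 0"
     "C a b u - \<i> *s C a (i b) u + \<i> *s C (i a) b u + C (i a) (i b) u = 0"
     "K a b u - \<i> *s K a (i b) u - \<i> *s K (i a) b u - K (i a) (i b) u = 0" 
      by (simp_all add: vec_eq_iff)
  qed
  note hD = hermitian_formD[OF h]
  have C1: "C a b u + C (i a) (i b) u = 0" "C (i a) b u - C a (i b) u = 0" for a b u
    by (rule adjoint_pair_vanishes[OF h, where S = "\<lambda>u. C a b u + C (i a) (i b) u" and T = "\<lambda>u. C (i a) b u - C a (i b) u" and \<sigma> = 1];
        use types(2)[of a b] in \<open>simp add: hD Cadj vec_eq_iff algebra_simps\<close>)+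
  have K1: "K a b u - K (i a) (i b) u = 0" "- K a (i b) u - K (i a) b u = 0" for a b u
    by (rule adjoint_pair_vanishes[OF h, where S = "\<lambda>u. K a b u - K (i a) (i b) u" and T = "\<lambda>u. - K a (i b) u - K (i a) b u" and \<sigma> = "-1"];
        use types(3)[of a b] in \<open>simp add: hD Kadj vec_eq_iff algebra_simps\<close>)+
  define L where "L a b u = C a b u - C b a u" for a b u
  have RL: "R a b u = - L a b u - K a b u" for a b u using F[of a b u] unfolding L_def by (simp add: algebra_simps eq_neg_iff_add_eq_0)
  have L1: "L a b u - L (i a) (i b) u = 0" for a b u
  proof (rule adjoint_pair_vanishes(1)[OF h, where S = "\<lambda>u. L a b u - L (i a) (i b) u" and T = "\<lambda>u. L (i a) b u + L a (i b) u" and \<sigma> = 1])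
    fix u
    have K0: "K (i a) (i b) u = K a b u" "K (i a) b u = - K a (i b) u" using K1[of a b u] by (simp_all add: algebra_simps eq_neg_iff_add_eq_0)
    show "L a b u - L (i a) (i b) u + \<i> *s (L (i a) b u + L a (i b) u) = 0"
      using types(1)[of a b u] unfolding RL K0 by (simp add: vec_eq_iff algebra_simps)
  qed (simp_all add: L_def hD Cadj)
  have "L (i a) (i b) u = - L a b u" for a b u
  proof -
    have "C (i a) (i b) u = - C a b u" for a b
      using C1(1)[of a b u] by (simp add: eq_neg_iff_add_eq_0 add.commute)
    thus ?thesis by (simp add: L_def)
  qed
  hence "L a b u + L a b u = 0" for a b u using L1[of a b u] by simp
  hence L0: "L a b u = 0" for a b u by (metis scaleR_2 scaleR_eq_0_iff zero_neq_numeral)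
  show "C a b u = C b a u" using L0[of a b u] by (simp add: L_def)
  show "C (i a) b u = C a (i b) u" using C1(2)[of a b u] by simp
  show "K (i a) (i b) u = K a b u" "K a (i b) u = - K (i a) b u" 
    using K1[of a b u] by (simp_all add: eq_neg_iff_add_eq_0 neg_eq_iff_add_eq_0)
  show "R a b u + K a b u = 0" using RL[of a b u] L0[of a b u] by simp
qed

section \<open>Harmonic bundles in a frame\<close>

text \<open>The \<open>(1,0)\<close>-part of an endomorphism form.\<close>
definition higgs_part :: "(complex ^ 'n \<Rightarrow> complex ^ 'r \<Rightarrow> complex ^ 'r) \<Rightarrow> complex ^ 'n \<Rightarrow> complex ^ 'r \<Rightarrow> complex ^ 'r" where
  "higgs_part \<alpha> a u = (1/2) *s (\<alpha> a u - \<i> *s \<alpha> (\<i> *s a) u)"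

definition dir_deriv :: "(complex ^ 'n \<Rightarrow> 'b::real_normed_vector) \<Rightarrow> complex ^ 'n \<Rightarrow> complex ^ 'n \<Rightarrow> 'b" where
  "dir_deriv f z a = frechet_derivative f (at z) a"

lemma dir_deriv_eq: "(f has_derivative f') (at z) \<Longrightarrow> dir_deriv f z = f'"
  unfolding dir_deriv_def using frechet_derivative_at by metis

text \<open>The operator \<open>\<partial>bar + \<theta>\<close> in a frame, applied in direction \<open>a\<close> to a section with value \<open>u\<close> and
  directional derivatives \<open>d\<close>.\<close>
definition dbar_higgs ::
  "(complex ^ 'n \<Rightarrow> complex ^ 'r \<Rightarrow> complex ^ 'r) \<Rightarrow> (complex ^ 'n \<Rightarrow> complex ^ 'r \<Rightarrow> complex ^ 'r) \<Rightarrow>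
    (complex ^ 'n \<Rightarrow> complex ^ 'r) \<Rightarrow> complex ^ 'r \<Rightarrow> complex ^ 'n \<Rightarrow> complex ^ 'r" where
  "dbar_higgs \<Gamma> \<alpha> d u a =
     (1/2) *s ((d a + \<Gamma> a u) + \<i> *s (d (\<i> *s a) + \<Gamma> (\<i> *s a) u)) + higgs_part \<alpha> a u"

text \<open>The coordinates of a harmonic bundle in a chart and a frame: the connection form \<open>\<Gamma>\<close> of \<open>\<nabla>\<close>, the
  Hermitian form \<open>\<alpha>\<close> and the metric \<open>h\<close>. That \<open>\<nabla>\<close> is a metric connection is recorded in
  \<open>cov_adjoint\<close>: the covariant derivative of \<open>\<alpha>\<close> is selfadjoint.\<close>
locale harmonic_frame =
  fixes \<Omega> :: "(complex ^ 'n) set"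
    and \<Gamma> \<alpha> :: "complex ^ 'n \<Rightarrow> complex ^ 'n \<Rightarrow> complex ^ 'r \<Rightarrow> complex ^ 'r"
    and h :: "complex ^ 'n \<Rightarrow> complex ^ 'r \<Rightarrow> complex ^ 'r \<Rightarrow> complex"
  assumes open_dom: "open \<Omega>"
    and C1_\<Gamma>: "C1_on (\<lambda>z. \<Gamma> z a u) \<Omega>" and C1_\<alpha>: "C1_on (\<lambda>z. \<alpha> z a u) \<Omega>"
    and \<Gamma>_real_linear: "z \<in> \<Omega> \<Longrightarrow> linear (\<lambda>a. \<Gamma> z a u)"
    and \<alpha>_real_linear: "z \<in> \<Omega> \<Longrightarrow> linear (\<lambda>a. \<alpha> z a u)"
    and \<Gamma>_add: "z \<in> \<Omega> \<Longrightarrow> \<Gamma> z a (u + v) = \<Gamma> z a u + \<Gamma> z a v"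
    and \<Gamma>_scale: "z \<in> \<Omega> \<Longrightarrow> \<Gamma> z a (c *s u) = c *s \<Gamma> z a u"
    and \<alpha>_add: "z \<in> \<Omega> \<Longrightarrow> \<alpha> z a (u + v) = \<alpha> z a u + \<alpha> z a v"
    and \<alpha>_scale: "z \<in> \<Omega> \<Longrightarrow> \<alpha> z a (c *s u) = c *s \<alpha> z a u"
    and hermitian: "z \<in> \<Omega> \<Longrightarrow> hermitian_form (h z)"
    and \<alpha>_adjoint: "z \<in> \<Omega> \<Longrightarrow> h z (\<alpha> z a u) v = h z u (\<alpha> z a v)"
    and cov_adjoint: "z \<in> \<Omega> \<Longrightarrow>
        h z (dir_deriv (\<lambda>z. \<alpha> z b u) z a + \<Gamma> z a (\<alpha> z b u) - \<alpha> z b (\<Gamma> z a u)) v =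
        h z u (dir_deriv (\<lambda>z. \<alpha> z b v) z a + \<Gamma> z a (\<alpha> z b v) - \<alpha> z b (\<Gamma> z a v))"
    and flat: "z \<in> \<Omega> \<Longrightarrow>
        dir_deriv (\<lambda>z. \<Gamma> z b u + \<alpha> z b u) z a + (\<Gamma> z a (\<Gamma> z b u + \<alpha> z b u) + \<alpha> z a (\<Gamma> z b u + \<alpha> z b u)) =
        dir_deriv (\<lambda>z. \<Gamma> z a u + \<alpha> z a u) z b + (\<Gamma> z b (\<Gamma> z a u + \<alpha> z a u) + \<alpha> z b (\<Gamma> z a u + \<alpha> z a u))"
    and harmonic: "z \<in> \<Omega> \<Longrightarrow>
        dbar_higgs (\<Gamma> z) (\<alpha> z) (dir_deriv (\<lambda>z. dbar_higgs (\<Gamma> z) (\<alpha> z) (\<lambda>_. 0) u b) z) (dbar_higgs (\<Gamma> z) (\<alpha> z) (\<lambda>_. 0) u b) a =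
        dbar_higgs (\<Gamma> z) (\<alpha> z) (dir_deriv (\<lambda>z. dbar_higgs (\<Gamma> z) (\<alpha> z) (\<lambda>_. 0) u a) z) (dbar_higgs (\<Gamma> z) (\<alpha> z) (\<lambda>_. 0) u a) b"
begin

text \<open>By \<open>harmonic_curvature_identities\<close> the coefficients of the powers of \<open>\<lambda>\<close> in the curvature of
  \<open>\<nabla> + \<lambda>\<^sup>-\<^sup>1 \<theta> + \<lambda> \<theta>*\<close> vanish, so that \<open>birkhoff_potential\<close> applies; here
  \<open>\<theta> a = (\<alpha> a - \<i> \<alpha> (\<i> a)) / 2\<close> and \<open>\<theta>* a = (\<alpha> a + \<i> \<alpha> (\<i> a)) / 2\<close>.\<close>
theorem higgs_potential:
  assumes p: "p \<in> \<Omega>"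
  obtains r and F g :: "complex ^ 'n \<Rightarrow> complex ^ 'r \<Rightarrow> complex ^ 'r" where "r > 0" "ball p r \<subseteq> \<Omega>"
    "\<And>z. z \<in> ball p r \<Longrightarrow> linear (g z) \<and> bij (g z)"
    "\<And>z c u. z \<in> ball p r \<Longrightarrow> g z (c *s u) = c *s g z u"
    "\<And>z u. z \<in> ball p r \<Longrightarrow> ((\<lambda>z. F z u) has_derivative (\<lambda>a. inv (g z) (higgs_part (\<alpha> z) a (g z u)))) (at z)"
proof -
  note blin = \<Gamma>_scale \<alpha>_scale \<Gamma>_add \<alpha>_add
  have lin\<Gamma>: "linear (\<Gamma> z a)" and lin\<alpha>: "linear (\<alpha> z a)" if "z \<in> \<Omega>" for z a
    using blin[OF that] by (auto intro!: linearI simp flip: vector_scale_of_real)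
  obtain G G' where dG: "\<And>z. z \<in> \<Omega> \<Longrightarrow> (G has_derivative blinfun_apply (G' z)) (at z)" "continuous_on \<Omega> G'"
    and G: "\<And>z a u. z \<in> \<Omega> \<Longrightarrow> blinfun_apply (blinfun_apply (G z) a) u = \<Gamma> z a u"
    and G': "\<And>z v a u. z \<in> \<Omega> \<Longrightarrow> G' z v a u = frechet_derivative (\<lambda>z. \<Gamma> z a u) (at z) v"
    using bilinear_family_as_blinfun[OF open_dom C1_\<Gamma> lin\<Gamma> \<Gamma>_real_linear] by blast
  obtain A A' where dA: "\<And>z. z \<in> \<Omega> \<Longrightarrow> (A has_derivative blinfun_apply (A' z)) (at z)" "continuous_on \<Omega> A'"
    and A: "\<And>z a u. z \<in> \<Omega> \<Longrightarrow> blinfun_apply (blinfun_apply (A z) a) u = \<alpha> z a u"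
    and A': "\<And>z v a u. z \<in> \<Omega> \<Longrightarrow> A' z v a u = frechet_derivative (\<lambda>z. \<alpha> z a u) (at z) v"
    using bilinear_family_as_blinfun[OF open_dom C1_\<alpha> lin\<alpha> \<alpha>_real_linear] by blast
  have D\<Gamma>: "((\<lambda>z. \<Gamma> z a u) has_derivative (\<lambda>v. G' z v a u)) (at z)" if "z \<in> \<Omega>" for z a u
    using C1_on_derivative[OF C1_\<Gamma> that] by (simp add: G'[OF that])
  have D\<alpha>: "((\<lambda>z. \<alpha> z a u) has_derivative (\<lambda>v. A' z v a u)) (at z)" if "z \<in> \<Omega>" for z a u
    using C1_on_derivative[OF C1_\<alpha> that] by (simp add: A'[OF that])
  define R where "R z a b u = G' z a b u - G' z b a u + \<Gamma> z a (\<Gamma> z b u) - \<Gamma> z b (\<Gamma> z a u)" for z a b u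
  define C where "C z a b u = A' z a b u + \<Gamma> z a (\<alpha> z b u) - \<alpha> z b (\<Gamma> z a u)" for z a b u
  define K where "K z a b u = \<alpha> z a (\<alpha> z b u) - \<alpha> z b (\<alpha> z a u)" for z a b u
  have ix: "\<i> * (\<i> * x) = - x" for x :: complex by simp
  have ii: "\<i> *s (\<i> *s a) = - a" for a :: "complex ^ 'm" by (simp add: vec_eq_iff)
  have identities: "C z a b u = C z b a u" "C z (\<i> *s a) b u = C z a (\<i> *s b) u"
    "K z (\<i> *s a) (\<i> *s b) u = K z a b u" "K z a (\<i> *s b) u = - K z (\<i> *s a) b u" "R z a b u + K z a b u = 0"
    if z: "z \<in> \<Omega>" for z a b u
  proof -
    have neg: "\<Gamma> z (- a) u = - \<Gamma> z a u" "\<alpha> z (- a) u = - \<alpha> z a u" "\<Gamma> z a (- u) = - \<Gamma> z a u" "\<alpha> z a (- u) = - \<alpha> z a u" for a u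
      using linear_neg \<Gamma>_real_linear[OF z] \<alpha>_real_linear[OF z] lin\<Gamma>[OF z] lin\<alpha>[OF z] by blast+
    have diff: "\<Gamma> z a (u - v) = \<Gamma> z a u - \<Gamma> z a v" "\<alpha> z a (u - v) = \<alpha> z a u - \<alpha> z a v" for a u v
      using linear_diff lin\<Gamma>[OF z] lin\<alpha>[OF z] by blast+
    have Rn: "R z (- a) b u = - R z a b u" "R z a (- b) u = - R z a b u" for a b u
      by (simp_all add: R_def neg blinfun.bilinear_simps)
    have Cn: "C z (- a) b u = - C z a b u" "C z a (- b) u = - C z a b u" for a b u
      by (simp_all add: C_def neg blinfun.bilinear_simps)
    have Kn: "K z (- a) b u = - K z a b u" "K z a (- b) u = - K z a b u" for a b u
      by (simp_all add: K_def neg)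
    have Cadj: "h z (C z a b u) v = h z u (C z a b v)" for a b u v
      using cov_adjoint[OF z] by (simp add: C_def A'[OF z] dir_deriv_def)
    have Kadj: "h z (K z a b u) v = - h z u (K z a b v)" for a b u v
      by (simp add: K_def hermitian_formD[OF hermitian[OF z]] \<alpha>_adjoint[OF z])
    have F: "R z a b u + C z a b u - C z b a u + K z a b u = 0" for a b u
    proof -
      have "dir_deriv (\<lambda>z. \<Gamma> z b u + \<alpha> z b u) z a = G' z a b u + A' z a b u" for a b
        by (rule fun_cong[OF dir_deriv_eq, OF has_derivative_add[OF D\<Gamma>[OF z] D\<alpha>[OF z]]])
      with flat[OF z, of b u a] show ?thesis
        by (simp add: R_def C_def K_def blin[OF z] algebra_simps)
    qed
    define m' where "m' a b u = (1/2) *s (G' z a b u + \<i> *s G' z a (\<i> *s b) u) + (1/2) *s (A' z a b u + (-\<i>) *s A' z a (\<i> *s b) u)" for a b u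
    have Q: "(R z a b u + \<i> *s R z (\<i> *s a) b u + \<i> *s R z a (\<i> *s b) u - R z (\<i> *s a) (\<i> *s b) u)
       + (C z a b u - \<i> *s C z a (\<i> *s b) u + \<i> *s C z (\<i> *s a) b u + C z (\<i> *s a) (\<i> *s b) u)
       - (C z b a u - \<i> *s C z b (\<i> *s a) u + \<i> *s C z (\<i> *s b) a u + C z (\<i> *s b) (\<i> *s a) u)
       + (K z a b u - \<i> *s K z a (\<i> *s b) u - \<i> *s K z (\<i> *s a) b u - K z (\<i> *s a) (\<i> *s b) u) = 0" for a b u
    proof -
      define m where "m z b = (1/2) *s (\<Gamma> z b u + \<i> *s \<Gamma> z (\<i> *s b) u) + (1/2) *s (\<alpha> z b u + (-\<i>) *s \<alpha> z (\<i> *s b) u)" for z b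
      have m: "dbar_higgs (\<Gamma> z) (\<alpha> z) (\<lambda>_. 0) u b = m z b" for z b
        by (simp add: dbar_higgs_def higgs_part_def m_def vec_eq_iff)
      have Dm: "dir_deriv (\<lambda>z. m z b) z = (\<lambda>a. m' a b u)" for b
        unfolding m_def m'_def
        by (rule dir_deriv_eq, intro has_derivative_add bounded_linear.has_derivative[OF bounded_linear_vector_scale_right] D\<Gamma> D\<alpha> z)
      have "dbar_higgs (\<Gamma> z) (\<alpha> z) (\<lambda>a. m' a b u) (m z b) a = dbar_higgs (\<Gamma> z) (\<alpha> z) (\<lambda>b. m' b a u) (m z a) b"
        using harmonic[OF z, of u b a] unfolding m Dm .
      hence 4: "4 * dbar_higgs (\<Gamma> z) (\<alpha> z) (\<lambda>a. m' a b u) (m z b) a $ k = 4 * dbar_higgs (\<Gamma> z) (\<alpha> z) (\<lambda>b. m' b a u) (m z a) b $ k" for k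
        by simp
      show ?thesis
        unfolding vec_eq_iff
        using 4
        by (simp add: dbar_higgs_def higgs_part_def m_def m'_def R_def C_def K_def blin[OF z] diff neg algebra_simps ix)
    qed
    show "C z a b u = C z b a u" "C z (\<i> *s a) b u = C z a (\<i> *s b) u"
      "K z (\<i> *s a) (\<i> *s b) u = K z a b u" "K z a (\<i> *s b) u = - K z (\<i> *s a) b u" "R z a b u + K z a b u = 0"
      by (rule harmonic_curvature_identities[OF hermitian[OF z], where R = "R z" and C = "C z" and K = "K z"];
          fact Rn Cn Kn Cadj Kadj F Q)+
  qed

  define T where "T \<sigma> z a u = (1/2) *s (\<alpha> z a u + \<sigma> *s \<alpha> z (\<i> *s a) u)" for \<sigma> z a u
  have T_hp: "T (- \<i>) z a u = higgs_part (\<alpha> z) a u" for z a u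
    by (simp add: T_def higgs_part_def vec_eq_iff)
  \<comment> \<open>\<open>\<theta>\<close> and \<open>\<theta>*\<close> are the members \<open>\<sigma> = - \<i>\<close> and \<open>\<sigma> = \<i>\<close> of one family.\<close>
  have family: "\<exists>M M'. (\<forall>z\<in>\<Omega>. (M has_derivative blinfun_apply (M' z)) (at z)) \<and> continuous_on \<Omega> M' \<and>
      (\<forall>z\<in>\<Omega>. \<forall>a u. blinfun_apply (blinfun_apply (M z) a) u = T \<sigma> z a u) \<and>
      (\<forall>z\<in>\<Omega>. \<forall>v a u. blinfun_apply (blinfun_apply (blinfun_apply (M' z) v) a) u = (1/2) *s (A' z v a u + \<sigma> *s A' z v (\<i> *s a) u))" for \<sigma>
  proof -
    have C1T: "C1_on (\<lambda>z. T \<sigma> z a u) \<Omega>" for a u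
      unfolding T_def by (intro C1_on_bounded_linear[OF bounded_linear_vector_scale_right] C1_on_add C1_\<alpha>)
    have linTu: "linear (T \<sigma> z a)" if "z \<in> \<Omega>" for z a
      using that by (auto intro!: linearI simp: T_def blin simp flip: vector_scale_of_real; simp add: vec_eq_iff algebra_simps)+
    have linTa: "linear (\<lambda>a. T \<sigma> z a u)" if z: "z \<in> \<Omega>" for z u
    proof -
      have i: "linear (\<lambda>a. \<alpha> z (\<i> *s a) u)"
        using linear_compose[OF bounded_linear.linear[OF bounded_linear_vector_scale_right] \<alpha>_real_linear[OF z]] by (simp add: o_def)
      show ?thesis
        unfolding T_def
        by (intro linear_compose[OF _ bounded_linear.linear[OF bounded_linear_vector_scale_right], unfolded o_def]
             linear_compose_add \<alpha>_real_linear[OF z] i)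
    qed
    have DT: "((\<lambda>z. T \<sigma> z a u) has_derivative (\<lambda>v. (1/2) *s (A' z v a u + \<sigma> *s A' z v (\<i> *s a) u))) (at z)"
      if "z \<in> \<Omega>" for z a u
      unfolding T_def
      by (intro bounded_linear.has_derivative[OF bounded_linear_vector_scale_right] has_derivative_add D\<alpha> that)
    obtain M M' where "\<And>z. z \<in> \<Omega> \<Longrightarrow> (M has_derivative blinfun_apply (M' z)) (at z)" "continuous_on \<Omega> M'"
      "\<And>z a u. z \<in> \<Omega> \<Longrightarrow> blinfun_apply (blinfun_apply (M z) a) u = T \<sigma> z a u"
      "\<And>z v a u. z \<in> \<Omega> \<Longrightarrow> M' z v a u = frechet_derivative (\<lambda>z. T \<sigma> z a u) (at z) v"
      using bilinear_family_as_blinfun[OF open_dom C1T linTu linTa] by blast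
    moreover have "frechet_derivative (\<lambda>z. T \<sigma> z a u) (at z) v = (1/2) *s (A' z v a u + \<sigma> *s A' z v (\<i> *s a) u)" if "z \<in> \<Omega>" for z v a u
      by (rule fun_cong[OF dir_deriv_eq[unfolded dir_deriv_def], OF DT[OF that]])
    ultimately show ?thesis by (intro exI[of _ M] exI[of _ M']) simp
  qed
  obtain M M' where dM: "\<And>\<sigma> z. z \<in> \<Omega> \<Longrightarrow> (M \<sigma> has_derivative blinfun_apply (M' \<sigma> z)) (at z)" "\<And>\<sigma>. continuous_on \<Omega> (M' \<sigma>)"
    and M: "\<And>\<sigma> z a u. z \<in> \<Omega> \<Longrightarrow> blinfun_apply (blinfun_apply (M \<sigma> z) a) u = T \<sigma> z a u"
    and M': "\<And>\<sigma> z v a u. z \<in> \<Omega> \<Longrightarrow> blinfun_apply (blinfun_apply (blinfun_apply (M' \<sigma> z) v) a) u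
                = (1/2) *s (A' z v a u + \<sigma> *s A' z v (\<i> *s a) u)"
    using family by metis
  note defs = blinfun.bilinear_simps T_def
  have atoms: "C z v w u $ k = C z w v u $ k" "C z v (\<i> *s w) u $ k = C z w (\<i> *s v) u $ k"
      "K z (\<i> *s v) (\<i> *s w) u $ k = K z v w u $ k" "K z v (\<i> *s w) u $ k = - (K z (\<i> *s v) w u $ k)" "R z v w u $ k + K z v w u $ k = 0"
    if z: "z \<in> \<Omega>" for z v w u k
    using identities[OF z] by (metis, metis, metis, metis vector_uminus_component, metis vector_add_component zero_index)
  have commute: "(M \<sigma> z v o\<^sub>L M \<sigma> z w) = (M \<sigma> z w o\<^sub>L M \<sigma> z v)" if z: "z \<in> \<Omega>" and \<sigma>: "\<sigma> * \<sigma> = -1" for \<sigma> z v w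
  proof (rule blinfun_eqI)
    fix u
    have \<sigma>2: "\<sigma> * (\<sigma> * x) = - x" for x using \<sigma> by (simp add: mult.assoc[symmetric])
    have "4 * ((M \<sigma> z v o\<^sub>L M \<sigma> z w) u $ k) - 4 * ((M \<sigma> z w o\<^sub>L M \<sigma> z v) u $ k)
        = (K z v w u $ k - K z (\<i> *s v) (\<i> *s w) u $ k) + \<sigma> * (K z (\<i> *s v) w u $ k + K z v (\<i> *s w) u $ k)" for k
      by (simp add: defs M[OF z] G[OF z] M'[OF z] blin[OF z] K_def algebra_simps \<sigma>2)
    thus "(M \<sigma> z v o\<^sub>L M \<sigma> z w) u = (M \<sigma> z w o\<^sub>L M \<sigma> z v) u" by (simp add: vec_eq_iff atoms(3)[OF z] atoms(4)[OF z, of v w])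
  qed
  have closed: "M' \<sigma> z v w + (G z v o\<^sub>L M \<sigma> z w) + (M \<sigma> z v o\<^sub>L G z w) = M' \<sigma> z w v + (G z w o\<^sub>L M \<sigma> z v) + (M \<sigma> z w o\<^sub>L G z v)"
    if z: "z \<in> \<Omega>" for \<sigma> z v w
  proof (rule blinfun_eqI)
    fix u
    have "2 * ((M' \<sigma> z v w + (G z v o\<^sub>L M \<sigma> z w) + (M \<sigma> z v o\<^sub>L G z w)) u $ k) - 2 * ((M' \<sigma> z w v + (G z w o\<^sub>L M \<sigma> z v) + (M \<sigma> z w o\<^sub>L G z v)) u $ k)
        = (C z v w u $ k - C z w v u $ k) + \<sigma> * (C z v (\<i> *s w) u $ k - C z w (\<i> *s v) u $ k)" for k
      by (simp add: defs M[OF z] G[OF z] M'[OF z] blin[OF z] C_def algebra_simps)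
    thus "(M' \<sigma> z v w + (G z v o\<^sub>L M \<sigma> z w) + (M \<sigma> z v o\<^sub>L G z w)) u = (M' \<sigma> z w v + (G z w o\<^sub>L M \<sigma> z v) + (M \<sigma> z w o\<^sub>L G z v)) u"
      using atoms(1,2)[OF z, of v w u] by (simp add: vec_eq_iff)
  qed
  define B B' S S' where "B = M (- \<i>)" and "B' = M' (- \<i>)" and "S = M \<i>" and "S' = M' \<i>"
  have curvature: "G' z v w + (G z v o\<^sub>L G z w) + (B z v o\<^sub>L S z w) + (S z v o\<^sub>L B z w)
      = G' z w v + (G z w o\<^sub>L G z v) + (B z w o\<^sub>L S z v) + (S z w o\<^sub>L B z v)" if z: "z \<in> \<Omega>" for z v w
  proof (rule blinfun_eqI)
    fix u
    have "2 * ((G' z v w + (G z v o\<^sub>L G z w) + (B z v o\<^sub>L S z w) + (S z v o\<^sub>L B z w)) u $ k)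
        - 2 * ((G' z w v + (G z w o\<^sub>L G z v) + (B z w o\<^sub>L S z v) + (S z w o\<^sub>L B z v)) u $ k)
        = 2 * R z v w u $ k + K z v w u $ k + K z (\<i> *s v) (\<i> *s w) u $ k" for k
      by (simp add: B_def S_def defs M[OF z] G[OF z] M'[OF z] blin[OF z] R_def K_def algebra_simps ix)
    also have "\<dots> k = 2 * (R z v w u $ k + K z v w u $ k)" for k by (simp add: atoms(3)[OF z])
    finally show "(G' z v w + (G z v o\<^sub>L G z w) + (B z v o\<^sub>L S z w) + (S z v o\<^sub>L B z w)) u
       = (G' z w v + (G z w o\<^sub>L G z v) + (B z w o\<^sub>L S z v) + (S z w o\<^sub>L B z v)) u"
      by (simp add: vec_eq_iff atoms(5)[OF z])
  qed
  have dB: "\<And>z. z \<in> \<Omega> \<Longrightarrow> (B has_derivative blinfun_apply (B' z)) (at z)" "continuous_on \<Omega> B'"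
    and dS: "\<And>z. z \<in> \<Omega> \<Longrightarrow> (S has_derivative blinfun_apply (S' z)) (at z)" "continuous_on \<Omega> S'"
    using dM by (simp_all add: B_def B'_def S_def S'_def)
  have eqs: "(S z v o\<^sub>L S z w) = (S z w o\<^sub>L S z v)"
    "S' z v w + (G z v o\<^sub>L S z w) + (S z v o\<^sub>L G z w) = S' z w v + (G z w o\<^sub>L S z v) + (S z w o\<^sub>L G z v)"
    "B' z v w + (G z v o\<^sub>L B z w) + (B z v o\<^sub>L G z w) = B' z w v + (G z w o\<^sub>L B z v) + (B z w o\<^sub>L G z v)"
    "(B z v o\<^sub>L B z w) = (B z w o\<^sub>L B z v)"
    if z: "z \<in> \<Omega>" for z v w
    unfolding B_def B'_def S_def S'_def using commute[OF z] closed[OF z] by simp_all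
  show thesis
  proof (rule birkhoff_potential[where N = G and N' = G' and Th = B and Th' = B' and Ts = S and Ts' = S', OF open_dom p dG dB dS eqs(1,2) curvature eqs(3,4)])
    fix r and F g :: "complex ^ 'n \<Rightarrow> complex ^ 'r \<Rightarrow> complex ^ 'r"
    assume r: "r > 0" "ball p r \<subseteq> \<Omega>"
    and g: "\<And>x. x \<in> ball p r \<Longrightarrow> linear (g x) \<and> bij (g x)"
    and gJ: "\<And>x J y. x \<in> ball p r \<Longrightarrow> (\<And>x w. x \<in> \<Omega> \<Longrightarrow> (J o\<^sub>L G x w) = (G x w o\<^sub>L J) \<and> (J o\<^sub>L B x w) = (B x w o\<^sub>L J)
         \<and> (J o\<^sub>L S x w) = (S x w o\<^sub>L J)) \<Longrightarrow> g x (blinfun_apply J y) = J (g x y)"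
    and dF: "\<And>x y. x \<in> ball p r \<Longrightarrow> ((\<lambda>x. F x y) has_derivative (\<lambda>h. inv (g x) (B x h (g x y)))) (at x)"
    show thesis
    proof (rule that[OF r g])
      fix z c u assume z: "z \<in> ball p r"
      hence zO: "z \<in> \<Omega>" using r by blast
      let ?J = "Blinfun (\<lambda>u :: complex ^ 'r. c *s u)"
      have J: "blinfun_apply ?J u = c *s u" for u
        by (simp add: bounded_linear_Blinfun_apply bounded_linear_vector_scale_right)
      have "g z (?J u) = ?J (g z u)"
        by (rule gJ[OF z])
           (auto intro!: blinfun_eqI simp: J G B_def S_def M T_def blin; simp add: vec_eq_iff algebra_simps)
      thus "g z (c *s u) = c *s g z u" by (simp add: J)
      show "((\<lambda>z. F z u) has_derivative (\<lambda>a. inv (g z) (higgs_part (\<alpha> z) a (g z u)))) (at z)"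
        using dF[OF z, of u] by (simp add: B_def M[OF zO] T_hp)
    qed
  qed
qed

end

section \<open>Smooth functions\<close>

lemma Ck_on_mono: "Ck_on k f S \<Longrightarrow> T \<subseteq> S \<Longrightarrow> Ck_on k f T"
proof (induction k arbitrary: f)
  case (Suc k)
  then show ?case by (simp, metis subsetD)
qed (auto intro: continuous_on_subset)

lemma Ck_on_imp_continuous: "Ck_on k f S \<Longrightarrow> continuous_on S f"
  by (cases k) (auto intro!: continuous_at_imp_continuous_on intro: has_derivative_continuous)

lemma Ck_on_SucD: "Ck_on (Suc k) f S \<Longrightarrow> Ck_on k f S"
proof (induction k arbitrary: f)
  case 0
  show ?case using Ck_on_imp_continuous[OF 0] by simp
next
  case (Suc k)
  from Suc.prems obtain f' where "\<forall>x\<in>S. (f has_derivative f' x) (at x)" "\<forall>v. Ck_on (Suc k) (\<lambda>x. f' x v) S"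
    by (auto simp del: Ck_on.simps simp: Ck_on.simps(2)[of "Suc k"])
  with Suc.IH show ?case unfolding Ck_on.simps(2) by blast
qed

lemma Ck_on_cong:
  assumes "open S" "\<And>x. x \<in> S \<Longrightarrow> f x = g x" "Ck_on k f S"
  shows "Ck_on k g S"
proof (cases k)
  case 0
  with assms show ?thesis by (simp cong: continuous_on_cong_simp)
next
  case (Suc m)
  with assms(3) obtain f' where f': "\<And>x. x \<in> S \<Longrightarrow> (f has_derivative f' x) (at x)" "\<forall>v. Ck_on m (\<lambda>x. f' x v) S"
    by auto
  have "(g has_derivative f' x) (at x)" if "x \<in> S" for x
    using has_derivative_transform_within_open[OF f'(1)[OF that] assms(1) that assms(2)] .
  with f'(2) Suc show ?thesis by auto
qed

lemma Ck_on_const: "Ck_on k (\<lambda>x. c) S"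
proof (induction k arbitrary: c)
  case (Suc k)
  show ?case unfolding Ck_on.simps(2) by (rule exI[of _ "\<lambda>_ _. 0"]) (simp add: Suc)
qed simp

lemma Ck_on_bounded_linear:
  assumes "bounded_linear L" "Ck_on k f S"
  shows "Ck_on k (\<lambda>x. L (f x)) S"
  using assms(2)
proof (induction k arbitrary: f)
  case 0
  thus ?case using bounded_linear.continuous_on[OF assms(1)] by simp
next
  case (Suc k)
  then obtain f' where "\<forall>x\<in>S. (f has_derivative f' x) (at x)" "\<forall>v. Ck_on k (\<lambda>x. f' x v) S" by auto
  thus ?case unfolding Ck_on.simps(2)
    by (intro exI[of _ "\<lambda>x v. L (f' x v)"]) (auto intro: bounded_linear.has_derivative[OF assms(1)] Suc.IH)
qed

lemma Ck_on_add:
  assumes "Ck_on k f S" "Ck_on k g S"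
  shows "Ck_on k (\<lambda>x. f x + g x) S"
  using assms
proof (induction k arbitrary: f g)
  case 0
  thus ?case by (simp add: continuous_on_add)
next
  case (Suc k)
  then obtain f' g' where "\<forall>x\<in>S. (f has_derivative f' x) (at x)" "\<forall>v. Ck_on k (\<lambda>x. f' x v) S"
    "\<forall>x\<in>S. (g has_derivative g' x) (at x)" "\<forall>v. Ck_on k (\<lambda>x. g' x v) S" by auto
  thus ?case unfolding Ck_on.simps(2)
    by (intro exI[of _ "\<lambda>x v. f' x v + g' x v"]) (auto intro: has_derivative_add Suc.IH)
qed

lemma Ck_on_sum: "(\<And>i. i \<in> I \<Longrightarrow> Ck_on k (f i) S) \<Longrightarrow> Ck_on k (\<lambda>x. \<Sum>i\<in>I. f i x) S"
  by (induction I rule: infinite_finite_induct) (auto intro: Ck_on_const Ck_on_add)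

lemma Ck_on_bilinear:
  assumes B: "bounded_bilinear B" and "Ck_on k f S" "Ck_on k g S"
  shows "Ck_on k (\<lambda>x. B (f x) (g x)) S"
  using assms(2,3)
proof (induction k arbitrary: f g)
  case 0
  thus ?case by (simp add: bounded_bilinear.continuous_on[OF B])
next
  case (Suc k)
  then obtain f' g' where f': "\<forall>x\<in>S. (f has_derivative f' x) (at x)" "\<forall>v. Ck_on k (\<lambda>x. f' x v) S"
    and g': "\<forall>x\<in>S. (g has_derivative g' x) (at x)" "\<forall>v. Ck_on k (\<lambda>x. g' x v) S" by auto
  have "Ck_on k f S" "Ck_on k g S" using Suc.prems Ck_on_SucD by blast+
  with f' g' show ?case unfolding Ck_on.simps(2)
    by (intro exI[of _ "\<lambda>x v. B (f x) (g' x v) + B (f' x v) (g x)"] conjI ballI allI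
          bounded_bilinear.FDERIV[OF B] Ck_on_add) (auto intro!: Suc.IH)
qed

lemma smooth_on_imp_C1_on:
  assumes "smooth_on f S"
  shows "C1_on f S"
proof -
  have "Ck_on (Suc 0) f S" using assms by (simp add: smooth_on_def)
  then obtain f' where f': "\<And>x. x \<in> S \<Longrightarrow> (f has_derivative f' x) (at x)" "\<And>v. continuous_on S (\<lambda>x. f' x v)"
    by auto
  have ap: "blinfun_apply (Blinfun (f' x)) = f' x" if "x \<in> S" for x
    by (intro bounded_linear_Blinfun_apply has_derivative_bounded_linear[OF f'(1)[OF that]])
  have "continuous_on S (\<lambda>x. Blinfun (f' x))"
    by (rule continuous_on_blinfun_componentwise, rule continuous_on_eq[OF f'(2)]) (simp add: ap)
  thus ?thesis unfolding C1_on_def by (intro exI[of _ "\<lambda>x. Blinfun (f' x)"]) (simp add: ap f'(1))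
qed

lemma bounded_bilinear_vector_scale: "bounded_bilinear (\<lambda>c (v :: complex ^ 'n). c *s v)"
proof
  show "\<exists>K. \<forall>a (b :: complex ^ 'n). norm (a *s b) \<le> norm a * norm b * K"
    by (rule exI[of _ 1]) (simp add: norm_vector_scale_complex)
qed (auto simp: vec_eq_iff algebra_simps)

lemma has_derivative_vec_complex:
  fixes f :: "'v::real_normed_vector \<Rightarrow> complex ^ 'm"
  assumes "\<And>i. ((\<lambda>z. f z $ i) has_derivative D i) (at z)"
  shows "(f has_derivative (\<lambda>v. \<chi> i. D i v)) (at z)"
proof -
  have "((\<lambda>z. \<Sum>i\<in>UNIV. (f z $ i) *s axis i (1::complex)) has_derivative (\<lambda>v. \<Sum>i\<in>UNIV. D i v *s axis i 1)) (at z)"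
    by (intro has_derivative_sum bounded_linear.has_derivative[OF bounded_linear_vector_scale] assms)
  moreover have "(\<Sum>i\<in>UNIV. D i v *s axis i 1) = (\<chi> i. D i v)" for v
    using basis_expansion[of "\<chi> i. D i v"] by simp
  ultimately show ?thesis by (simp add: basis_expansion)
qed

section \<open>Charts and tangent vectors\<close>

locale manifold =
  fixes A :: "('x::{t2_space, second_countable_topology}, 'n::finite) chart set"
  assumes complex_manifold: "complex_manifold A"
begin

lemma open_chart: "c \<in> A \<Longrightarrow> open (fst c)"
  and chart_homeo: "c \<in> A \<Longrightarrow> homeomorphism (fst c) (snd c ` fst c) (snd c) (chart_inv c)"
  and chart_cover: "\<exists>c\<in>A. x \<in> fst c"
  and open_chart_image: "c \<in> A \<Longrightarrow> open (snd c ` fst c)"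
  using complex_manifold unfolding complex_manifold_def by blast+

lemma chart_inv_left [simp]: "c \<in> A \<Longrightarrow> x \<in> fst c \<Longrightarrow> chart_inv c (snd c x) = x"
  using chart_homeo homeomorphism_apply1 by metis

lemma open_chart_image_Int: "c \<in> A \<Longrightarrow> open U \<Longrightarrow> open (snd c ` (fst c \<inter> U))"
proof -
  assume c: "c \<in> A" and U: "open U"
  have "openin (top_of_set (fst c)) (fst c \<inter> U)" using U by blast
  hence "openin (top_of_set (snd c ` fst c)) (snd c ` (fst c \<inter> U))"
    using homeomorphism_imp_open_map[OF chart_homeo[OF c]] by blast
  thus ?thesis using open_chart_image[OF c] openin_open_trans by blast
qed

lemma smooth_fun_cong:
  assumes "open U" "\<And>x. x \<in> U \<Longrightarrow> f x = g x" "smooth_fun A U f"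
  shows "smooth_fun A U g"
  unfolding smooth_fun_def smooth_on_def
proof (intro ballI allI)
  fix c k assume c: "c \<in> A"
  show "Ck_on k (g \<circ> chart_inv c) (snd c ` (fst c \<inter> U))"
    by (rule Ck_on_cong[OF open_chart_image_Int[OF c assms(1)], of "f \<circ> chart_inv c"])
       (use assms c in \<open>auto simp: smooth_fun_def smooth_on_def\<close>)
qed

lemma smooth_fun_mono: "smooth_fun A U f \<Longrightarrow> V \<subseteq> U \<Longrightarrow> smooth_fun A V f"
  unfolding smooth_fun_def smooth_on_def by (meson Ck_on_mono Int_mono image_mono subset_refl)

lemma smooth_fun_bounded_linear: "bounded_linear L \<Longrightarrow> smooth_fun A U f \<Longrightarrow> smooth_fun A U (\<lambda>x. L (f x))"
  unfolding smooth_fun_def smooth_on_def o_def by (intro ballI allI, rule Ck_on_bounded_linear[where L = L]) blast+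

lemma smooth_fun_add: "smooth_fun A U f \<Longrightarrow> smooth_fun A U g \<Longrightarrow> smooth_fun A U (\<lambda>x. f x + g x)"
  unfolding smooth_fun_def smooth_on_def o_def by (intro ballI allI, rule Ck_on_add) blast+

lemma smooth_fun_sum: "(\<And>i. i \<in> I \<Longrightarrow> smooth_fun A U (f i)) \<Longrightarrow> smooth_fun A U (\<lambda>x. \<Sum>i\<in>I. f i x)"
  unfolding smooth_fun_def smooth_on_def o_def by (intro ballI allI, rule Ck_on_sum) blast+

lemma smooth_fun_const: "smooth_fun A U (\<lambda>x. k)"
  unfolding smooth_fun_def smooth_on_def o_def by (intro ballI allI, rule Ck_on_const)

lemma smooth_fun_scale:
  fixes g :: "'x \<Rightarrow> complex ^ 'm"
  shows "smooth_fun A U f \<Longrightarrow> smooth_fun A U g \<Longrightarrow> smooth_fun A U (\<lambda>x. f x *s g x)"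
  unfolding smooth_fun_def smooth_on_def o_def by (intro ballI allI, rule Ck_on_bilinear[OF bounded_bilinear_vector_scale]) blast+

lemma smooth_fun_chart_derivative:
  assumes "smooth_fun A U f" "c \<in> A" "x \<in> U \<inter> fst c"
  shows "((f \<circ> chart_inv c) has_derivative frechet_derivative (f \<circ> chart_inv c) (at (snd c x))) (at (snd c x))"
  using assms by (intro C1_on_derivative[of _ "snd c ` (fst c \<inter> U)"] smooth_on_imp_C1_on) (auto simp: smooth_fun_def)

abbreviation transition_deriv :: "('x, 'n) chart \<Rightarrow> ('x, 'n) chart \<Rightarrow> 'x \<Rightarrow> complex ^ 'n \<Rightarrow> complex ^ 'n" where
  "transition_deriv c c' x \<equiv> frechet_derivative (snd c' \<circ> chart_inv c) (at (snd c x))"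

lemma transition_derivative:
  assumes "c \<in> A" "c' \<in> A" "x \<in> fst c \<inter> fst c'"
  shows "((snd c' \<circ> chart_inv c) has_derivative transition_deriv c c' x) (at (snd c x))"
    and "transition_deriv c c' x (k *s a) = k *s transition_deriv c c' x a"
proof -
  have "\<exists>D. ((\<lambda>z. snd c' (chart_inv c z) $ i) has_derivative D) (at (snd c x)) \<and> (\<forall>k v. D (k *s v) = k * D v)" for i
    using complex_manifold assms unfolding complex_manifold_def holo_on_def by blast
  then obtain D where D: "\<And>i. ((\<lambda>z. (snd c' \<circ> chart_inv c) z $ i) has_derivative D i) (at (snd c x))"
    "\<And>i k v. D i (k *s v) = k * D i v" unfolding o_def by metis
  have *: "((snd c' \<circ> chart_inv c) has_derivative (\<lambda>v. \<chi> i. D i v)) (at (snd c x))"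
    by (rule has_derivative_vec_complex[OF D(1)])
  hence eq: "transition_deriv c c' x = (\<lambda>v. \<chi> i. D i v)" using frechet_derivative_at by metis
  show "((snd c' \<circ> chart_inv c) has_derivative transition_deriv c c' x) (at (snd c x))" using * eq by simp
  show "transition_deriv c c' x (k *s a) = k *s transition_deriv c c' x a" by (simp add: eq vec_eq_iff D(2))
qed

lemma transition_linear:
  assumes "c \<in> A" "c' \<in> A" "x \<in> fst c \<inter> fst c'"
  shows "linear (transition_deriv c c' x)"
  using transition_derivative(1)[OF assms] has_derivative_linear by blast

lemma chart_change_derivative:
  fixes f :: "'x \<Rightarrow> 'b::real_normed_vector"
  assumes c: "c \<in> A" "c' \<in> A" "x \<in> fst c \<inter> fst c'"
    and f: "((f \<circ> chart_inv c') has_derivative D) (at (snd c' x))"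
  shows "((f \<circ> chart_inv c) has_derivative (\<lambda>a. D (transition_deriv c c' x a))) (at (snd c x))"
proof -
  have "((f \<circ> chart_inv c') has_derivative D) (at ((snd c' \<circ> chart_inv c) (snd c x)))"
    using f c by simp
  from has_derivative_compose[OF transition_derivative(1)[OF c] this]
  have "((\<lambda>z. (f \<circ> chart_inv c') ((snd c' \<circ> chart_inv c) z)) has_derivative (\<lambda>a. D (transition_deriv c c' x a))) (at (snd c x))" .
  thus ?thesis
    by (rule has_derivative_transform_within_open[OF _ open_chart_image_Int[OF c(1) open_chart[OF c(2)]]]) (use c in auto)
qed

lemma transition_chain:
  assumes "c \<in> A" "c' \<in> A" "c'' \<in> A" "x \<in> fst c \<inter> fst c' \<inter> fst c''"
  shows "transition_deriv c c'' x a = transition_deriv c' c'' x (transition_deriv c c' x a)"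
proof -
  have "((snd c'' \<circ> chart_inv c) has_derivative (\<lambda>a. transition_deriv c' c'' x (transition_deriv c c' x a))) (at (snd c x))"
    by (rule chart_change_derivative[OF _ _ _ transition_derivative(1)]) (use assms in auto)
  thus ?thesis using frechet_derivative_at by metis
qed

lemma fst_coord_vec [simp]: "fst (coord_vec A c a x) = x"
  by (simp add: coord_vec_def)

lemma coord_vec_in_tangent_bundle:
  assumes c: "c \<in> A" "x \<in> fst c"
  shows "coord_vec A c a x \<in> tangent_bundle A"
  unfolding tangent_bundle_def coord_vec_def mem_Collect_eq case_prod_conv
proof (intro conjI ballI impI allI)
  fix c1 c2 assume "c1 \<in> A" "c2 \<in> A" "x \<in> fst c1 \<inter> fst c2"
  thus "(if c2 \<in> A \<and> x \<in> fst c2 then transition_deriv c c2 x a else 0) =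
     transition_deriv c1 c2 x (if c1 \<in> A \<and> x \<in> fst c1 then transition_deriv c c1 x a else 0)"
    using transition_chain[of c c1 c2 x a] c by simp
qed (rule if_not_P)

lemma tangent_vector_eq_coord_vec:
  assumes v: "v \<in> tangent_bundle A" "c \<in> A" "fst v \<in> fst c"
  shows "v = coord_vec A c (snd v c) (fst v)"
proof -
  have "snd v c' = (if c' \<in> A \<and> fst v \<in> fst c' then transition_deriv c c' (fst v) (snd v c) else 0)" for c'
    using v unfolding tangent_bundle_def case_prod_unfold mem_Collect_eq by (metis IntI)
  thus ?thesis unfolding coord_vec_def by (simp add: prod_eq_iff fun_eq_iff)
qed

lemma tadd_coord_vec:
  assumes "c \<in> A" "x \<in> fst c"
  shows "tadd (coord_vec A c a x) (coord_vec A c b x) = coord_vec A c (a + b) x"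
  unfolding tadd_def coord_vec_def fst_conv snd_conv
proof (rule arg_cong[where f = "Pair x"], rule ext)
  fix c'
  have "transition_deriv c c' x a + transition_deriv c c' x b = transition_deriv c c' x (a + b)"
    if "c' \<in> A" "x \<in> fst c'"
    by (rule linear_add[OF transition_linear, symmetric]) (use that assms in simp_all)
  thus "(if c' \<in> A \<and> x \<in> fst c' then transition_deriv c c' x a else 0) +
      (if c' \<in> A \<and> x \<in> fst c' then transition_deriv c c' x b else 0) =
      (if c' \<in> A \<and> x \<in> fst c' then transition_deriv c c' x (a + b) else 0)"
    by simp
qed

lemma tscale_coord_vec:
  assumes "c \<in> A" "x \<in> fst c"
  shows "tscale k (coord_vec A c a x) = coord_vec A c (k *s a) x"
  unfolding tscale_def coord_vec_def fst_conv snd_conv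
proof (rule arg_cong[where f = "Pair x"], rule ext)
  fix c'
  have "k *s transition_deriv c c' x a = transition_deriv c c' x (k *s a)"
    if "c' \<in> A" "x \<in> fst c'"
    by (rule transition_derivative(2)[symmetric]) (use that assms in simp_all)
  thus "k *s (if c' \<in> A \<and> x \<in> fst c' then transition_deriv c c' x a else 0) =
      (if c' \<in> A \<and> x \<in> fst c' then transition_deriv c c' x (k *s a) else 0)"
    by simp
qed

text \<open>Independence of the differential of the chart that its definition chooses.\<close>
lemma mdiff_coord_vec:
  fixes f :: "'x \<Rightarrow> 'b::real_normed_vector"
  assumes c: "c \<in> A" "x \<in> fst c" and f: "\<And>c'. c' \<in> A \<Longrightarrow> x \<in> fst c' \<Longrightarrow> (f \<circ> chart_inv c') differentiable (at (snd c' x))"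
  shows "mdiff A f (coord_vec A c a x) = frechet_derivative (f \<circ> chart_inv c) (at (snd c x)) a"
proof -
  define c' where "c' = (SOME c. c \<in> A \<and> x \<in> fst c)"
  have c': "c' \<in> A" "x \<in> fst c'" using someI[of "\<lambda>c. c \<in> A \<and> x \<in> fst c" c] c by (auto simp: c'_def)
  have "((f \<circ> chart_inv c) has_derivative (\<lambda>a. frechet_derivative (f \<circ> chart_inv c') (at (snd c' x)) (transition_deriv c c' x a))) (at (snd c x))"
    by (rule chart_change_derivative[OF _ _ _ frechet_derivative_works[THEN iffD1, OF f[OF c']]]) (use c c' in auto)
  hence "frechet_derivative (f \<circ> chart_inv c) (at (snd c x)) = (\<lambda>a. frechet_derivative (f \<circ> chart_inv c') (at (snd c' x)) (transition_deriv c c' x a))"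
    using frechet_derivative_at by metis
  thus ?thesis
    using c' by (simp add: mdiff_def c'_def[symmetric]) (simp add: coord_vec_def)
qed

lemma mdiff_smooth:
  assumes "smooth_fun A U f" "c \<in> A" "x \<in> U \<inter> fst c"
  shows "mdiff A f (coord_vec A c a x) = frechet_derivative (f \<circ> chart_inv c) (at (snd c x)) a"
proof (rule mdiff_coord_vec)
  fix c' assume "c' \<in> A" "x \<in> fst c'"
  thus "(f \<circ> chart_inv c') differentiable (at (snd c' x))"
    using smooth_fun_chart_derivative[OF assms(1), of c' x] assms(3) by (auto intro: differentiableI)
qed (use assms in simp_all)

end

section \<open>A bundle in a local frame\<close>

lemma dir_deriv_cong:
  assumes "open S" "z \<in> S" "\<And>y. y \<in> S \<Longrightarrow> f y = g y"
  shows "dir_deriv f z = dir_deriv g z"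
proof -
  have "(f has_derivative D) (at z) \<longleftrightarrow> (g has_derivative D) (at z)" for D
    using assms has_derivative_transform_within_open[OF _ assms(1,2), of f D UNIV g]
      has_derivative_transform_within_open[OF _ assms(1,2), of g D UNIV f] by auto
  thus ?thesis unfolding dir_deriv_def frechet_derivative_def by simp
qed

locale bundle_chart = manifold A
  for A :: "('x::{t2_space, second_countable_topology}, 'n::finite) chart set" +
  fixes E :: "('x, 'e, 'r::finite) vbundle" and U :: "'x set" and \<tau> :: "'e \<Rightarrow> complex ^ 'r" and c :: "('x, 'n) chart"
  assumes vector_bundle: "smooth_vector_bundle A E" and triv: "(U, \<tau>) \<in> trivs E" and chart: "c \<in> A"
begin

lemma trivialisation:
  assumes "(V, \<sigma>) \<in> trivs E"
  shows "open V"
    and "x \<in> V \<Longrightarrow> bij_betw \<sigma> (fibre E x) UNIV"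
    and "x \<in> V \<Longrightarrow> vzero E x \<in> fibre E x \<and> \<sigma> (vzero E x) = 0"
    and "x \<in> V \<Longrightarrow> e \<in> fibre E x \<Longrightarrow> e' \<in> fibre E x \<Longrightarrow> vadd E e e' \<in> fibre E x \<and> \<sigma> (vadd E e e') = \<sigma> e + \<sigma> e'"
    and "x \<in> V \<Longrightarrow> e \<in> fibre E x \<Longrightarrow> vscale E k e \<in> fibre E x \<and> \<sigma> (vscale E k e) = k *s \<sigma> e"
  using vector_bundle assms unfolding smooth_vector_bundle_def by blast+

definition const_section :: "complex ^ 'r \<Rightarrow> 'x \<Rightarrow> 'e" where
  "const_section u x = inv_into (fibre E x) \<tau> u"

abbreviation \<Omega> :: "(complex ^ 'n) set" where "\<Omega> \<equiv> snd c ` (fst c \<inter> U)"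
abbreviation pt :: "complex ^ 'n \<Rightarrow> 'x" where "pt \<equiv> chart_inv c"
abbreviation cv :: "complex ^ 'n \<Rightarrow> 'x \<Rightarrow> ('x, 'n) tvec" where "cv \<equiv> coord_vec A c"

lemma open_U: "open U" using trivialisation(1)[OF triv] .

lemma open_W: "open (U \<inter> fst c)" using open_U open_chart[OF chart] by blast

lemma open_\<Omega>: "open \<Omega>" using open_chart_image_Int[OF chart open_U] .

lemma pt_in: "z \<in> \<Omega> \<Longrightarrow> pt z \<in> U" "z \<in> \<Omega> \<Longrightarrow> pt z \<in> fst c" "z \<in> \<Omega> \<Longrightarrow> snd c (pt z) = z"
  using chart by auto

lemma const_section_fibre: "x \<in> U \<Longrightarrow> const_section u x \<in> fibre E x"
  and triv_const_section [simp]: "x \<in> U \<Longrightarrow> \<tau> (const_section u x) = u"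
  and const_section_triv: "x \<in> U \<Longrightarrow> e \<in> fibre E x \<Longrightarrow> const_section (\<tau> e) x = e"
  using trivialisation(2)[OF triv, of x] unfolding const_section_def bij_betw_def
  by (auto simp: inv_into_into f_inv_into_f inv_into_f_f)

lemma triv_inj: "x \<in> U \<Longrightarrow> e \<in> fibre E x \<Longrightarrow> e' \<in> fibre E x \<Longrightarrow> \<tau> e = \<tau> e' \<Longrightarrow> e = e'"
  using const_section_triv by metis

lemmas triv_add = trivialisation(4)[OF triv]
lemmas triv_scale = trivialisation(5)[OF triv]

lemma const_section_add: "x \<in> U \<Longrightarrow> const_section (u + v) x = vadd E (const_section u x) (const_section v x)"
  by (rule triv_inj) (auto simp: const_section_fibre triv_add)

lemma const_section_scale: "x \<in> U \<Longrightarrow> const_section (k *s u) x = vscale E k (const_section u x)"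
  by (rule triv_inj) (auto simp: const_section_fibre triv_scale)

lemma other_triv_expansion:
  assumes V: "(V, \<sigma>) \<in> trivs E" and x: "x \<in> U \<inter> V" and e: "e \<in> fibre E x"
  shows "\<sigma> e = (\<Sum>k\<in>UNIV. \<tau> e $ k *s \<sigma> (const_section (axis k 1) x))"
proof -
  have xU: "x \<in> U" and xV: "x \<in> V" using x by auto
  have add: "\<sigma> (const_section (u + v) x) = \<sigma> (const_section u x) + \<sigma> (const_section v x)" for u v
    using trivialisation(4)[OF V xV] by (simp add: const_section_add[OF xU] const_section_fibre[OF xU])
  have scale: "\<sigma> (const_section (k *s u) x) = k *s \<sigma> (const_section u x)" for k u
    using trivialisation(5)[OF V xV] by (simp add: const_section_scale[OF xU] const_section_fibre[OF xU])
  have zero: "\<sigma> (const_section 0 x) = 0" using scale[of 0 0] by simp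
  have "\<sigma> (const_section (\<Sum>k\<in>K. u $ k *s axis k 1) x) = (\<Sum>k\<in>K. u $ k *s \<sigma> (const_section (axis k 1) x))" for K u
    by (induction K rule: infinite_finite_induct) (auto simp: zero add scale)
  from this[of "\<tau> e" UNIV] show ?thesis
    by (simp add: basis_expansion const_section_triv[OF xU e])
qed

text \<open>Smoothness of a section is required in every trivialisation; as transition functions are smooth and
  linear in the fibre, a single trivialisation suffices.\<close>
lemma smooth_sectionI:
  assumes W: "open W" "W \<subseteq> U" and t: "\<And>x. x \<in> W \<Longrightarrow> t x \<in> fibre E x" and sm: "smooth_fun A W (\<lambda>x. \<tau> (t x))"
  shows "smooth_section A E W t"
  unfolding smooth_section_def
proof (intro conjI ballI)
  fix p assume p: "p \<in> trivs E"
  obtain V \<sigma> where V: "p = (V, \<sigma>)" by (cases p)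
  hence V': "(V, \<sigma>) \<in> trivs E" using p by simp
  have tr: "smooth_fun A (U \<inter> V) (\<lambda>x. \<sigma> (const_section b x))" for b
  proof -
    have "\<forall>(U, \<tau>)\<in>trivs E. \<forall>(V, \<sigma>)\<in>trivs E. \<forall>b. smooth_fun A (U \<inter> V) (\<lambda>x. \<sigma> (inv_into (fibre E x) \<tau> b))"
      using vector_bundle unfolding smooth_vector_bundle_def by (elim conjE)
    from bspec[OF bspec[OF this triv, unfolded case_prod_conv] V', unfolded case_prod_conv]
    show ?thesis unfolding const_section_def by (rule spec)
  qed
  have "smooth_fun A (W \<inter> V) (\<lambda>x. \<Sum>k\<in>UNIV. \<tau> (t x) $ k *s \<sigma> (const_section (axis k 1) x))"
    by (intro smooth_fun_sum smooth_fun_scale smooth_fun_bounded_linear[OF bounded_linear_vec_nth]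
         smooth_fun_mono[OF sm] smooth_fun_mono[OF tr]) (use W in auto)
  hence "smooth_fun A (W \<inter> V) (\<sigma> \<circ> t)"
    by (rule smooth_fun_cong[rotated 2])
       (use W trivialisation(1)[OF V'] t other_triv_expansion[OF V'] in \<open>auto simp: subset_iff\<close>)
  thus "case p of (V, \<tau>) \<Rightarrow> smooth_fun A (W \<inter> V) (\<tau> \<circ> t)" using V by simp
qed (use assms in auto)

lemma smooth_section_coords:
  assumes "smooth_section A E W t" "W \<subseteq> U"
  shows "smooth_fun A W (\<lambda>x. \<tau> (t x))" "open W" "\<And>x. x \<in> W \<Longrightarrow> t x \<in> fibre E x"
proof -
  have "smooth_fun A (W \<inter> U) (\<tau> \<circ> t)" using assms(1) triv unfolding smooth_section_def by blast
  thus "smooth_fun A W (\<lambda>x. \<tau> (t x))" using assms(2) by (simp add: Int_absorb2 o_def)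
qed (use assms in \<open>auto simp: smooth_section_def\<close>)

lemma smooth_const_section: "open W \<Longrightarrow> W \<subseteq> U \<Longrightarrow> smooth_section A E W (const_section u)"
  by (rule smooth_sectionI, assumption, assumption, use const_section_fibre in blast,
      rule smooth_fun_cong[OF _ _ smooth_fun_const[of W u]]) (auto simp: subset_iff)

lemma bundle_one_form_fibre:
  assumes "bundle_one_form A E W \<eta>" "v \<in> tangent_bundle A" "fst v \<in> W"
  shows "\<eta> v \<in> fibre E (fst v)"
  using assms unfolding bundle_one_form_def by blast

lemma bundle_one_form_section:
  assumes "bundle_one_form A E W \<eta>"
  shows "smooth_section A E (W \<inter> fst c) (\<lambda>x. \<eta> (cv a x))"
  using assms chart unfolding bundle_one_form_def by blast

lemma bundle_one_form_linear:
  assumes \<eta>: "bundle_one_form A E W \<eta>" and x: "x \<in> W" "x \<in> U" "x \<in> fst c"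
  shows "linear (\<lambda>a. \<tau> (\<eta> (cv a x)))"
proof (rule linearI)
  note tb = coord_vec_in_tangent_bundle[OF chart x(3)]
  have *: "\<eta> (tadd (cv a x) (cv b x)) = vadd E (\<eta> (cv a x)) (\<eta> (cv b x))"
     "\<eta> (tscale (complex_of_real k) (cv a x)) = vscale E (complex_of_real k) (\<eta> (cv a x))" for a b k
    using \<eta> tb[of a] tb[of b] x(1) unfolding bundle_one_form_def by auto
  have f: "\<eta> (cv a x) \<in> fibre E x" for a using bundle_one_form_fibre[OF \<eta> tb] x(1) by simp
  show "\<tau> (\<eta> (cv (a + b) x)) = \<tau> (\<eta> (cv a x)) + \<tau> (\<eta> (cv b x))" for a b
    using *(1)[of a b] by (simp add: tadd_coord_vec[OF chart x(3)] triv_add[OF x(2) f f])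
  fix k :: real and a
  show "\<tau> (\<eta> (cv (k *\<^sub>R a) x)) = k *\<^sub>R \<tau> (\<eta> (cv a x))"
    using *(2)[of k a] by (simp add: tscale_coord_vec[OF chart x(3)] triv_scale[OF x(2) f] vector_scale_of_real)
qed

definition conn_form :: "(('x \<Rightarrow> 'e) \<Rightarrow> ('x, 'n) tvec \<Rightarrow> 'e) \<Rightarrow> complex ^ 'n \<Rightarrow> complex ^ 'n \<Rightarrow> complex ^ 'r \<Rightarrow> complex ^ 'r" where
  "conn_form N z a u = \<tau> (N (const_section u) (cv a (pt z)))"

definition endo_form :: "(('x, 'n) tvec \<Rightarrow> 'e \<Rightarrow> 'e) \<Rightarrow> complex ^ 'n \<Rightarrow> complex ^ 'n \<Rightarrow> complex ^ 'r \<Rightarrow> complex ^ 'r" where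
  "endo_form \<alpha> z a u = \<tau> (\<alpha> (cv a (pt z)) (const_section u (pt z)))"

lemma connectionD:
  assumes "connection A E N"
  shows "smooth_section A E W s \<Longrightarrow> bundle_one_form A E W (N s)"
    and "smooth_section A E W s \<Longrightarrow> (\<And>x. x \<in> W \<Longrightarrow> t x = s x) \<Longrightarrow> v \<in> tangent_bundle A \<Longrightarrow> fst v \<in> W \<Longrightarrow> N t v = N s v"
    and "smooth_section A E W s \<Longrightarrow> smooth_section A E W t \<Longrightarrow> v \<in> tangent_bundle A \<Longrightarrow> fst v \<in> W \<Longrightarrow>
       N (\<lambda>x. vadd E (s x) (t x)) v = vadd E (N s v) (N t v)"
    and "smooth_section A E W s \<Longrightarrow> smooth_fun A W f \<Longrightarrow> v \<in> tangent_bundle A \<Longrightarrow> fst v \<in> W \<Longrightarrow>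
       N (\<lambda>x. vscale E (f x) (s x)) v = vadd E (vscale E (mdiff A f v) (s (fst v))) (vscale E (f (fst v)) (N s v))"
proof -
  note D = assms[unfolded connection_def]
  show "smooth_section A E W s \<Longrightarrow> bundle_one_form A E W (N s)"
    using D[THEN conjunct1] by blast
  show "smooth_section A E W s \<Longrightarrow> (\<And>x. x \<in> W \<Longrightarrow> t x = s x) \<Longrightarrow> v \<in> tangent_bundle A \<Longrightarrow> fst v \<in> W \<Longrightarrow> N t v = N s v"
    using D[THEN conjunct2, THEN conjunct1, rule_format, of W s t v] by blast
  show "smooth_section A E W s \<Longrightarrow> smooth_section A E W t \<Longrightarrow> v \<in> tangent_bundle A \<Longrightarrow> fst v \<in> W \<Longrightarrow>
       N (\<lambda>x. vadd E (s x) (t x)) v = vadd E (N s v) (N t v)"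
    using D[THEN conjunct2, THEN conjunct2, THEN conjunct1, rule_format, of W s t v] by blast
  show "smooth_section A E W s \<Longrightarrow> smooth_fun A W f \<Longrightarrow> v \<in> tangent_bundle A \<Longrightarrow> fst v \<in> W \<Longrightarrow>
       N (\<lambda>x. vscale E (f x) (s x)) v = vadd E (vscale E (mdiff A f v) (s (fst v))) (vscale E (f (fst v)) (N s v))"
    using D[THEN conjunct2, THEN conjunct2, THEN conjunct2, rule_format, of W s f v] by blast
qed

text \<open>By additivity and the Leibniz rule a connection is determined by its values on the frame; the
  combination of frame sections is built up one summand at a time.\<close>
lemma connection_partial_sum:
  assumes N: "connection A E N" and f: "\<And>k. smooth_fun A W (f k)" and W: "open W" "W \<subseteq> U"
    and v: "v \<in> tangent_bundle A" "fst v \<in> W"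
  shows "finite K \<Longrightarrow> \<tau> (N (\<lambda>x. const_section (\<Sum>k\<in>K. f k x *s axis k 1) x) v) =
     (\<Sum>k\<in>K. mdiff A (f k) v *s axis k 1 + f k (fst v) *s \<tau> (N (const_section (axis k 1)) v))"
proof (induction K rule: finite_induct)
  have vU: "fst v \<in> U" using v W by blast
  have Nfib: "N s v \<in> fibre E (fst v)" if "smooth_section A E W s" for s
    using bundle_one_form_fibre[OF connectionD(1)[OF N that] v] .
  have Nscale: "\<tau> (N (\<lambda>x. vscale E (g x) (const_section u x)) v) = mdiff A g v *s u + g (fst v) *s \<tau> (N (const_section u) v)"
    if g: "smooth_fun A W g" for g u
    unfolding connectionD(4)[OF N smooth_const_section[OF W] g v]
    using triv_add[OF vU] triv_scale[OF vU] Nfib[OF smooth_const_section[OF W]] const_section_fibre[OF vU] by (simp add: vU)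
  {
    case empty
    have zero: "vscale E 0 (const_section 0 x) = const_section 0 x" if "x \<in> U" for x
      using const_section_scale[OF that, of 0 0] by simp
    have "N (const_section 0) v = N (\<lambda>x. vscale E ((\<lambda>_. 0) x) (const_section 0 x)) v"
      by (rule connectionD(2)[OF N smooth_const_section[OF W] _ v, symmetric]) (use W zero in \<open>auto simp: subset_iff\<close>)
    thus ?case using Nscale[OF smooth_fun_const[of W 0], of 0] by simp
  next
    case (insert k K)
    define s where "s x = vscale E (f k x) (const_section (axis k 1) x)" for x
    define t where "t x = const_section (\<Sum>k\<in>K. f k x *s axis k 1) x" for x
    have \<tau>s: "\<tau> (s x) = f k x *s axis k 1" "s x \<in> fibre E x" if "x \<in> W" for x
      using that W triv_scale[of x] const_section_fibre[of x] by (auto simp: s_def)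
    have sum: "smooth_fun A W (\<lambda>x. \<Sum>k\<in>K. f k x *s axis k 1)" for K :: "'r set"
      by (intro smooth_fun_sum smooth_fun_scale smooth_fun_const f)
    have ss: "smooth_section A E W s"
      by (rule smooth_sectionI[OF W \<tau>s(2)], assumption, rule smooth_fun_cong[OF W(1) _ smooth_fun_scale[OF f smooth_fun_const]])
         (use \<tau>s(1) in auto)
    have st: "smooth_section A E W (\<lambda>x. const_section (\<Sum>k\<in>K. f k x *s axis k 1) x)" for K
      by (rule smooth_sectionI[OF W], use W const_section_fibre in blast, rule smooth_fun_cong[OF W(1) _ sum[of K]])
         (use W in \<open>auto simp: subset_iff\<close>)
    have "N (\<lambda>x. const_section (\<Sum>k\<in>insert k K. f k x *s axis k 1) x) v = N (\<lambda>x. vadd E (s x) (t x)) v"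
    proof (rule connectionD(2)[OF N st _ v, symmetric])
      fix x assume "x \<in> W"
      hence "x \<in> U" using W by blast
      thus "vadd E (s x) (t x) = const_section (\<Sum>k\<in>insert k K. f k x *s axis k 1) x"
        using insert.hyps by (simp add: s_def t_def const_section_add const_section_scale)
    qed
    also have "\<dots> = vadd E (N s v) (N t v)"
      unfolding t_def[abs_def] by (rule connectionD(3)[OF N ss st v])
    finally have "\<tau> (N (\<lambda>x. const_section (\<Sum>k\<in>insert k K. f k x *s axis k 1) x) v) = \<tau> (N s v) + \<tau> (N t v)"
      using triv_add[OF vU Nfib[OF ss] Nfib[OF st]] by (simp add: t_def[abs_def])
    thus ?case using insert Nscale[OF f[of k], of "axis k 1"] by (simp add: s_def[abs_def] t_def[abs_def])
  }
qed

lemma connection_coords_aux: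
  assumes N: "connection A E N" and t: "smooth_section A E W t" and W: "W \<subseteq> U" and x: "x \<in> W" "x \<in> fst c"
  shows "\<tau> (N t (cv a x)) = dir_deriv (\<lambda>z. \<tau> (t (pt z))) (snd c x) a
       + (\<Sum>k\<in>UNIV. \<tau> (t x) $ k *s conn_form N (snd c x) a (axis k 1))"
proof -
  note tb = coord_vec_in_tangent_bundle[OF chart x(2)]
  note tc = smooth_section_coords[OF t W]
  have xU: "x \<in> U" using x W by blast
  have fx: "fst (cv a x) \<in> W" using x by simp
  have f: "smooth_fun A W (\<lambda>x. \<tau> (t x) $ k)" for k
    by (rule smooth_fun_bounded_linear[OF bounded_linear_vec_nth tc(1)])
  have Dt: "((\<lambda>z. \<tau> (t (pt z))) has_derivative dir_deriv (\<lambda>z. \<tau> (t (pt z))) (snd c x)) (at (snd c x))"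
    using smooth_fun_chart_derivative[OF tc(1) chart, of x] x by (simp add: dir_deriv_def[abs_def] o_def)
  have md: "mdiff A (\<lambda>x. \<tau> (t x) $ k) (cv a x) = dir_deriv (\<lambda>z. \<tau> (t (pt z))) (snd c x) a $ k" for k
  proof -
    have "mdiff A (\<lambda>x. \<tau> (t x) $ k) (cv a x) = dir_deriv (\<lambda>z. \<tau> (t (pt z)) $ k) (snd c x) a"
      using mdiff_smooth[OF f[of k] chart, of x a] x by (simp add: dir_deriv_def o_def)
    also have "\<dots> = dir_deriv (\<lambda>z. \<tau> (t (pt z))) (snd c x) a $ k"
      by (rule fun_cong[OF dir_deriv_eq]) (rule bounded_linear.has_derivative[OF bounded_linear_vec_nth Dt])
    finally show ?thesis .
  qed
  have "N t (cv a x) = N (\<lambda>x. const_section (\<Sum>k\<in>UNIV. \<tau> (t x) $ k *s axis k 1) x) (cv a x)"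
    by (rule connectionD(2)[OF N t _ tb fx, symmetric])
       (use W tc(3) const_section_triv in \<open>auto simp: basis_expansion subset_iff\<close>)
  hence "\<tau> (N t (cv a x)) = (\<Sum>k\<in>UNIV. mdiff A (\<lambda>x. \<tau> (t x) $ k) (cv a x) *s axis k 1 
      + \<tau> (t x) $ k *s \<tau> (N (const_section (axis k 1)) (cv a x)))"
    using connection_partial_sum[OF N f tc(2) W tb fx finite_class.finite_UNIV] by simp
  thus ?thesis using x chart
    by (simp add: sum.distrib md basis_expansion conn_form_def)
qed

lemma conn_form_expansion:
  assumes N: "connection A E N" and z: "z \<in> \<Omega>"
  shows "conn_form N z a u = (\<Sum>k\<in>UNIV. u $ k *s conn_form N z a (axis k 1))"
proof -
  have "dir_deriv (\<lambda>z. \<tau> (const_section u (pt z))) z = dir_deriv (\<lambda>_. u) z"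
    by (rule dir_deriv_cong[OF open_\<Omega> z]) (simp add: pt_in(1))
  also have "\<dots> = (\<lambda>_. 0)" by (rule dir_deriv_eq) simp
  finally show ?thesis
    using connection_coords_aux[OF N smooth_const_section[OF open_U subset_refl, of u] subset_refl pt_in(1,2)[OF z], of a]
    by (simp add: pt_in[OF z] conn_form_def)
qed

lemma connection_coords:
  assumes N: "connection A E N" and t: "smooth_section A E W t" and W: "W \<subseteq> U" and x: "x \<in> W" "x \<in> fst c"
  shows "\<tau> (N t (cv a x)) = dir_deriv (\<lambda>z. \<tau> (t (pt z))) (snd c x) a + conn_form N (snd c x) a (\<tau> (t x))"
proof -
  have "snd c x \<in> \<Omega>" using x W by blast
  from conn_form_expansion[OF N this, of a "\<tau> (t x)"] show ?thesis
    by (simp add: connection_coords_aux[OF assms])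
qed

lemma conn_form_complex_linear:
  assumes N: "connection A E N" and z: "z \<in> \<Omega>"
  shows "conn_form N z a (u + v) = conn_form N z a u + conn_form N z a v"
    and "conn_form N z a (k *s u) = k *s conn_form N z a u"
  using conn_form_expansion[OF N z, of a u] conn_form_expansion[OF N z, of a v]
    conn_form_expansion[OF N z, of a "u + v"] conn_form_expansion[OF N z, of a "k *s u"]
  by (simp_all add: sum.distrib vec.scale_sum_right vec_eq_iff algebra_simps sum_distrib_left)

lemma smooth_section_C1:
  assumes "smooth_section A E (U \<inter> fst c) t"
  shows "C1_on (\<lambda>z. \<tau> (t (pt z))) \<Omega>"
proof -
  have "smooth_fun A (U \<inter> fst c) (\<lambda>x. \<tau> (t x))" by (rule smooth_section_coords[OF assms]) simp
  hence "smooth_on ((\<lambda>x. \<tau> (t x)) \<circ> pt) (snd c ` (fst c \<inter> (U \<inter> fst c)))"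
    using chart unfolding smooth_fun_def by blast
  moreover have "fst c \<inter> (U \<inter> fst c) = fst c \<inter> U" by blast
  ultimately show ?thesis using smooth_on_imp_C1_on by (simp add: o_def)
qed

lemma conn_form_C1:
  assumes N: "connection A E N"
  shows "C1_on (\<lambda>z. conn_form N z a u) \<Omega>"
  unfolding conn_form_def
  by (rule smooth_section_C1[OF bundle_one_form_section[OF connectionD(1)[OF N smooth_const_section[OF open_U subset_refl]]]])

lemma conn_form_real_linear:
  assumes N: "connection A E N" and z: "z \<in> \<Omega>"
  shows "linear (\<lambda>a. conn_form N z a u)"
  unfolding conn_form_def
  by (rule bundle_one_form_linear[OF connectionD(1)[OF N smooth_const_section[OF open_U subset_refl]]])
     (use pt_in[OF z] in auto)

lemma connection_section:
  assumes "connection A E N"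
  shows "smooth_section A E (U \<inter> fst c) (\<lambda>y. N (const_section u) (cv a y))"
  by (rule bundle_one_form_section[OF connectionD(1)[OF assms smooth_const_section[OF open_U subset_refl]]])

lemma endo_one_formD:
  assumes "endo_one_form A E \<alpha>" "v \<in> tangent_bundle A" "e \<in> fibre E (fst v)"
  shows "\<alpha> v e \<in> fibre E (fst v)" "\<alpha> v (vscale E k e) = vscale E k (\<alpha> v e)"
    "e' \<in> fibre E (fst v) \<Longrightarrow> \<alpha> v (vadd E e e') = vadd E (\<alpha> v e) (\<alpha> v e')"
  using assms(1)[unfolded endo_one_form_def, THEN conjunct1, rule_format, OF assms(2,3)] assms(3) by blast+

lemma endo_one_form_section:
  assumes "endo_one_form A E \<alpha>" "smooth_section A E W s"
  shows "bundle_one_form A E W (\<lambda>v. \<alpha> v (s (fst v)))"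
  using assms(1)[unfolded endo_one_form_def, THEN conjunct2] assms(2) by blast

lemma endo_form_section:
  assumes "endo_one_form A E \<alpha>"
  shows "smooth_section A E (U \<inter> fst c) (\<lambda>y. \<alpha> (cv a y) (const_section u y))"
  using bundle_one_form_section[OF endo_one_form_section[OF assms smooth_const_section[OF open_U subset_refl, of u]], of a]
  by simp

lemma endo_coords:
  assumes "x \<in> U" "x \<in> fst c" "e \<in> fibre E x"
  shows "\<tau> (\<alpha> (cv a x) e) = endo_form \<alpha> (snd c x) a (\<tau> e)"
  using assms chart by (simp add: endo_form_def const_section_triv)

lemma endo_form_complex_linear:
  assumes \<alpha>: "endo_one_form A E \<alpha>" and z: "z \<in> \<Omega>"
  shows "endo_form \<alpha> z a (u + v) = endo_form \<alpha> z a u + endo_form \<alpha> z a v"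
    and "endo_form \<alpha> z a (k *s u) = k *s endo_form \<alpha> z a u"
proof -
  note x = pt_in[OF z]
  note tb = coord_vec_in_tangent_bundle[OF chart x(2), of a]
  have f: "const_section u (pt z) \<in> fibre E (fst (cv a (pt z)))" for u using const_section_fibre[OF x(1)] by simp
  have af: "\<alpha> (cv a (pt z)) (const_section u (pt z)) \<in> fibre E (pt z)" for u
    using endo_one_formD(1)[OF \<alpha> tb f] by simp
  show "endo_form \<alpha> z a (u + v) = endo_form \<alpha> z a u + endo_form \<alpha> z a v"
    "endo_form \<alpha> z a (k *s u) = k *s endo_form \<alpha> z a u"
    by (simp_all add: endo_form_def const_section_add[OF x(1)] const_section_scale[OF x(1)]
        endo_one_formD(2)[OF \<alpha> tb f] endo_one_formD(3)[OF \<alpha> tb f f] triv_add[OF x(1) af af] triv_scale[OF x(1) af])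
qed

lemma endo_form_real_linear:
  assumes \<alpha>: "endo_one_form A E \<alpha>" and z: "z \<in> \<Omega>"
  shows "linear (\<lambda>a. endo_form \<alpha> z a u)"
  using bundle_one_form_linear[OF endo_one_form_section[OF \<alpha> smooth_const_section[OF open_U subset_refl, of u]] _ pt_in(1,2)[OF z]]
    pt_in(1)[OF z] by (simp add: endo_form_def)

lemma endo_form_C1:
  assumes \<alpha>: "endo_one_form A E \<alpha>"
  shows "C1_on (\<lambda>z. endo_form \<alpha> z a u) \<Omega>"
  unfolding endo_form_def by (rule smooth_section_C1[OF endo_form_section[OF \<alpha>]])

lemma form10_coords:
  assumes \<alpha>: "endo_one_form A E \<alpha>" and x: "x \<in> U" "x \<in> fst c" and e: "e \<in> fibre E x"
  shows "form10 E \<alpha> (cv a x) e \<in> fibre E x"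
    and "\<tau> (form10 E \<alpha> (cv a x) e) = higgs_part (endo_form \<alpha> (snd c x)) a (\<tau> e)"
proof -
  have f: "\<alpha> (cv b x) e \<in> fibre E x" for b
    using endo_one_formD(1)[OF \<alpha> coord_vec_in_tangent_bundle[OF chart x(2)], of e b] e by simp
  have v: "vscale E k e' \<in> fibre E x" "\<tau> (vscale E k e') = k *s \<tau> e'" if "e' \<in> fibre E x" for k e'
    using triv_scale[OF x(1) that] by blast+
  have w: "vadd E e1 e2 \<in> fibre E x" "\<tau> (vadd E e1 e2) = \<tau> e1 + \<tau> e2" if "e1 \<in> fibre E x" "e2 \<in> fibre E x" for e1 e2
    using triv_add[OF x(1) that] by blast+
  show "form10 E \<alpha> (cv a x) e \<in> fibre E x"
    by (simp add: form10_def part10_def v w f tscale_coord_vec[OF chart x(2)])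
  show "\<tau> (form10 E \<alpha> (cv a x) e) = higgs_part (endo_form \<alpha> (snd c x)) a (\<tau> e)"
    by (simp add: form10_def part10_def v w f tscale_coord_vec[OF chart x(2)] higgs_part_def endo_coords[OF x e])
qed

abbreviation "frame_dbar N \<alpha> z \<equiv> dbar_higgs (conn_form N z) (endo_form \<alpha> z)"

lemma dbar_plus_theta_coords:
  assumes N: "connection A E N" and \<alpha>: "endo_one_form A E \<alpha>" and t: "smooth_section A E W t" and W: "W \<subseteq> U"
    and x: "x \<in> W" "x \<in> fst c"
  shows "dbar_plus_theta E N \<alpha> t (cv a x) \<in> fibre E x"
    and "\<tau> (dbar_plus_theta E N \<alpha> t (cv a x)) =
      frame_dbar N \<alpha> (snd c x) (dir_deriv (\<lambda>z. \<tau> (t (pt z))) (snd c x)) (\<tau> (t x)) a"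
proof -
  have xU: "x \<in> U" using x W by blast
  have f: "N t (cv b x) \<in> fibre E x" for b
    using bundle_one_form_fibre[OF connectionD(1)[OF N t] coord_vec_in_tangent_bundle[OF chart x(2), of b]] x(1) by simp
  have tx: "t x \<in> fibre E x" using smooth_section_coords(3)[OF t W x(1)] .
  have v: "vscale E k e' \<in> fibre E x" "\<tau> (vscale E k e') = k *s \<tau> e'" if "e' \<in> fibre E x" for k e'
    using triv_scale[OF xU that] by blast+
  have w: "vadd E e1 e2 \<in> fibre E x" "\<tau> (vadd E e1 e2) = \<tau> e1 + \<tau> e2" if "e1 \<in> fibre E x" "e2 \<in> fibre E x" for e1 e2
    using triv_add[OF xU that] by blast+
  note F = form10_coords[OF \<alpha> xU x(2) tx]
  show "dbar_plus_theta E N \<alpha> t (cv a x) \<in> fibre E x"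
    by (simp add: dbar_plus_theta_def part01_def v w f F tscale_coord_vec[OF chart x(2)])
  show "\<tau> (dbar_plus_theta E N \<alpha> t (cv a x)) =
      frame_dbar N \<alpha> (snd c x) (dir_deriv (\<lambda>z. \<tau> (t (pt z))) (snd c x)) (\<tau> (t x)) a"
    by (simp add: dbar_plus_theta_def part01_def v w f F tscale_coord_vec[OF chart x(2)] dbar_higgs_def
        connection_coords[OF N t W x])
qed

lemma dir_deriv_const_section:
  assumes z: "z \<in> \<Omega>"
  shows "dir_deriv (\<lambda>z. \<tau> (const_section u (pt z))) z = (\<lambda>_. 0)"
proof -
  have "dir_deriv (\<lambda>z. \<tau> (const_section u (pt z))) z = dir_deriv (\<lambda>_. u) z"
    by (rule dir_deriv_cong[OF open_\<Omega> z]) (simp add: pt_in(1))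
  also have "\<dots> = (\<lambda>_. 0)" by (rule dir_deriv_eq) simp
  finally show ?thesis .
qed

lemma dbar_plus_theta_section:
  assumes N: "connection A E N" and \<alpha>: "endo_one_form A E \<alpha>"
  shows "smooth_section A E (U \<inter> fst c) (\<lambda>y. dbar_plus_theta E N \<alpha> (const_section u) (cv b y))"
proof (rule smooth_sectionI[OF open_W])
  let ?W = "U \<inter> fst c"
  have s: "smooth_section A E U (const_section u)" by (rule smooth_const_section[OF open_U subset_refl])
  fix x assume "x \<in> ?W"
  thus "dbar_plus_theta E N \<alpha> (const_section u) (cv b x) \<in> fibre E x"
    using dbar_plus_theta_coords(1)[OF N \<alpha> s subset_refl] by blast
next
  let ?W = "U \<inter> fst c"
  have s: "smooth_section A E U (const_section u)" by (rule smooth_const_section[OF open_U subset_refl])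
  have sN: "smooth_fun A ?W (\<lambda>x. \<tau> (N (const_section u) (cv a x)))" for a
    by (rule smooth_section_coords(1)[OF connection_section[OF N]]) simp
  have s\<alpha>: "smooth_fun A ?W (\<lambda>x. \<tau> (\<alpha> (cv a x) (const_section u x)))" for a
    by (rule smooth_section_coords(1)[OF endo_form_section[OF \<alpha>]]) simp
  show "smooth_fun A ?W (\<lambda>x. \<tau> (dbar_plus_theta E N \<alpha> (const_section u) (cv b x)))"
  proof (rule smooth_fun_cong[OF open_W])
    show "smooth_fun A ?W (\<lambda>x. (1/2) *s (\<tau> (N (const_section u) (cv b x)) + \<i> *s \<tau> (N (const_section u) (cv (\<i> *s b) x)))
       + (1/2) *s (\<tau> (\<alpha> (cv b x) (const_section u x)) + (- \<i>) *s \<tau> (\<alpha> (cv (\<i> *s b) x) (const_section u x))))"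
      by (intro smooth_fun_add smooth_fun_scale smooth_fun_const sN s\<alpha>)
    fix x assume x: "x \<in> ?W"
    hence z: "snd c x \<in> \<Omega>" and xx: "x \<in> U" "x \<in> fst c" "pt (snd c x) = x" using chart by auto
    show "(1/2) *s (\<tau> (N (const_section u) (cv b x)) + \<i> *s \<tau> (N (const_section u) (cv (\<i> *s b) x)))
       + (1/2) *s (\<tau> (\<alpha> (cv b x) (const_section u x)) + (- \<i>) *s \<tau> (\<alpha> (cv (\<i> *s b) x) (const_section u x)))
       = \<tau> (dbar_plus_theta E N \<alpha> (const_section u) (cv b x))"
      unfolding dbar_plus_theta_coords(2)[OF N \<alpha> s subset_refl xx(1,2)] dir_deriv_const_section[OF z]
      using xx by (simp add: dbar_higgs_def higgs_part_def conn_form_def endo_form_def)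
  qed
qed simp

definition frame_metric :: "('e \<Rightarrow> 'e \<Rightarrow> complex) \<Rightarrow> complex ^ 'n \<Rightarrow> complex ^ 'r \<Rightarrow> complex ^ 'r \<Rightarrow> complex" where
  "frame_metric h z u v = h (const_section u (pt z)) (const_section v (pt z))"

lemma frame_metric_hermitian:
  assumes h: "hermitian_metric A E h" and z: "z \<in> \<Omega>"
  shows "hermitian_form (frame_metric h z)"
proof -
  note x = pt_in[OF z]
  have H: "h (vadd E e e') e'' = h e e'' + h e' e''" "h (vscale E k e) e' = k * h e e'" "h e' e = cnj (h e e')"
    "e \<noteq> vzero E (pt z) \<Longrightarrow> 0 < Re (h e e)"
    if "e \<in> fibre E (pt z)" "e' \<in> fibre E (pt z)" "e'' \<in> fibre E (pt z)" for e e' e'' k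
    using h[unfolded hermitian_metric_def, THEN conjunct1, rule_format, OF that(1,2)] that(3) by blast+
  note f = const_section_fibre[OF x(1)]
  have nz: "const_section u (pt z) \<noteq> vzero E (pt z)" if "u \<noteq> 0" for u
    using that trivialisation(3)[OF triv x(1)] triv_const_section[OF x(1), of u] by auto
  show ?thesis
    unfolding hermitian_form_def frame_metric_def const_section_add[OF x(1)] const_section_scale[OF x(1)]
    using H(1)[OF f f f] H(2)[OF f f f] H(3)[OF f f f] H(4)[OF f f f nz] by blast
qed

lemma metric_connectionD:
  assumes "metric_connection A E h N" "smooth_section A E W s" "smooth_section A E W t" "v \<in> tangent_bundle A" "fst v \<in> W"
  shows "mdiff A (\<lambda>x. h (s x) (t x)) v = h (N s v) (t (fst v)) + h (s (fst v)) (N t v)"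
  using assms(1)[unfolded metric_connection_def, THEN conjunct2, rule_format, of W s t v] assms(2-) by blast

lemma frame_metric_coords:
  assumes "x \<in> U" "x \<in> fst c" "e \<in> fibre E x" "e' \<in> fibre E x"
  shows "h e e' = frame_metric h (snd c x) (\<tau> e) (\<tau> e')"
  using assms chart by (simp add: frame_metric_def const_section_triv)

lemma metric_connection_coords:
  assumes N: "metric_connection A E h N" and s: "smooth_section A E W s" and t: "smooth_section A E W t"
    and W: "W \<subseteq> U" and x: "x \<in> W" "x \<in> fst c"
  shows "mdiff A (\<lambda>x. h (s x) (t x)) (cv a x) =
     frame_metric h (snd c x) (dir_deriv (\<lambda>z. \<tau> (s (pt z))) (snd c x) a + conn_form N (snd c x) a (\<tau> (s x))) (\<tau> (t x)) +
     frame_metric h (snd c x) (\<tau> (s x)) (dir_deriv (\<lambda>z. \<tau> (t (pt z))) (snd c x) a + conn_form N (snd c x) a (\<tau> (t x)))"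
proof -
  have N': "connection A E N" using N unfolding metric_connection_def by blast
  note tb = coord_vec_in_tangent_bundle[OF chart x(2), of a]
  have xU: "x \<in> U" using x W by blast
  have f: "N s (cv a x) \<in> fibre E x" "N t (cv a x) \<in> fibre E x"
    using bundle_one_form_fibre[OF connectionD(1)[OF N'] tb] s t x(1) by auto
  have g: "s x \<in> fibre E x" "t x \<in> fibre E x" using smooth_section_coords(3)[OF _ W x(1)] s t by blast+
  show ?thesis
    using metric_connectionD[OF N s t tb] x(1)
    by (simp add: frame_metric_coords[OF xU x(2) f(1) g(2)] frame_metric_coords[OF xU x(2) g(1) f(2)]
        connection_coords[OF N' s W x] connection_coords[OF N' t W x])
qed

lemma endo_form_self_adjoint:
  assumes \<alpha>: "hermitian_one_form A E h \<alpha>" and z: "z \<in> \<Omega>"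
  shows "frame_metric h z (endo_form \<alpha> z a u) v = frame_metric h z u (endo_form \<alpha> z a v)"
proof -
  note x = pt_in[OF z]
  note tb = coord_vec_in_tangent_bundle[OF chart x(2), of a]
  have \<alpha>': "endo_one_form A E \<alpha>" using \<alpha> unfolding hermitian_one_form_def by blast
  have f: "const_section u (pt z) \<in> fibre E (fst (cv a (pt z)))" for u using const_section_fibre[OF x(1)] by simp
  have af: "\<alpha> (cv a (pt z)) (const_section u (pt z)) \<in> fibre E (pt z)" for u
    using endo_one_formD(1)[OF \<alpha>' tb f] by simp
  have "h (\<alpha> (cv a (pt z)) (const_section u (pt z))) (const_section v (pt z)) = h (const_section u (pt z)) (\<alpha> (cv a (pt z)) (const_section v (pt z)))"
    using \<alpha>[unfolded hermitian_one_form_def, THEN conjunct2, rule_format, OF tb f f] .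
  thus ?thesis unfolding frame_metric_def endo_form_def by (simp add: const_section_triv[OF x(1) af])
qed

lemma mdiff_cong:
  assumes h: "smooth_fun A W f" and W: "open W" and fg: "\<And>x. x \<in> W \<Longrightarrow> f x = g x" and x: "x \<in> W" "x \<in> fst c"
  shows "mdiff A f (cv a x) = mdiff A g (cv a x)"
proof -
  have "dir_deriv (f \<circ> pt) (snd c x) = dir_deriv (g \<circ> pt) (snd c x)"
    by (rule dir_deriv_cong[OF open_chart_image_Int[OF chart W]]) (use x fg chart in auto)
  thus ?thesis
    using mdiff_smooth[OF h chart, of x a] mdiff_smooth[OF smooth_fun_cong[OF W fg h] chart, of x a] x
    unfolding dir_deriv_def by (metis IntI)
qed

text \<open>Both sides arise by differentiating \<open>h (\<alpha> s) t = h s (\<alpha> t)\<close> for sections \<open>s\<close> and \<open>t\<close> with constant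
  coordinates.\<close>
lemma endo_covariant_derivative_self_adjoint:
  assumes h: "hermitian_metric A E h" and N: "metric_connection A E h N" and \<alpha>: "hermitian_one_form A E h \<alpha>" and z: "z \<in> \<Omega>"
  shows "frame_metric h z (dir_deriv (\<lambda>z. endo_form \<alpha> z b u) z a + conn_form N z a (endo_form \<alpha> z b u) - endo_form \<alpha> z b (conn_form N z a u)) v =
     frame_metric h z u (dir_deriv (\<lambda>z. endo_form \<alpha> z b v) z a + conn_form N z a (endo_form \<alpha> z b v) - endo_form \<alpha> z b (conn_form N z a v))"
proof -
  let ?W = "U \<inter> fst c"
  note x = pt_in[OF z]
  have xW: "pt z \<in> ?W" using x by blast
  have \<alpha>': "endo_one_form A E \<alpha>" using \<alpha> unfolding hermitian_one_form_def by blast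
  define s where "s u y = \<alpha> (cv b y) (const_section u y)" for u y
  have ss: "smooth_section A E ?W (s u)" for u
    unfolding s_def by (rule endo_form_section[OF \<alpha>'])
  have sc: "smooth_section A E ?W (const_section u)" for u
    by (rule smooth_const_section[OF open_W]) simp
  have \<tau>s: "(\<lambda>z. \<tau> (s u (pt z))) = (\<lambda>z. endo_form \<alpha> z b u)" for u
    by (simp add: s_def endo_form_def)
  have sm: "smooth_fun A ?W (\<lambda>x. h (s u x) (const_section v x))"
    using h[unfolded hermitian_metric_def, THEN conjunct2, rule_format, of ?W "s u" "const_section v"] ss sc by blast
  have "mdiff A (\<lambda>x. h (s u x) (const_section v x)) (cv a (pt z)) = mdiff A (\<lambda>x. h (const_section u x) (s v x)) (cv a (pt z))"
  proof (rule mdiff_cong[OF sm open_W _ xW x(2)])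
    fix y assume y: "y \<in> ?W"
    note tb = coord_vec_in_tangent_bundle[OF chart, of y b]
    show "h (s u y) (const_section v y) = h (const_section u y) (s v y)"
      unfolding s_def using \<alpha>[unfolded hermitian_one_form_def, THEN conjunct2, rule_format, OF tb] const_section_fibre[of y] y by simp
  qed
  hence "frame_metric h z (dir_deriv (\<lambda>z. endo_form \<alpha> z b u) z a + conn_form N z a (endo_form \<alpha> z b u)) v + frame_metric h z (endo_form \<alpha> z b u) (conn_form N z a v)
     = frame_metric h z (conn_form N z a u) (endo_form \<alpha> z b v) + frame_metric h z u (dir_deriv (\<lambda>z. endo_form \<alpha> z b v) z a + conn_form N z a (endo_form \<alpha> z b v))"
    unfolding metric_connection_coords[OF N ss sc Int_lower1 xW x(2)] metric_connection_coords[OF N sc ss Int_lower1 xW x(2)]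
    using fun_cong[OF \<tau>s] by (simp add: x \<tau>s dir_deriv_const_section[OF z])
  thus ?thesis
    by (simp add: hermitian_formD[OF frame_metric_hermitian[OF h z]] endo_form_self_adjoint[OF \<alpha> z] algebra_simps)
qed

lemma decomposition_conn_form:
  assumes dec: "metric_decomposition A E D h N \<alpha>" and z: "z \<in> \<Omega>"
  shows "conn_form D z a u = conn_form N z a u + endo_form \<alpha> z a u"
proof -
  note x = pt_in[OF z]
  note tb = coord_vec_in_tangent_bundle[OF chart x(2), of a]
  have N: "connection A E N" and \<alpha>: "endo_one_form A E \<alpha>"
    using dec unfolding metric_decomposition_def metric_connection_def hermitian_one_form_def by blast+
  have s: "smooth_section A E U (const_section u)" by (rule smooth_const_section[OF open_U subset_refl])
  have "D (const_section u) (cv a (pt z)) = vadd E (N (const_section u) (cv a (pt z))) (\<alpha> (cv a (pt z)) (const_section u (pt z)))"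
    using dec[unfolded metric_decomposition_def, THEN conjunct2, THEN conjunct2, rule_format, OF s tb] x by simp
  moreover have "N (const_section u) (cv a (pt z)) \<in> fibre E (pt z)"
    using bundle_one_form_fibre[OF connectionD(1)[OF N s] tb] x by simp
  moreover have "\<alpha> (cv a (pt z)) (const_section u (pt z)) \<in> fibre E (pt z)"
    using endo_one_formD(1)[OF \<alpha> tb] const_section_fibre[OF x(1)] by simp
  ultimately show ?thesis using triv_add[OF x(1)] by (simp add: conn_form_def endo_form_def)
qed

text \<open>The difference of two decompositions is skew, as a difference of metric connections, and
  selfadjoint, as a difference of Hermitian forms.\<close>
lemma metric_decomposition_unique:
  assumes h: "hermitian_metric A E h" and 1: "metric_decomposition A E D h N \<alpha>" and 2: "metric_decomposition A E D h N' \<alpha>'"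
    and z: "z \<in> \<Omega>"
  shows "endo_form \<alpha> z a u = endo_form \<alpha>' z a u"
proof -
  note x = pt_in[OF z]
  note hD = hermitian_formD[OF frame_metric_hermitian[OF h z]]
  have s: "smooth_section A E U (const_section u)" for u by (rule smooth_const_section[OF open_U subset_refl])
  have N: "metric_connection A E h N" "metric_connection A E h N'" 
    and \<alpha>: "hermitian_one_form A E h \<alpha>" "hermitian_one_form A E h \<alpha>'"
    using 1 2 unfolding metric_decomposition_def by blast+
  define \<delta> where "\<delta> u = endo_form \<alpha> z a u - endo_form \<alpha>' z a u" for u
  have \<delta>: "conn_form N' z a u = conn_form N z a u + \<delta> u" for u
    using decomposition_conn_form[OF 1 z, of a u] decomposition_conn_form[OF 2 z, of a u] by (simp add: \<delta>_def algebra_simps)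
  have skew: "frame_metric h z (\<delta> u) v + frame_metric h z u (\<delta> v) = 0" for u v
    using metric_connection_coords[OF N(1) s[of u] s[of v] subset_refl x(1,2), of a]
      metric_connection_coords[OF N(2) s[of u] s[of v] subset_refl x(1,2), of a]
    by (simp add: x dir_deriv_const_section[OF z] \<delta> hD)
  have self: "frame_metric h z (\<delta> u) v = frame_metric h z u (\<delta> v)" for u v
    by (simp add: \<delta>_def hD endo_form_self_adjoint[OF \<alpha>(1) z] endo_form_self_adjoint[OF \<alpha>(2) z])
  have "frame_metric h z (\<delta> u) v = 0" for v
    using skew[of u v] self[of u v] by simp
  hence "\<delta> u = 0" by (rule hD(9))
  thus ?thesis by (simp add: \<delta>_def)
qed

theorem harmonic_frame_of_bundle:
  assumes flat: "flat_connection A E D" and h: "hermitian_metric A E h" and dec: "metric_decomposition A E D h N \<alpha>"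
    and harm: "squares_to_zero A E (dbar_plus_theta E N \<alpha>)"
  shows "harmonic_frame \<Omega> (conn_form N) (endo_form \<alpha>) (frame_metric h)"
proof -
  have mN: "metric_connection A E h N" and h\<alpha>: "hermitian_one_form A E h \<alpha>"
    using dec unfolding metric_decomposition_def by blast+
  have N: "connection A E N" and \<alpha>: "endo_one_form A E \<alpha>"
    using mN h\<alpha> unfolding metric_connection_def hermitian_one_form_def by blast+
  have D: "connection A E D" and DD: "squares_to_zero A E D" using flat unfolding flat_connection_def by blast+
  have s: "smooth_section A E U (const_section u)" for u by (rule smooth_const_section[OF open_U subset_refl])
  show ?thesis
  proof
    fix z a u v k b assume z: "z \<in> \<Omega>"
    note x = pt_in[OF z]
    have xW: "pt z \<in> U \<inter> fst c" using x by blast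
    let ?DD = "\<lambda>a b. dir_deriv (\<lambda>z. conn_form N z b u + endo_form \<alpha> z b u) z a + (conn_form N z a (conn_form N z b u + endo_form \<alpha> z b u) + endo_form \<alpha> z a (conn_form N z b u + endo_form \<alpha> z b u))"
    have D2: "\<tau> (D (\<lambda>y. D (const_section u) (cv b y)) (cv a (pt z))) =
        ?DD a b" for a b
    proof -
      have d: "dir_deriv (\<lambda>z. \<tau> (D (const_section u) (cv b (pt z)))) z = dir_deriv (\<lambda>z. conn_form N z b u + endo_form \<alpha> z b u) z"
        by (rule dir_deriv_cong[OF open_\<Omega> z]) (simp only: decomposition_conn_form[OF dec, symmetric] conn_form_def[of D])
      have e: "\<tau> (D (const_section u) (cv b (pt z))) = conn_form N z b u + endo_form \<alpha> z b u"
        by (simp only: decomposition_conn_form[OF dec z, symmetric] conn_form_def[of D])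
      show ?thesis
        using connection_coords[OF D connection_section[OF D] Int_lower1 xW x(2), of u b a]
        by (simp add: x d e decomposition_conn_form[OF dec z])
    qed
    show "?DD a b =
       ?DD b a"
      using DD[unfolded squares_to_zero_def, rule_format, OF s chart xW, of u b a] D2[of a b] D2[of b a] by simp
    let ?PP = "\<lambda>a b. frame_dbar N \<alpha> z (dir_deriv (\<lambda>z. frame_dbar N \<alpha> z (\<lambda>_. 0) u b) z) (frame_dbar N \<alpha> z (\<lambda>_. 0) u b) a"
    have P2: "\<tau> (dbar_plus_theta E N \<alpha> (\<lambda>y. dbar_plus_theta E N \<alpha> (const_section u) (cv b y)) (cv a (pt z))) =
        ?PP a b" for a b
    proof -
      have e: "\<tau> (dbar_plus_theta E N \<alpha> (const_section u) (cv b (pt z))) = frame_dbar N \<alpha> z (\<lambda>_. 0) u b" if z: "z \<in> \<Omega>" for z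
        using dbar_plus_theta_coords(2)[OF N \<alpha> s subset_refl pt_in(1,2)[OF z], of u b]
        by (simp add: pt_in[OF z] dir_deriv_const_section[OF z])
      have d: "dir_deriv (\<lambda>z. \<tau> (dbar_plus_theta E N \<alpha> (const_section u) (cv b (pt z)))) z = dir_deriv (\<lambda>z. frame_dbar N \<alpha> z (\<lambda>_. 0) u b) z"
        by (rule dir_deriv_cong[OF open_\<Omega> z]) (rule e)
      show ?thesis
        using dbar_plus_theta_coords(2)[OF N \<alpha> dbar_plus_theta_section[OF N \<alpha>] Int_lower1 xW x(2), of u b a]
        by (simp only: x(3) d e[OF z])
    qed
    show "?PP a b =
      ?PP b a"
      using harm[unfolded squares_to_zero_def, rule_format, OF s chart xW, of u b a] P2[of a b] P2[of b a] by simp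
    show "frame_metric h z (dir_deriv (\<lambda>z. endo_form \<alpha> z b u) z a + conn_form N z a (endo_form \<alpha> z b u) - endo_form \<alpha> z b (conn_form N z a u)) v =
     frame_metric h z u (dir_deriv (\<lambda>z. endo_form \<alpha> z b v) z a + conn_form N z a (endo_form \<alpha> z b v) - endo_form \<alpha> z b (conn_form N z a v))"
      by (rule endo_covariant_derivative_self_adjoint[OF h mN h\<alpha> z])
  qed (simp_all add: open_\<Omega> conn_form_C1[OF N] endo_form_C1[OF \<alpha>]
      linear_add[OF conn_form_real_linear[OF N]] linear_scale[OF conn_form_real_linear[OF N]]
      linear_add[OF endo_form_real_linear[OF \<alpha>]] linear_scale[OF endo_form_real_linear[OF \<alpha>]]
      conn_form_complex_linear[OF N] endo_form_complex_linear[OF \<alpha>] frame_metric_hermitian[OF h]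
      endo_form_self_adjoint[OF h\<alpha>])
qed

end

context manifold
begin

section \<open>First integrals of the Higgs kernel\<close>

lemma holo_fun_from_chart:
  assumes c: "c \<in> A" and W: "open W" "W \<subseteq> fst c" and h: "holo_on h (snd c ` W)" and f: "\<And>x. x \<in> W \<Longrightarrow> f x = h (snd c x)"
  shows "holo_fun A W f"
  unfolding holo_fun_def holo_on_def
proof (intro ballI)
  fix c' z assume c': "c' \<in> A" and "z \<in> snd c' ` (fst c' \<inter> W)"
  then obtain x where x: "x \<in> fst c'" "x \<in> W" "z = snd c' x" by blast
  have op: "open (snd c ` W)" using open_chart_image_Int[OF c W(1)] W(2) by (simp add: Int_absorb1)
  have xx: "x \<in> fst c' \<inter> fst c" and mem: "snd c x \<in> snd c ` W" using x W(2) by blast+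
  obtain D where D: "(h has_derivative D) (at (snd c x))" "\<And>k v. D (k *s v) = k * D v"
    using h mem unfolding holo_on_def by blast
  have "((f \<circ> chart_inv c) has_derivative D) (at (snd c x))"
    by (rule has_derivative_transform_within_open[OF D(1) op mem]) (use f W(2) c in auto)
  from chart_change_derivative[OF c' c xx this]
  have "((f \<circ> chart_inv c') has_derivative (\<lambda>a. D (transition_deriv c' c x a))) (at z)" by (simp add: x(3))
  moreover have "D (transition_deriv c' c x (k *s a)) = k * D (transition_deriv c' c x a)" for k a
    by (simp add: transition_derivative(2)[OF c' c xx] D(2))
  ultimately show "\<exists>f'. ((f \<circ> chart_inv c') has_derivative f') (at z) \<and> (\<forall>k v. f' (k *s v) = k * f' v)" by blast
qed

lemma holo_fun_mdiff:
  assumes f: "holo_fun A V f" and c: "c \<in> A" and x: "x \<in> V \<inter> fst c"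
  shows "mdiff A f (coord_vec A c a x) = frechet_derivative (f \<circ> chart_inv c) (at (snd c x)) a"
proof (rule mdiff_coord_vec[OF c])
  fix c' assume "c' \<in> A" "x \<in> fst c'"
  hence "holo_on (f \<circ> chart_inv c') (snd c' ` (fst c' \<inter> V))" "snd c' x \<in> snd c' ` (fst c' \<inter> V)"
    using f x unfolding holo_fun_def by blast+
  from holo_onD(1)[OF this] show "(f \<circ> chart_inv c') differentiable (at (snd c' x))" by (rule differentiableI)
qed (use x in blast)

lemma holo_one_form_mdiff:
  assumes V: "open V" and f: "holo_fun A V f"
  shows "holo_one_form A V (mdiff A f)"
  unfolding holo_one_form_def
proof (intro conjI ballI impI allI; (elim conjE)?)
  fix v w k assume v: "v \<in> tangent_bundle A" and w: "w \<in> tangent_bundle A" and x: "fst v \<in> V" "fst w = fst v"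
  obtain c where c: "c \<in> A" "fst v \<in> fst c" using chart_cover by blast
  define a b where "a = snd v c" and "b = snd w c"
  have eq: "v = coord_vec A c a (fst v)" "w = coord_vec A c b (fst v)"
    using tangent_vector_eq_coord_vec[OF v c] tangent_vector_eq_coord_vec[OF w c(1)] c(2) x(2) by (simp_all add: a_def b_def)
  have xc: "fst v \<in> V \<inter> fst c" using x c by blast
  have hol: "holo_on (f \<circ> chart_inv c) (snd c ` (fst c \<inter> V))" "snd c (fst v) \<in> snd c ` (fst c \<inter> V)"
    using f c x unfolding holo_fun_def by blast+
  note D = holo_onD[OF hol]
  show "mdiff A f (tadd v w) = mdiff A f v + mdiff A f w"
    by (subst (1 2) eq(1), subst (1 2) eq(2))
       (simp add: tadd_coord_vec[OF c] holo_fun_mdiff[OF f c(1) xc] linear_add[OF has_derivative_linear[OF D(1)]])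
  show "mdiff A f (tscale k v) = k * mdiff A f v"
    by (subst (1 2) eq(1)) (simp add: tscale_coord_vec[OF c] holo_fun_mdiff[OF f c(1) xc] D(2))
next
  fix c a assume c: "c \<in> A"
  have op: "open (V \<inter> fst c)" using V open_chart[OF c] by blast
  have e: "V \<inter> fst c = fst c \<inter> V" by blast
  have "holo_on (f \<circ> chart_inv c) (snd c ` (V \<inter> fst c))" using f c unfolding holo_fun_def e by blast
  hence "holo_on (\<lambda>z. frechet_derivative (f \<circ> chart_inv c) (at z) a) (snd c ` (V \<inter> fst c))"
    by (rule holo_on_directional_derivative) (simp add: e open_chart_image_Int[OF c V])
  thus "holo_fun A (V \<inter> fst c) (\<lambda>x. mdiff A f (coord_vec A c a x))"
    by (rule holo_fun_from_chart[OF c op Int_lower2]) (use holo_fun_mdiff[OF f c] in auto)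
qed

end

lemma higgs_part_complex_linear:
  assumes "linear (\<lambda>a. \<alpha> a u)"
  shows "higgs_part \<alpha> (k *s a) u = k *s higgs_part \<alpha> a u"
proof -
  note add = linear_add[OF assms] and scale = linear_scale[OF assms]
  have "k *s a = Re k *\<^sub>R a + Im k *\<^sub>R (\<i> *s a)"
    unfolding vector_scale_of_real[symmetric] by (simp add: vec_eq_iff complex_eq_iff)
  hence 1: "\<alpha> (k *s a) u = complex_of_real (Re k) *s \<alpha> a u + complex_of_real (Im k) *s \<alpha> (\<i> *s a) u"
    by (simp add: add scale vector_scale_of_real)
  have "\<i> *s (k *s a) = Re k *\<^sub>R (\<i> *s a) + (- Im k) *\<^sub>R a"
    unfolding vector_scale_of_real[symmetric] by (simp add: vec_eq_iff complex_eq_iff)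
  hence 2: "\<alpha> (\<i> *s (k *s a)) u = complex_of_real (Re k) *s \<alpha> (\<i> *s a) u + complex_of_real (- Im k) *s \<alpha> a u"
    by (simp only: add scale vector_scale_of_real)
  show ?thesis
    unfolding higgs_part_def 1 2 by (simp add: vec_eq_iff complex_eq_iff algebra_simps diff_divide_distrib add_divide_distrib)
qed

context bundle_chart
begin

text \<open>The functions are the entries of the matrix \<open>F\<close> of \<open>higgs_potential\<close>. Since \<open>dF = g\<^sup>-\<^sup>1 \<theta> g\<close> with \<open>\<theta>\<close>
  complex linear in the direction and \<open>g\<close> complex linear, they are holomorphic, and since \<open>g\<close> is
  invertible, all \<open>dF\<close> vanish on a tangent vector exactly if \<open>\<theta>\<close> does.\<close>
theorem higgs_kernel_local_first_integrals:
  assumes flat: "flat_connection A E D" and h: "hermitian_metric A E h" and dec: "metric_decomposition A E D h N \<alpha>"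
    and harm: "squares_to_zero A E (dbar_plus_theta E N \<alpha>)" and p: "p \<in> U" "p \<in> fst c"
  obtains V Fs where "open V" "p \<in> V" "finite Fs" "\<And>f. f \<in> Fs \<Longrightarrow> holo_fun A V f"
    "\<And>v. v \<in> tangent_bundle A \<Longrightarrow> fst v \<in> V \<Longrightarrow>
       (\<forall>e\<in>fibre E (fst v). form10 E \<alpha> v e = vzero E (fst v)) \<longleftrightarrow> (\<forall>f\<in>Fs. mdiff A f v = 0)"
proof -
  have \<alpha>: "endo_one_form A E \<alpha>" using dec unfolding metric_decomposition_def hermitian_one_form_def by blast
  interpret harmonic_frame \<Omega> "conn_form N" "endo_form \<alpha>" "frame_metric h"
    by (rule harmonic_frame_of_bundle[OF flat h dec harm])
  have "snd c p \<in> \<Omega>" using p by blast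
  then obtain r and F g :: "complex ^ 'n \<Rightarrow> complex ^ 'r \<Rightarrow> complex ^ 'r"
    where r: "r > 0" "ball (snd c p) r \<subseteq> \<Omega>"
    and g: "\<And>z. z \<in> ball (snd c p) r \<Longrightarrow> linear (g z) \<and> bij (g z)"
    and gs: "\<And>z k u. z \<in> ball (snd c p) r \<Longrightarrow> g z (k *s u) = k *s g z u"
    and dF: "\<And>z u. z \<in> ball (snd c p) r \<Longrightarrow>
        ((\<lambda>z. F z u) has_derivative (\<lambda>a. inv (g z) (higgs_part (endo_form \<alpha> z) a (g z u)))) (at z)"
    by (rule higgs_potential) (rule that, (assumption | blast)+)
  define V where "V = (fst c \<inter> snd c -` ball (snd c p) r) \<inter> U"
  have cont: "continuous_on (fst c) (snd c)" using homeomorphism_cont1[OF chart_homeo[OF chart]] .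
  have V: "open V" unfolding V_def
    by (intro open_Int continuous_open_preimage[OF cont open_chart[OF chart] open_ball] open_U)
  have pV: "p \<in> V" using p r by (simp add: V_def)
  have Vc: "V \<subseteq> fst c" by (auto simp: V_def)
  have zV: "snd c x \<in> ball (snd c p) r" "snd c x \<in> \<Omega>" "x \<in> U" "x \<in> fst c" if "x \<in> V" for x
    using that by (auto simp: V_def)
  define dF' where "dF' z u a = inv (g z) (higgs_part (endo_form \<alpha> z) a (g z u))" for z u a
  have inv_scale: "inv (g z) (k *s y) = k *s inv (g z) y" if z: "z \<in> ball (snd c p) r" for z k y
  proof (rule injD[OF bij_is_inj])
    show "bij (g z)" using g[OF z] by blast
    hence "g z (inv (g z) y) = y" for y by (simp add: bij_is_surj surj_f_inv_f)
    thus "g z (inv (g z) (k *s y)) = g z (k *s inv (g z) y)" by (simp add: gs[OF z])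
  qed
  have dF'_scale: "dF' z u (k *s a) = k *s dF' z u a" if z: "z \<in> ball (snd c p) r" "z \<in> \<Omega>" for z u k a
    by (simp add: dF'_def higgs_part_complex_linear[of "endo_form \<alpha> z", OF endo_form_real_linear[OF \<alpha> z(2)]] inv_scale[OF z(1)])
  define f where "f j k x = F (snd c x) (axis k 1) $ j" for j k x
  have dFj: "((\<lambda>z. F z u $ j) has_derivative (\<lambda>a. dF' z u a $ j)) (at z)" if "z \<in> ball (snd c p) r" for z u j
    unfolding dF'_def by (rule bounded_linear.has_derivative[OF bounded_linear_vec_nth dF[OF that]])
  have hol: "holo_fun A V (f j k)" for j k
  proof (rule holo_fun_from_chart[OF chart V Vc])
    show "holo_on (\<lambda>z. F z (axis k 1) $ j) (snd c ` V)"
      unfolding holo_on_def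
    proof
      fix z assume "z \<in> snd c ` V"
      hence z: "z \<in> ball (snd c p) r" "z \<in> \<Omega>" using zV by blast+
      show "\<exists>f'. ((\<lambda>z. F z (axis k 1) $ j) has_derivative f') (at z) \<and> (\<forall>c v. f' (c *s v) = c * f' v)"
        by (rule exI[of _ "\<lambda>a. dF' z (axis k 1) a $ j"]) (simp add: dFj[OF z(1)] dF'_scale[OF z])
    qed
  qed (simp add: f_def)
  have md: "mdiff A (f j k) (cv a x) = dF' (snd c x) (axis k 1) a $ j" if x: "x \<in> V" for j k a x
  proof -
    have "((f j k \<circ> pt) has_derivative (\<lambda>a. dF' (snd c x) (axis k 1) a $ j)) (at (snd c x))"
      by (rule has_derivative_transform_within_open[OF dFj[OF zV(1)[OF x]] open_chart_image_Int[OF chart V]])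
         (use x zV(4) chart in \<open>auto simp: f_def\<close>)
    thus ?thesis
      using holo_fun_mdiff[OF hol chart, of x j k a] x zV(4) dir_deriv_eq[of "f j k \<circ> pt" _ "snd c x"] by (simp add: dir_deriv_def[abs_def])
  qed
  show thesis
  proof (rule that[OF V pV])
    show "finite (range (\<lambda>(j, k). f j k))" by simp
    show "holo_fun A V q" if "q \<in> range (\<lambda>(j, k). f j k)" for q using that hol by auto
    fix v assume v: "v \<in> tangent_bundle A" "fst v \<in> V"
    define x a where "x = fst v" and "a = snd v c"
    have x: "x \<in> V" "x \<in> U" "x \<in> fst c" using v zV by (auto simp: x_def)
    have va: "v = cv a x" using tangent_vector_eq_coord_vec[OF v(1) chart] x by (simp add: x_def a_def)
    let ?z = "snd c x"
    let ?\<theta> = "higgs_part (endo_form \<alpha> ?z) a"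
    have z: "?z \<in> ball (snd c p) r" "?z \<in> \<Omega>" using zV[OF x(1)] by blast+
    have lin: "linear (g ?z)" and bij: "bij (g ?z)" using g[OF z(1)] by blast+
    have \<theta>add: "?\<theta> (u + w) = ?\<theta> u + ?\<theta> w" and \<theta>scale: "?\<theta> (k *s u) = k *s ?\<theta> u" for u w k
      by (simp_all add: higgs_part_def endo_form_complex_linear[OF \<alpha> z(2)] vec_eq_iff algebra_simps)
    have \<theta>0: "?\<theta> 0 = 0" using \<theta>scale[of 0 0] by simp
    have inv0: "inv (g ?z) y = 0 \<longleftrightarrow> y = 0" for y
      using linear_0[OF lin] bij by (metis bij_inv_eq_iff)
    have "(\<forall>e\<in>fibre E x. form10 E \<alpha> v e = vzero E x) \<longleftrightarrow> (\<forall>u. ?\<theta> u = 0)"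
    proof -
      have "form10 E \<alpha> v e = vzero E x \<longleftrightarrow> ?\<theta> (\<tau> e) = 0" if e: "e \<in> fibre E x" for e
        using form10_coords[OF \<alpha> x(2,3) e, of a] trivialisation(3)[OF triv x(2)] triv_inj[OF x(2)] unfolding va by metis
      thus ?thesis using const_section_fibre[OF x(2)] triv_const_section[OF x(2)] by metis
    qed
    also have "\<dots> \<longleftrightarrow> (\<forall>k. ?\<theta> (g ?z (axis k 1)) = 0)"
    proof
      assume 0: "\<forall>k. ?\<theta> (g ?z (axis k 1)) = 0"
      have s: "?\<theta> (g ?z (\<Sum>k\<in>K. u $ k *s axis k 1)) = (\<Sum>k\<in>K. u $ k *s ?\<theta> (g ?z (axis k 1)))" for K u
        by (induction K rule: infinite_finite_induct)
           (auto simp: linear_0[OF lin] linear_add[OF lin] gs[OF z(1)] \<theta>0 \<theta>add \<theta>scale)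
      have "?\<theta> (g ?z u) = 0" for u using s[of u UNIV] by (simp add: basis_expansion 0)
      thus "\<forall>u. ?\<theta> u = 0" using bij by (metis bij_is_surj surj_f_inv_f)
    qed blast
    also have "\<dots> \<longleftrightarrow> (\<forall>q\<in>range (\<lambda>(j, k). f j k). mdiff A q v = 0)"
    proof -
      have "?\<theta> (g ?z (axis k 1)) = 0 \<longleftrightarrow> dF' ?z (axis k 1) a = 0" for k
        by (simp add: dF'_def inv0)
      also have "\<dots> k \<longleftrightarrow> (\<forall>j. mdiff A (f j k) v = 0)" for k
        by (simp add: va md[OF x(1)] vec_eq_iff)
      finally show ?thesis by auto
    qed
    finally show "(\<forall>e\<in>fibre E (fst v). form10 E \<alpha> v e = vzero E (fst v)) \<longleftrightarrow> (\<forall>q\<in>range (\<lambda>(j, k). f j k). mdiff A q v = 0)"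
      by (simp add: x_def)
  qed
qed

lemma form10_decomposition_unique:
  assumes h: "hermitian_metric A E h" and 1: "metric_decomposition A E D h N \<alpha>" and 2: "metric_decomposition A E D h N' \<alpha>'"
    and v: "v \<in> tangent_bundle A" "fst v \<in> U" "fst v \<in> fst c" and e: "e \<in> fibre E (fst v)"
  shows "form10 E \<alpha> v e = form10 E \<alpha>' v e"
proof -
  have \<alpha>: "endo_one_form A E \<alpha>" "endo_one_form A E \<alpha>'"
    using 1 2 unfolding metric_decomposition_def hermitian_one_form_def by blast+
  have z: "snd c (fst v) \<in> \<Omega>" using v by blast
  have "\<tau> (form10 E \<alpha> (cv (snd v c) (fst v)) e) = \<tau> (form10 E \<alpha>' (cv (snd v c) (fst v)) e)"
    by (simp add: form10_coords(2)[OF \<alpha>(1) v(2,3) e] form10_coords(2)[OF \<alpha>(2) v(2,3) e] higgs_part_def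
        metric_decomposition_unique[OF h 1 2 z])
  hence "form10 E \<alpha> (cv (snd v c) (fst v)) e = form10 E \<alpha>' (cv (snd v c) (fst v)) e"
    by (rule triv_inj[OF v(2) form10_coords(1)[OF \<alpha>(1) v(2,3) e] form10_coords(1)[OF \<alpha>(2) v(2,3) e]])
  thus ?thesis using tangent_vector_eq_coord_vec[OF v(1) chart v(3)] by simp
qed

end

theorem theorem4:
  fixes A :: "('x::{t2_space, second_countable_topology}, 'n::finite) chart set"
    and E :: "('x, 'e, 'r::finite) vbundle"
    and D :: "('x \<Rightarrow> 'e) \<Rightarrow> ('x, 'n) tvec \<Rightarrow> 'e"
    and h :: "'e \<Rightarrow> 'e \<Rightarrow> complex"
    and \<theta> :: "('x, 'n) tvec \<Rightarrow> 'e \<Rightarrow> 'e"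
  assumes "complex_manifold A"
    and "harmonic_bundle A E D h"
    and "higgs_field A E D h \<theta>"
  shows "holomorphic_distribution A (higgs_kernel A E \<theta>) \<and>
         integrable_distribution A (higgs_kernel A E \<theta>)"
proof -
  interpret manifold A by (rule manifold.intro) (rule assms(1))
  have vb: "smooth_vector_bundle A E" and flat: "flat_connection A E D" and h: "hermitian_metric A E h"
    using assms(2) unfolding harmonic_bundle_def by blast+
  obtain N \<alpha> where dec: "metric_decomposition A E D h N \<alpha>" and harm: "squares_to_zero A E (dbar_plus_theta E N \<alpha>)"
    using assms(2) unfolding harmonic_bundle_def by blast
  obtain N' \<alpha>' where dec': "metric_decomposition A E D h N' \<alpha>'"
    and \<theta>: "\<And>v e. v \<in> tangent_bundle A \<Longrightarrow> e \<in> fibre E (fst v) \<Longrightarrow> \<theta> v e = form10 E \<alpha>' v e"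
    using assms(3) unfolding higgs_field_def by blast
  have main: "\<exists>V Fs. open V \<and> p \<in> V \<and> finite Fs \<and> (\<forall>f\<in>Fs. holo_fun A V f) \<and>
      (\<forall>v\<in>tangent_bundle A. fst v \<in> V \<longrightarrow> (v \<in> higgs_kernel A E \<theta> \<longleftrightarrow> (\<forall>f\<in>Fs. mdiff A f v = 0)))" for p
  proof -
    obtain c where c: "c \<in> A" "p \<in> fst c" using chart_cover by blast
    have "(\<Union>(U, \<tau>)\<in>trivs E. U) = UNIV"
      using vb[unfolded smooth_vector_bundle_def, THEN conjunct1] .
    hence "p \<in> (\<Union>(U, \<tau>)\<in>trivs E. U)" by (simp only: UNIV_I)
    then obtain U \<tau> where U: "(U, \<tau>) \<in> trivs E" "p \<in> U" by (elim UN_E) (auto split: prod.splits)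
    interpret bundle_chart A E U \<tau> c by unfold_locales (fact vb U(1) c(1))+
    obtain V Fs where V: "open V" "p \<in> V" "finite Fs" and hol: "\<And>f. f \<in> Fs \<Longrightarrow> holo_fun A V f"
      and ker: "\<And>v. v \<in> tangent_bundle A \<Longrightarrow> fst v \<in> V \<Longrightarrow>
       (\<forall>e\<in>fibre E (fst v). form10 E \<alpha> v e = vzero E (fst v)) \<longleftrightarrow> (\<forall>f\<in>Fs. mdiff A f v = 0)"
      by (rule higgs_kernel_local_first_integrals[OF flat h dec harm U(2) c(2)]) blast
    let ?V = "V \<inter> (U \<inter> fst c)"
    show ?thesis
    proof (intro exI[of _ ?V] exI[of _ Fs] conjI ballI impI)
      show "open ?V" using V(1) open_W by blast
      show "p \<in> ?V" using V(2) U(2) c(2) by blast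
      show "finite Fs" by (rule V(3))
      show "holo_fun A ?V f" if "f \<in> Fs" for f
        using hol[OF that] unfolding holo_fun_def holo_on_def by blast
      fix v assume v: "v \<in> tangent_bundle A" "fst v \<in> ?V"
      have "\<theta> v e = form10 E \<alpha> v e" if "e \<in> fibre E (fst v)" for e
        using \<theta>[OF v(1) that] form10_decomposition_unique[OF h dec dec' v(1) _ _ that] v(2) by simp
      thus "v \<in> higgs_kernel A E \<theta> \<longleftrightarrow> (\<forall>f\<in>Fs. mdiff A f v = 0)"
        using ker[OF v(1)] v unfolding higgs_kernel_def by simp
    qed
  qed
  show ?thesis
  proof
    show "integrable_distribution A (higgs_kernel A E \<theta>)"
      unfolding integrable_distribution_def using main by blast
    show "holomorphic_distribution A (higgs_kernel A E \<theta>)"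
      unfolding holomorphic_distribution_def
    proof (intro conjI allI)
      show "higgs_kernel A E \<theta> \<subseteq> tangent_bundle A" unfolding higgs_kernel_def by blast
      fix p
      obtain V Fs where V: "open V" "p \<in> V" "finite Fs" "\<forall>f\<in>Fs. holo_fun A V f"
        "\<forall>v\<in>tangent_bundle A. fst v \<in> V \<longrightarrow> (v \<in> higgs_kernel A E \<theta> \<longleftrightarrow> (\<forall>f\<in>Fs. mdiff A f v = 0))"
        using main[of p] by blast
      show "\<exists>U W. open U \<and> p \<in> U \<and> finite W \<and> (\<forall>\<omega>\<in>W. holo_one_form A U \<omega>) \<and>
        (\<forall>v\<in>tangent_bundle A. fst v \<in> U \<longrightarrow> (v \<in> higgs_kernel A E \<theta> \<longleftrightarrow> (\<forall>\<omega>\<in>W. \<omega> v = 0)))"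
        by (rule exI[of _ V], rule exI[of _ "mdiff A ` Fs"]) (use V holo_one_form_mdiff[OF V(1)] in simp)
    qed
  qed
qed

end
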